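(* Let $(X,T,\alpha)$ be a full fibred system, and suppose that the $\sigma$-finite measure $\mu$ on $X$ is $\mathcal E(X,T,\alpha)$-invariant. (1) If $\mu$ is topologically $\sigma$-finite and recurrent, then $\mu$ is a mixture of $(X,T,\alpha)$-product probability measures. (2) If $\mu$ is locally finite, then $\mu$ is recurrent, and hence (by (1)) a mixture of $(X,T,\alpha)$-product probability measures.
   Context: A fibred system is a triple $(X,T,\alpha)$ where $X$ is a standard measurable space, $T:X\to X$ is measurable, and $\alpha$ is a finite or countable partition of $X$ into measurable sets such that $\bigvee_{i\ge 0}T^{-i}\alpha$ generates the $\sigma$-algebra $\mathcal B(X)$ and, for every $A\in\alpha$, $T|_A:A\to TA$ is invertible and bi-measurable. It is full if $TA=X$ for all $A\in\alpha$. Let $\alpha_k=\bigvee_{j=0}^{k-1}T^{-j}\alpha$; its elements are the cylinders $[a_0,\dots,a_{k-1}]=\bigcap_{j=0}^{k-1}T^{-j}a_j$ of length $k$. $X$ carries the topology generated by the cylinders. Let $\pi:X\to\alpha^{\mathbb N}$ be the (injective) coding map, $T^{n-1}x\in\pi(x)_n\in\alpha$. The exchangeable relation $\mathcal E(X,T,\alpha)$ is the set of $(x,y)\in X\times X$ such that $\pi(y)$ is obtained from $\pi(x)$ by a permutation of $\mathbb N$ moving only finitely many coordinates. For a countable Borel equivalence relation $\mathcal R$ on $X$, an $\mathcal R$-holonomy is a bi-measurable bijection $\kappa:A\to B$ between measurable sets with $(x,\kappa(x))\in\mathcal R$ for all $x\in A$; $\mu$ is $\mathcal R$-invariant if $\mu(\kappa(C))=\mu(C)$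 for every holonomy $\kappa:A\to B$ and measurable $C\subseteq A$. $\mu$ is locally finite if $X$ has a countable cover by open sets of finite $\mu$-measure; $\mu$ is topologically $\sigma$-finite if it is locally finite on some Borel subset of full $\mu$-measure (with the relative topology). $\mu$ is recurrent if for every $a\in\alpha$, $N_a:=\sum_{n=0}^\infty 1_a\circ T^n\in\{0,\infty\}$ $\mu$-a.e. A $(X,T,\alpha)$-product measure is a probability measure $m$ on $X$ with $m\big(\bigcap_{j=0}^nT^{-j}A_j\big)=\prod_{j=0}^n m(A_j)$ for all $n\ge0$ and $A_0,\dots,A_n\in\alpha$. A mixture of measures of a given kind is a measure $\mu$ of the form $\mu(B)=\int_\Omega\mu_\omega(B)\,d\nu(\omega)$ for all measurable $B$, where $(\Omega,\mathcal F,\nu)$ is a $\sigma$-finite (possibly infinite) measure space, each $\mu_\omega$ is a measure of that kind, and $\omega\mapsto\mu_\omega(B)$ is measurable for each measurable $B$. *)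

theory Defs
  imports "HOL-Probability.Probability"
begin

text \<open>
  A measurable space is represented by a measure \<open>M\<close> of which only \<open>space M\<close> and \<open>sets M\<close> matter;
  a measure on it is a \<open>\<mu>\<close> with \<open>sets \<mu> = sets M\<close>.
\<close>

definition standard_measurable_space :: "'a measure \<Rightarrow> bool" where
  "standard_measurable_space M \<longleftrightarrow>
     (\<exists>S. completely_metrizable_space S \<and> separable_space S \<and> topspace S = space M \<and>
          sets M = sigma_sets (space M) {U. openin S U})"

definition bimeasurable_bij :: "'a measure \<Rightarrow> 'a set \<Rightarrow> 'a set \<Rightarrow> ('a \<Rightarrow> 'a) \<Rightarrow> bool" where
  "bimeasurable_bij M A B f \<longleftrightarrow>
     bij_betw f A B \<and>
     f \<in> measurable (restrict_space M A) (restrict_space M B) \<and>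
     the_inv_into A f \<in> measurable (restrict_space M B) (restrict_space M A)"

locale fibred_system =
  fixes M :: "'a measure" and T :: "'a \<Rightarrow> 'a" and \<alpha> :: "'a set set"
  assumes standard: "standard_measurable_space M"
    and T_measurable: "T \<in> measurable M M"
    and countable_partition: "countable \<alpha>"
    and partition: "partition_on (space M) \<alpha>"
    and partition_measurable: "\<alpha> \<subseteq> sets M"
    and generating: "sets M = sigma_sets (space M) {(T ^^ i) -` A \<inter> space M | i A. A \<in> \<alpha>}"
    and branches: "\<And>A. A \<in> \<alpha> \<Longrightarrow> bimeasurable_bij M A (T ` A) T"

locale full_fibred_system = fibred_system +
  assumes full: "\<And>A. A \<in> \<alpha> \<Longrightarrow> T ` A = space M"

definition cylinder :: "'a measure \<Rightarrow> ('a \<Rightarrow> 'a) \<Rightarrow> nat \<Rightarrow> (nat \<Rightarrow> 'a set) \<Rightarrow> 'a set" where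
  "cylinder M T k a = {x \<in> space M. \<forall>j<k. (T ^^ j) x \<in> a j}"

definition cylinder_topology :: "'a measure \<Rightarrow> ('a \<Rightarrow> 'a) \<Rightarrow> 'a set set \<Rightarrow> 'a topology" where
  "cylinder_topology M T \<alpha> =
     topology_generated_by {cylinder M T k a | k a. k \<ge> 1 \<and> (\<forall>j<k. a j \<in> \<alpha>)}"

text \<open>Coordinates are indexed from 0, so \<open>coding T \<alpha> x n\<close> is the element of \<open>\<alpha>\<close> containing \<open>T\<^sup>n x\<close>.\<close>

definition coding :: "('a \<Rightarrow> 'a) \<Rightarrow> 'a set set \<Rightarrow> 'a \<Rightarrow> nat \<Rightarrow> 'a set" where
  "coding T \<alpha> x n = (THE A. A \<in> \<alpha> \<and> (T ^^ n) x \<in> A)"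

definition exchangeable_relation ::
    "'a measure \<Rightarrow> ('a \<Rightarrow> 'a) \<Rightarrow> 'a set set \<Rightarrow> ('a \<times> 'a) set" where
  "exchangeable_relation M T \<alpha> =
     {(x, y). x \<in> space M \<and> y \<in> space M \<and>
        (\<exists>p :: nat \<Rightarrow> nat. bij p \<and> finite {n. p n \<noteq> n} \<and>
           (\<forall>n. coding T \<alpha> y n = coding T \<alpha> x (p n)))}"

definition holonomy ::
    "'a measure \<Rightarrow> ('a \<times> 'a) set \<Rightarrow> 'a set \<Rightarrow> 'a set \<Rightarrow> ('a \<Rightarrow> 'a) \<Rightarrow> bool" where
  "holonomy M R A B \<kappa> \<longleftrightarrow>
     A \<in> sets M \<and> B \<in> sets M \<and> bimeasurable_bij M A B \<kappa> \<and> (\<forall>x\<in>A. (x, \<kappa> x) \<in> R)"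

definition relation_invariant :: "('a \<times> 'a) set \<Rightarrow> 'a measure \<Rightarrow> bool" where
  "relation_invariant R \<mu> \<longleftrightarrow>
     (\<forall>A B \<kappa> C. holonomy \<mu> R A B \<kappa> \<longrightarrow> C \<in> sets \<mu> \<longrightarrow> C \<subseteq> A \<longrightarrow>
        emeasure \<mu> (\<kappa> ` C) = emeasure \<mu> C)"

text \<open>
  \<open>emeasure\<close> is 0 off the \<open>\<sigma>\<close>-algebra. This is harmless below: as \<open>\<alpha>\<close> is countable, every set that
  is open in the cylinder topology (or relatively open in a measurable set) is measurable.
\<close>

definition locally_finite_measure :: "'a topology \<Rightarrow> 'a measure \<Rightarrow> bool" where
  "locally_finite_measure S \<mu> \<longleftrightarrow>
     (\<exists>\<U>. countable \<U> \<and> (\<forall>U\<in>\<U>. openin S U \<and> emeasure \<mu> U < \<infinity>) \<and> \<Union>\<U> = topspace S)"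

definition topologically_sigma_finite :: "'a topology \<Rightarrow> 'a measure \<Rightarrow> bool" where
  "topologically_sigma_finite S \<mu> \<longleftrightarrow>
     (\<exists>Y\<in>sets \<mu>. emeasure \<mu> (space \<mu> - Y) = 0 \<and>
        locally_finite_measure (subtopology S Y) \<mu>)"

definition visits :: "('a \<Rightarrow> 'a) \<Rightarrow> 'a set \<Rightarrow> 'a \<Rightarrow> ennreal" where
  "visits T A x = (\<Sum>n. indicator A ((T ^^ n) x))"

definition recurrent_measure :: "('a \<Rightarrow> 'a) \<Rightarrow> 'a set set \<Rightarrow> 'a measure \<Rightarrow> bool" where
  "recurrent_measure T \<alpha> \<mu> \<longleftrightarrow> (\<forall>A\<in>\<alpha>. AE x in \<mu>. visits T A x \<in> {0, \<infinity>})"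

definition product_measure ::
    "'a measure \<Rightarrow> ('a \<Rightarrow> 'a) \<Rightarrow> 'a set set \<Rightarrow> 'a measure \<Rightarrow> bool" where
  "product_measure M T \<alpha> m \<longleftrightarrow>
     prob_space m \<and> sets m = sets M \<and>
     (\<forall>n A. (\<forall>j\<le>n. A j \<in> \<alpha>) \<longrightarrow>
        emeasure m (cylinder M T (Suc n) A) = (\<Prod>j\<le>n. emeasure m (A j)))"

definition mixture_over ::
    "'w measure \<Rightarrow> ('w \<Rightarrow> 'a measure) \<Rightarrow> ('a measure \<Rightarrow> bool) \<Rightarrow> 'a measure \<Rightarrow> bool" where
  "mixture_over \<nu> m P \<mu> \<longleftrightarrow>
     sigma_finite_measure \<nu> \<and>
     (\<forall>\<omega>\<in>space \<nu>. P (m \<omega>)) \<and>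
     (\<forall>B\<in>sets \<mu>. (\<lambda>\<omega>. emeasure (m \<omega>) B) \<in> borel_measurable \<nu> \<and>
        emeasure \<mu> B = (\<integral>\<^sup>+\<omega>. emeasure (m \<omega>) B \<partial>\<nu>))"

text \<open>
  HOL cannot quantify existentially over the type of the index space, so the index space is taken
  inside the type of measures on \<open>'a\<close>. For mixtures of probability measures representing a
  \<open>\<sigma>\<close>-finite \<open>\<mu>\<close> nothing is lost: a mixture over any \<open>(\<Omega>, \<nu>)\<close> is also the mixture, with \<open>m = id\<close>,
  over the image of \<open>\<nu>\<close> under \<open>m\<close> on the space of these probability measures. That image is again
  \<open>\<sigma>\<close>-finite: if sets \<open>B\<^sub>n\<close> of finite \<open>\<mu>\<close>-measure cover the space, then the sets of measures
  giving \<open>B\<^sub>n\<close> mass more than \<open>1/k\<close> have finite image measure and cover all probability measures.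
\<close>

definition is_mixture :: "('a measure \<Rightarrow> bool) \<Rightarrow> 'a measure \<Rightarrow> bool" where
  "is_mixture P \<mu> \<longleftrightarrow>
     (\<exists>(\<nu> :: 'a measure measure) (m :: 'a measure \<Rightarrow> 'a measure). mixture_over \<nu> m P \<mu>)"

end

theory Submission
  imports Defs "HOL-Combinatorics.Permutations"
begin

text \<open>
  Write \<open>cyl w\<close> for the cylinder of a word \<open>w\<close> (a list of letters), and call \<open>w\<close> good if \<open>cyl w\<close> has finite
  measure. Topological \<open>\<sigma>\<close>-finiteness says that good cylinders cover the space up to a null set, and
  local finiteness that they cover it. Fullness makes every finite permutation of the coordinates act on
  the space, and invariance of the measure is used only through these actions.

  On a good cylinder \<open>cyl w\<close> the coordinates behind \<open>w\<close> form an exchangeable sequence under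
  a finite measure, so that the frequency of every letter \<open>a\<close> converges almost everywhere to a function
  \<open>lim_freq a\<close> (\<open>lim_freq_converges\<close>). With \<open>word_freq v\<close> the product of the limit frequencies of the letters
  of \<open>v\<close>, averaging over the coordinates one at a time gives, for exchangeable \<open>h\<close>, the formula
  \<open>(\<integral>\<^sup>+x\<in>cyl (w @ v). h x \<partial>\<mu>) = (\<integral>\<^sup>+x\<in>cyl w. h x * word_freq v x \<partial>\<mu>)\<close> (\<open>product_formula\<close>). For good \<open>v\<close> the
  left-hand side is symmetric in \<open>w\<close> and \<open>v\<close>, hence so is the right-hand side (\<open>word_freq_swap\<close>).

  By recurrence \<open>word_freq w\<close> is positive almost everywhere on \<open>cyl w\<close> for good \<open>w\<close>
  (\<open>word_freq_pos\<close>). On the set of points \<open>x\<close> for which \<open>v\<close> is the first good word, in a fixed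
  enumeration, with \<open>word_freq v x\<close> positive, let the mixing measure have density \<open>1 / word_freq v\<close> on \<open>cyl v\<close>
  and zero elsewhere. Then \<open>word_freq_swap\<close> shows that \<open>word_freq d\<close>
  has integral \<open>\<mu> (cyl d)\<close> for every good \<open>d\<close> (\<open>weight_word_freq\<close>). Almost every tail behind a good word starts
  with a good word (\<open>tail_good\<close>), so the mixture does not charge the points outside all good cylinders.

  The product measures with weights \<open>lim_freq a x\<close> live on sequences of letters, whereas not every sequence
  is the code of a point. They are carried by codes because the space is standard: by inner regularity
  the set of codes contains a measurable set that carries almost all tails (\<open>standard_sequence_image\<close>), and
  the mixture formula forces almost every product measure to be carried by this set.

  Local finiteness implies recurrence: if a letter had a last occurrence with positive measure, transpositions could move this
  occurrence arbitrarily far out without changing the measure. Infinitely many disjoint sets with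
  measure bounded below would then accumulate at a point, against local finiteness (\<open>last_occurrence_null\<close>).
\<close>

section \<open>Measurable images of standard spaces up to null sets\<close>

text \<open>Exceptional sets of geometrically decreasing measure have a small union.\<close>

lemma (in finite_measure) measure_UN_le_geometric:
  assumes D: "\<And>n. D n \<in> sets M" and le: "\<And>n. measure M (D n) \<le> e / 2 ^ Suc n"
  shows "measure M (\<Union>n. D n) \<le> e"
proof -
  have sm: "(\<lambda>n. e / 2 ^ Suc n) sums e"
    using sums_mult[OF power_half_series, of e] by (simp add: power_one_over field_simps)
  have summ: "summable (\<lambda>n. measure M (D n))"
    by (rule summable_comparison_test'[OF sums_summable[OF sm], of 0]) (use le in auto)
  have "measure M (\<Union>n. D n) \<le> (\<Sum>n. measure M (D n))"
    using summ D by (intro finite_measure_subadditive_countably) auto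
  also have "\<dots> \<le> (\<Sum>n. e / 2 ^ Suc n)"
    by (rule suminf_le) (use le summ sums_summable[OF sm] in auto)
  also have "\<dots> = e" using sums_unique[OF sm] by simp
  finally show ?thesis .
qed

text \<open>The set \<open>B\<close> can be approximated in measure from inside by sets that are compact in \<open>S\<close>.\<close>

definition compact_inner_regular :: "'a topology \<Rightarrow> 'a measure \<Rightarrow> 'a set \<Rightarrow> bool" where
  "compact_inner_regular S P B \<longleftrightarrow>
     (\<forall>e>0. \<exists>K. compactin S K \<and> K \<subseteq> B \<and> measure P (B - K) < e)"

lemma closedin_borel:
  assumes "topspace S = space P" "sets P = sigma_sets (space P) {U. openin S U}" "closedin S C"
  shows "C \<in> sets P"
proof -
  have "topspace S - C \<in> sets P"
    unfolding assms(2) using openin_diff[OF openin_topspace assms(3)]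
    by (intro sigma_sets.Basic) simp
  then have "space P - (topspace S - C) \<in> sets P" by blast
  moreover have "space P - (topspace S - C) = C"
    using assms closedin_subset by fastforce
  ultimately show ?thesis by simp
qed

text \<open>
  Ulam's theorem: little mass can be taken away so that for every \<open>n\<close> finitely many balls of radius \<open>1/(n+1)\<close> cover
  the rest, which is then closed and totally bounded.
\<close>

lemma polish_tight:
  assumes S: "completely_metrizable_space S" "separable_space S" "topspace S = space P"
      "sets P = sigma_sets (space P) {U. openin S U}"
    and P: "finite_measure P"
  shows "compact_inner_regular S P (space P)"
  unfolding compact_inner_regular_def
proof (intro allI impI)
  fix e :: real assume e: "e > 0"
  interpret P: finite_measure P by fact
  obtain X d where "Metric_space X d" and compl: "Metric_space.mcomplete X d"
    and S_eq: "S = Metric_space.mtopology X d"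
    using S(1) by (auto simp: completely_metrizable_space_def)
  then interpret Metric_space X d by simp
  have X: "X = space P" using S(3) S_eq by simp
  obtain C where C: "countable C" "C \<subseteq> X" "mtopology closure_of C = X"
    using S(2) by (auto simp: separable_space_def S_eq)
  have cb: "mcball q r \<in> sets P" for q r
    by (rule closedin_borel[OF S(3,4)]) (simp add: S_eq)
  show "\<exists>K. compactin S K \<and> K \<subseteq> space P \<and> measure P (space P - K) < e"
  proof (cases "C = {}")
    case True
    then have "space P = {}" using C X by auto
    then show ?thesis using e by (intro exI[of _ "{}"]) auto
  next
    case False
    define q where "q = from_nat_into C"
    have q: "range q = C" using C False by (simp add: q_def range_from_nat_into)
    define R where "R n N = (\<Union>i<N. mcball (q i) (1 / Suc n))" for n N :: nat
    have R[measurable]: "R n N \<in> sets P" for n N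
      unfolding R_def using cb by auto
    have cover: "(\<Union>N. R n N) = space P" for n
    proof
      show "(\<Union>N. R n N) \<subseteq> space P" unfolding R_def using X mcball_subset_mspace by blast
      show "space P \<subseteq> (\<Union>N. R n N)"
      proof
        fix x assume x: "x \<in> space P"
        then have "x \<in> mtopology closure_of C" using C X by simp
        then obtain y where "y \<in> C" "y \<in> mball x (1 / Suc n)"
          unfolding metric_closure_of by (auto simp del: of_nat_Suc) (metis of_nat_0_less_iff zero_less_Suc zero_less_divide_1_iff)
        then obtain i where "q i \<in> mball x (1 / Suc n)" using q by blast
        then have "x \<in> mcball (q i) (1 / Suc n)" using commute by auto
        then show "x \<in> (\<Union>N. R n N)" unfolding R_def by blast
      qed
    qed
    have "\<exists>N. measure P (space P - R n N) < e / 2 / 2 ^ Suc n" for n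
    proof -
      have "(\<lambda>N. measure P (space P - R n N)) \<longlonglongrightarrow> measure P (\<Inter>N. space P - R n N)"
        by (rule P.finite_Lim_measure_decseq)
          (auto simp: decseq_def R_def intro!: sets.Diff cb)
      moreover have empty: "(\<Inter>N. space P - R n N) = {}"
        using cover[of n] by auto
      ultimately have "(\<lambda>N. measure P (space P - R n N)) \<longlonglongrightarrow> 0"
        unfolding empty by simp
      then have "eventually (\<lambda>N. measure P (space P - R n N) < e / 2 / 2 ^ Suc n) sequentially"
        using e by (intro order_tendstoD(2)[of _ 0]) auto
      then show ?thesis by (auto simp: eventually_sequentially)
    qed
    then obtain N where N: "\<And>n. measure P (space P - R n (N n)) < e / 2 / 2 ^ Suc n"
      by metis
    define K where "K = (\<Inter>n. R n (N n))"
    have Kcl: "closedin mtopology K"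
      unfolding K_def R_def by (intro closedin_INT closedin_Union) auto
    have KX: "K \<subseteq> X" using closedin_subset[OF Kcl] by simp
    have "mtotally_bounded K"
      unfolding mtotally_bounded_def
      proof (intro allI impI)
        fix r :: real assume r: "r > 0"
        obtain n where n: "1 / real (Suc n) < r / 2"
          using r by (metis half_gt_zero nat_approx_posE)
        \<comment> \<open>The balls of radius \<open>1/(n+1)\<close> that meet \<open>K\<close> are recentred at points of \<open>K\<close>.\<close>
        define J where "J = {i. i < N n \<and> K \<inter> mcball (q i) (1 / Suc n) \<noteq> {}}"
        have "\<forall>i\<in>J. \<exists>y. y \<in> K \<inter> mcball (q i) (1 / Suc n)" by (auto simp: J_def)
        then obtain y where y: "\<And>i. i \<in> J \<Longrightarrow> y i \<in> K \<inter> mcball (q i) (1 / Suc n)" by metis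
        have "K \<subseteq> (\<Union>x\<in>y ` J. mball x r)"
        proof
          fix x assume x: "x \<in> K"
          then obtain i where i: "i < N n" "x \<in> mcball (q i) (1 / Suc n)"
            unfolding K_def R_def by blast
          with x have "i \<in> J" by (auto simp: J_def)
          note yi = y[OF this]
          have "d (y i) x \<le> d (y i) (q i) + d (q i) x"
            using yi i by (intro triangle) auto
          also have "\<dots> \<le> 1 / Suc n + 1 / Suc n"
            using yi i commute[of "y i" "q i"] by (intro add_mono) auto
          also have "\<dots> < r" using n by simp
          finally have "x \<in> mball (y i) r" using yi i by auto
          then show "x \<in> (\<Union>x\<in>y ` J. mball x r)" using \<open>i \<in> J\<close> by blast
        qed
        moreover have "finite (y ` J)" by (simp add: J_def)
        moreover have "y ` J \<subseteq> K" using y by auto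
        ultimately show "\<exists>F. finite F \<and> F \<subseteq> K \<and> K \<subseteq> (\<Union>x\<in>F. mball x r)" by blast
      qed
    then have "compactin mtopology (mtopology closure_of K)"
      using mtotally_bounded_eq_compact_closure_of[OF compl] by blast
    then have "compactin S K" using Kcl by (simp add: S_eq closure_of_closedin)
    moreover have "measure P (space P - K) < e"
    proof -
      have "space P - K = (\<Union>n. space P - R n (N n))" unfolding K_def by auto
      then have "measure P (space P - K) = measure P (\<Union>n. space P - R n (N n))" by simp
      also have "\<dots> \<le> e / 2"
        using N by (intro P.measure_UN_le_geometric) (auto intro!: less_imp_le)
      also have "\<dots> < e" using e by simp
      finally show ?thesis .
    qed
    ultimately show ?thesis using KX X by blast
  qed
qed

lemma compact_inner_regular_UN:
  assumes P: "finite_measure P" and B: "\<And>n. B n \<in> sets P"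
    and K: "\<And>K. compactin S K \<Longrightarrow> K \<in> sets P"
    and reg: "\<And>n::nat. compact_inner_regular S P (B n)"
  shows "compact_inner_regular S P (\<Union>n. B n)"
  unfolding compact_inner_regular_def
proof (intro allI impI)
  fix e :: real assume e: "e > 0"
  interpret P: finite_measure P by fact
  note B[measurable]
  have "\<exists>K. compactin S K \<and> K \<subseteq> B n \<and> measure P (B n - K) < e / 2 / 2 ^ Suc n" for n
    using reg[of n] e unfolding compact_inner_regular_def by simp
  then obtain C where C: "\<And>n. compactin S (C n)" "\<And>n. C n \<subseteq> B n"
      "\<And>n. measure P (B n - C n) < e / 2 / 2 ^ Suc n" by metis
  have [measurable]: "C n \<in> sets P" for n using K C by blast
  define U where "U N = (\<Union>n. B n) - (\<Union>n<N. C n)" for N :: nat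
  have "(\<lambda>N. measure P (U N)) \<longlonglongrightarrow> measure P (\<Inter>N. U N)"
    by (rule P.finite_Lim_measure_decseq) (force simp: decseq_def U_def)+
  moreover have "measure P (\<Inter>N. U N) < e"
  proof -
    have "measure P (\<Inter>N. U N) \<le> measure P (\<Union>n. B n - C n)"
      by (rule P.finite_measure_mono) (auto simp: U_def)
    also have "\<dots> \<le> e / 2"
      using C(3) by (intro P.measure_UN_le_geometric) (auto intro!: less_imp_le)
    also have "\<dots> < e" using e by simp
    finally show ?thesis .
  qed
  ultimately have "eventually (\<lambda>N. measure P (U N) < e) sequentially"
    by (rule order_tendstoD(2))
  then obtain N where "measure P (U N) < e" by (auto simp: eventually_sequentially)
  moreover have "compactin S (\<Union>n<N. C n)" using C by (intro compactin_Union) auto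
  moreover have "(\<Union>n<N. C n) \<subseteq> (\<Union>n. B n)" using C by blast
  ultimately show "\<exists>K. compactin S K \<and> K \<subseteq> (\<Union>n. B n) \<and> measure P ((\<Union>n. B n) - K) < e"
    unfolding U_def by blast
qed

lemma compact_inner_regular_INT:
  assumes P: "finite_measure P" and B: "\<And>n. B n \<in> sets P"
    and K: "\<And>K. compactin S K \<Longrightarrow> K \<in> sets P" and S: "Hausdorff_space S"
    and reg: "\<And>n::nat. compact_inner_regular S P (B n)"
  shows "compact_inner_regular S P (\<Inter>n. B n)"
  unfolding compact_inner_regular_def
proof (intro allI impI)
  fix e :: real assume e: "e > 0"
  interpret P: finite_measure P by fact
  note B[measurable]
  have "\<exists>K. compactin S K \<and> K \<subseteq> B n \<and> measure P (B n - K) < e / 2 / 2 ^ Suc n" for n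
    using reg[of n] e unfolding compact_inner_regular_def by simp
  then obtain C where C: "\<And>n. compactin S (C n)" "\<And>n. C n \<subseteq> B n"
      "\<And>n. measure P (B n - C n) < e / 2 / 2 ^ Suc n" by metis
  have [measurable]: "C n \<in> sets P" for n using K C by blast
  have "measure P ((\<Inter>n. B n) - (\<Inter>n. C n)) \<le> measure P (\<Union>n. B n - C n)"
    by (rule P.finite_measure_mono) auto
  also have "\<dots> \<le> e / 2"
    using C(3) by (intro P.measure_UN_le_geometric) (auto intro!: less_imp_le)
  also have "\<dots> < e" using e by simp
  finally have "measure P ((\<Inter>n. B n) - (\<Inter>n. C n)) < e" .
  moreover have "compactin S (\<Inter>n. C n)"
    using C compactin_imp_closedin[OF S] by (intro closed_compactin_Inter[of _ "C 0"]) auto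
  moreover have "(\<Inter>n. C n) \<subseteq> (\<Inter>n. B n)" using C by blast
  ultimately show "\<exists>K. compactin S K \<and> K \<subseteq> (\<Inter>n. B n) \<and> measure P ((\<Inter>n. B n) - K) < e"
    by blast
qed

text \<open>
  The sets that are, together with their complement, inner regular form a \<open>\<sigma>\<close>-algebra. It contains
  the open sets, because these are countable unions of closed sets.
\<close>

theorem polish_compact_inner_regular:
  assumes S: "completely_metrizable_space S" "separable_space S" "topspace S = space P"
      "sets P = sigma_sets (space P) {U. openin S U}"
    and P: "finite_measure P" and B: "B \<in> sets P"
  shows "compact_inner_regular S P B"
proof -
  interpret P: finite_measure P by fact
  have metr: "metrizable_space S"
    using S(1) by (rule completely_metrizable_imp_metrizable_space)
  then have H: "Hausdorff_space S" by (rule metrizable_imp_Hausdorff_space)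
  have meas: "K \<in> sets P" if "compactin S K" for K
    using closedin_borel[OF S(3,4)] compactin_imp_closedin[OF H that] by blast
  have closed: "compact_inner_regular S P F" if F: "closedin S F" for F
    unfolding compact_inner_regular_def
  proof (intro allI impI)
    fix e :: real assume "e > 0"
    then obtain K where K: "compactin S K" "measure P (space P - K) < e"
      using polish_tight[OF S P] unfolding compact_inner_regular_def by blast
    have "measure P (F - F \<inter> K) \<le> measure P (space P - K)"
      using closedin_subset[OF F] S(3) meas[OF K(1)] by (intro P.finite_measure_mono) auto
    then show "\<exists>K. compactin S K \<and> K \<subseteq> F \<and> measure P (F - K) < e"
      using K closed_Int_compactin[OF F K(1)] by (intro exI[of _ "F \<inter> K"]) auto
  qed
  have "B \<in> sigma_sets (space P) {U. openin S U}" using B S(4) by simp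
  then have "B \<in> sets P \<and> compact_inner_regular S P B \<and> compact_inner_regular S P (space P - B)"
  proof (induction rule: sigma_sets.induct)
    case (Basic U)
    then have U: "openin S U" by simp
    have "fsigma_in S U" using metr U by (rule open_imp_fsigma_in)
    then obtain C where C: "\<And>n::nat. closedin S (C n)" "\<Union> (range C) = U"
      by (auto simp: fsigma_in_ascending)
    have "compact_inner_regular S P (\<Union>n. C n)"
      using C closed closedin_borel[OF S(3,4)] by (intro compact_inner_regular_UN[OF P _ meas]) auto
    moreover have "compact_inner_regular S P (space P - U)"
      using closed[of "space P - U"] U S(3) by (metis closedin_diff closedin_topspace)
    moreover have "U \<in> sets P" using U S(4) by auto
    ultimately show ?case using C by simp
  next
    case Empty
    then show ?case using closed[of "{}"] closed[of "space P"] S(3)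
      by (metis Diff_empty closedin_empty closedin_topspace sets.empty_sets)
  next
    case (Compl A)
    then show ?case by (auto simp: double_diff sets.sets_into_space)
  next
    case (Union A)
    have *: "space P - (\<Union>n. A n) = (\<Inter>n. space P - A n)" by auto
    have "compact_inner_regular S P (\<Union>n. A n)"
      using Union.IH by (intro compact_inner_regular_UN[OF P _ meas]) auto
    moreover have "compact_inner_regular S P (\<Inter>n. space P - A n)"
      using Union.IH by (intro compact_inner_regular_INT[OF P _ meas H]) auto
    ultimately show ?case using Union.IH unfolding * by auto
  qed
  then show ?thesis by simp
qed

text \<open>
  The image of a standard space under a sequence-valued measurable map contains a measurable set
  that carries the image measure; no injectivity is needed. Up to a small error, each set
  \<open>{x. \<phi> x i = a}\<close> agrees with a compact subset \<open>K i a\<close>, and a sequence \<open>s\<close> is a value of \<open>\<phi>\<close> as soon as the compact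
  sets \<open>K i (s i)\<close> have the finite intersection property, which is a measurable condition on \<open>s\<close>.
\<close>

theorem standard_sequence_image:
  fixes \<phi> :: "'a \<Rightarrow> nat \<Rightarrow> 'b"
  assumes M: "standard_measurable_space M"
    and P: "finite_measure P" "sets P = sets M"
    and A: "countable A"
    and \<phi>: "\<phi> \<in> measurable M (PiM UNIV (\<lambda>_. count_space A))"
  shows "\<exists>Z\<in>sets (PiM UNIV (\<lambda>_. count_space A)). Z \<subseteq> \<phi> ` space M \<and> (AE x in P. \<phi> x \<in> Z)"
proof -
  interpret P: finite_measure P by fact
  have sp: "space P = space M" using P(2) by (rule sets_eq_imp_space_eq)
  let ?\<Sigma> = "PiM UNIV (\<lambda>_::nat. count_space A)"
  obtain S where S: "completely_metrizable_space S" "separable_space S" "topspace S = space P"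
      "sets P = sigma_sets (space P) {U. openin S U}"
    using M P(2) sp by (auto simp: standard_measurable_space_def)
  have H: "Hausdorff_space S"
    using S(1) completely_metrizable_imp_metrizable_space metrizable_imp_Hausdorff_space by blast
  have meas: "K \<in> sets P" if "compactin S K" for K
    using closedin_borel[OF S(3,4)] compactin_imp_closedin[OF H that] by blast
  have \<phi>A: "\<phi> x i \<in> A" if "x \<in> space M" for x i
    using measurable_space[OF \<phi> that] by (auto simp: space_PiM PiE_iff)
  have \<phi>P[measurable]: "\<phi> \<in> measurable P ?\<Sigma>"
    using \<phi> P(2) by (simp cong: measurable_cong_sets)
  define B where "B i a = {x\<in>space P. \<phi> x i = a}" for i a
  have B[measurable]: "B i a \<in> sets P" for i a
  proof (cases "a \<in> A")
    case True
    have "(\<lambda>x. \<phi> x i) -` {a} \<inter> space P \<in> sets P"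
      by (rule measurable_sets[OF measurable_compose[OF \<phi>P measurable_component_singleton]])
        (use True in auto)
    then show ?thesis by (simp add: B_def vimage_def Int_def conj_commute)
  next
    case False
    then have "B i a = {}" using \<phi>A by (auto simp: B_def sp)
    then show ?thesis by simp
  qed
  have approx: "\<exists>Z\<in>sets ?\<Sigma>. Z \<subseteq> \<phi> ` space M \<and> measure P {x\<in>space P. \<phi> x \<notin> Z} \<le> e"
    if e: "e > 0" for e :: real
  proof -
    define c where "c i a = prod_encode (i, to_nat_on A a)" for i a
    have "\<exists>K. compactin S K \<and> K \<subseteq> B i a \<and> measure P (B i a - K) < e / 2 ^ Suc (c i a)" for i a
      using polish_compact_inner_regular[OF S P(1) B[of i a]] e
      unfolding compact_inner_regular_def by simp
    then obtain K where K: "\<And>i a. compactin S (K i a)" "\<And>i a. K i a \<subseteq> B i a"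
      "\<And>i a. measure P (B i a - K i a) < e / 2 ^ Suc (c i a)" by metis
    have [measurable]: "K i a \<in> sets P" for i a using K meas by blast
    define Z where "Z = {s\<in>space ?\<Sigma>. \<forall>n. (\<Inter>i\<le>n. K i (s i)) \<noteq> {}}"
    have "Z \<in> sets ?\<Sigma>"
    proof -
      have "(\<lambda>s. (\<Inter>i\<le>n. K i (s i)) \<noteq> {}) \<in> measurable ?\<Sigma> (count_space UNIV)" for n
      proof -
        have 1: "(\<lambda>s. map s [0..<Suc n]) \<in> measurable ?\<Sigma> (count_space (lists A))"
          unfolding measurable_count_space_eq_countable[OF countable_lists[OF A]]
        proof (intro conjI ballI funcsetI)
          fix s assume "s \<in> space ?\<Sigma>"
          then show "map s [0..<Suc n] \<in> lists A" by (auto simp: space_PiM PiE_iff)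
        next
          fix w :: "'b list" assume w: "w \<in> lists A"
          show "(\<lambda>s. map s [0..<Suc n]) -` {w} \<inter> space ?\<Sigma> \<in> sets ?\<Sigma>"
          proof (cases "length w = Suc n")
            case True
            then have eq: "(\<lambda>s. map s [0..<Suc n]) -` {w} \<inter> space ?\<Sigma> =
                {s\<in>space ?\<Sigma>. \<forall>i\<in>{..n}. s i \<in> {w ! i}}"
              by (auto simp: list_eq_iff_nth_eq less_Suc_eq_le simp del: upt_Suc)
            have "{s\<in>space ?\<Sigma>. s i \<in> {w ! i}} \<in> sets ?\<Sigma>" if "i \<le> n" for i
            proof -
              have "w ! i \<in> A" using w True that by (auto simp: in_lists_conv_set)
              then have "(\<lambda>s. s i) -` {w ! i} \<inter> space ?\<Sigma> \<in> sets ?\<Sigma>"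
                by (intro measurable_sets[OF measurable_component_singleton]) auto
              moreover have "(\<lambda>s. s i) -` {w ! i} \<inter> space ?\<Sigma> = {s\<in>space ?\<Sigma>. s i \<in> {w ! i}}" by auto
              ultimately show ?thesis by simp
            qed
            then show ?thesis unfolding eq by (intro sets.sets_Collect_finite_All) auto
          next
            case False
            then have "(\<lambda>s. map s [0..<Suc n]) -` {w} \<inter> space ?\<Sigma> = {}" by auto
            then show ?thesis by simp
          qed
        qed
        have 2: "(\<lambda>w. (\<Inter>i\<le>n. K i (w ! i)) \<noteq> {}) \<in> measurable (count_space (lists A)) (count_space UNIV)"
          by simp
        have eq: "(\<Inter>i\<le>n. K i (map s [0..<Suc n] ! i)) = (\<Inter>i\<le>n. K i (s i))" for s
          by (intro INF_cong) (auto simp: less_Suc_eq_le simp del: upt_Suc)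
        show ?thesis using measurable_compose[OF 1 2] unfolding eq .
      qed
      then show ?thesis unfolding Z_def by measurable
    qed
    moreover have "Z \<subseteq> \<phi> ` space M"
    proof
      fix s assume s: "s \<in> Z"
      have "(\<Inter>i. K i (s i)) \<noteq> {}"
      proof -
        have "K 0 (s 0) \<inter> \<Inter>(range (\<lambda>i. K i (s i))) \<noteq> {}"
        proof (rule compactin_fip[THEN iffD1, OF K(1), THEN conjunct2, rule_format], safe)
          fix i show "closedin S (K i (s i))" using compactin_imp_closedin[OF H K(1)] .
        next
          fix F assume F: "finite F" "F \<subseteq> range (\<lambda>i. K i (s i))"
            and "K 0 (s 0) \<inter> \<Inter>F = {}"
          obtain I where I: "finite I" "F = (\<lambda>i. K i (s i)) ` I"
            using finite_subset_image[OF F] by blast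
          obtain n where "\<And>i. i \<in> I \<Longrightarrow> i \<le> n" using I(1) finite_nat_set_iff_bounded_le by auto
          then have "(\<Inter>i\<le>n. K i (s i)) \<subseteq> K 0 (s 0) \<inter> \<Inter>F" using I by auto
          then show False using s \<open>K 0 (s 0) \<inter> \<Inter>F = {}\<close> by (auto simp: Z_def)
        qed
        then show ?thesis by blast
      qed
      then obtain x where x: "\<And>i. x \<in> K i (s i)" by blast
      then have "\<And>i. x \<in> B i (s i)" using K(2) by blast
      then have "x \<in> space M" "\<phi> x = s" by (auto simp: B_def sp)
      then show "s \<in> \<phi> ` space M" by blast
    qed
    moreover have "measure P {x\<in>space P. \<phi> x \<notin> Z} \<le> e"
    proof -
      \<comment> \<open>The errors \<open>B i a - K i a\<close>, enumerated through the pairing function; codes of no letter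
        contribute the empty set.\<close>
      define D where "D n = (case prod_decode n of (i, j) \<Rightarrow>
        if \<exists>a\<in>A. to_nat_on A a = j then B i (from_nat_into A j) - K i (from_nat_into A j) else {})" for n
      have Dm: "D n \<in> sets P" for n by (auto simp: D_def split: prod.split)
      have Dle: "measure P (D n) \<le> e / 2 ^ Suc n" for n
      proof -
        obtain i j where ij: "prod_decode n = (i, j)" by fastforce
        then have n: "n = prod_encode (i, j)" by (metis prod_decode_inverse)
        show ?thesis
        proof (cases "\<exists>a\<in>A. to_nat_on A a = j")
          case True
          then obtain a where a: "a \<in> A" "j = to_nat_on A a" by blast
          then have "from_nat_into A j = a" using A by simp
          then have "D n = B i a - K i a" using ij True by (simp add: D_def)
          then show ?thesis using K(3)[of i a] n a by (simp add: c_def)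
        next
          case False
          then show ?thesis using ij e by (simp add: D_def)
        qed
      qed
      have sub: "{x\<in>space P. \<phi> x \<notin> Z} \<subseteq> (\<Union>n. D n)"
      proof
        fix x assume x: "x \<in> {x\<in>space P. \<phi> x \<notin> Z}"
        then have "\<phi> x \<in> space ?\<Sigma>" using measurable_space[OF \<phi>P] by auto
        with x obtain n where "(\<Inter>i\<le>n. K i (\<phi> x i)) = {}" by (auto simp: Z_def)
        then obtain i where i: "x \<notin> K i (\<phi> x i)" by blast
        have a: "\<phi> x i \<in> A" using x \<phi>A sp by auto
        have "x \<in> B i (\<phi> x i)" using x by (auto simp: B_def)
        then have "x \<in> D (c i (\<phi> x i))" using i a A by (auto simp: D_def c_def)
        then show "x \<in> (\<Union>n. D n)" by blast
      qed
      have "measure P {x\<in>space P. \<phi> x \<notin> Z} \<le> measure P (\<Union>n. D n)"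
        using sub Dm by (intro P.finite_measure_mono) auto
      also have "\<dots> \<le> e" by (intro P.measure_UN_le_geometric Dm Dle)
      finally show ?thesis .
    qed
    ultimately show ?thesis by blast
  qed
  have "\<exists>Z. \<forall>n::nat. Z n \<in> sets ?\<Sigma> \<and> Z n \<subseteq> \<phi> ` space M \<and>
      measure P {x\<in>space P. \<phi> x \<notin> Z n} \<le> 1 / Suc n"
  proof (rule choice, rule allI)
    fix n :: nat
    show "\<exists>Z. Z \<in> sets ?\<Sigma> \<and> Z \<subseteq> \<phi> ` space M \<and>
        measure P {x\<in>space P. \<phi> x \<notin> Z} \<le> 1 / Suc n"
      using approx[of "1 / Suc n"] by auto
  qed
  then obtain Z where Z: "\<And>n. Z n \<in> sets ?\<Sigma>" "\<And>n. Z n \<subseteq> \<phi> ` space M"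
    "\<And>n::nat. measure P {x\<in>space P. \<phi> x \<notin> Z n} \<le> 1 / Suc n" by blast
  note Z(1)[measurable]
  let ?Z = "\<Union>n. Z n"
  have "measure P {x\<in>space P. \<phi> x \<notin> ?Z} \<le> 1 / Suc n" for n
    using Z(3)[of n] by (rule order_trans[rotated]) (intro P.finite_measure_mono; auto)
  then have "measure P {x\<in>space P. \<phi> x \<notin> ?Z} \<le> 0"
    by (intro LIMSEQ_le_const[OF LIMSEQ_inverse_real_of_nat]) (auto simp: inverse_eq_divide)
  then have "measure P {x\<in>space P. \<phi> x \<notin> ?Z} = 0"
    by (intro antisym measure_nonneg)
  then have "emeasure P {x\<in>space P. \<phi> x \<notin> ?Z} = 0"
    by (simp only: P.emeasure_eq_measure ennreal_0)
  then have "AE x in P. \<phi> x \<in> ?Z"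
    by (subst AE_iff_measurable[OF _ refl]) auto
  then show ?thesis using Z by (intro bexI[of _ ?Z]) auto
qed

section \<open>Coordinate processes and words\<close>

text \<open>
  A measurable space whose \<open>\<sigma>\<close>-algebra is generated by a sequence of coordinate maps into a countable
  alphabet. Both the space of a fibred system (with the coding) and the space of all sequences of
  letters are of this form. A word is a list of letters.
\<close>

locale coordinates =
  fixes N :: "'x measure" and f :: "'x \<Rightarrow> nat \<Rightarrow> 'b" and A :: "'b set"
  assumes countable_letters: "countable A"
    and letter: "\<And>x n. x \<in> space N \<Longrightarrow> f x n \<in> A"
    and sets_coordinates: "sets N = sigma_sets (space N) {{x\<in>space N. f x n = a} | n a. a \<in> A}"
begin

text \<open>The cylinder of a word; the empty word gives the whole space.\<close>

definition cyl :: "'b list \<Rightarrow> 'x set" where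
  "cyl w = {x\<in>space N. \<forall>j<length w. f x j = w ! j}"

lemma cyl_Nil[simp]: "cyl [] = space N"
  by (simp add: cyl_def)

lemma cyl_subset_space: "cyl w \<subseteq> space N"
  by (auto simp: cyl_def)

lemma cyl_append: "x \<in> cyl (w @ v) \<longleftrightarrow> x \<in> cyl w \<and> (\<forall>j<length v. f x (length w + j) = v ! j)"
proof
  assume x: "x \<in> cyl (w @ v)"
  have "f x j = w ! j" if "j < length w" for j
    using x that by (auto simp: cyl_def nth_append dest: spec[of _ j])
  moreover have "f x (length w + j) = v ! j" if "j < length v" for j
    using x that by (auto simp: cyl_def nth_append dest: spec[of _ "length w + j"])
  ultimately show "x \<in> cyl w \<and> (\<forall>j<length v. f x (length w + j) = v ! j)"
    using x by (auto simp: cyl_def)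
next
  assume x: "x \<in> cyl w \<and> (\<forall>j<length v. f x (length w + j) = v ! j)"
  have "f x j = (w @ v) ! j" if "j < length (w @ v)" for j
  proof (cases "j < length w")
    case False
    then have "f x (length w + (j - length w)) = v ! (j - length w)"
      using x that by (intro x[THEN conjunct2, rule_format]) auto
    then show ?thesis using False by (simp add: nth_append)
  qed (use x in \<open>auto simp: cyl_def nth_append\<close>)
  then show "x \<in> cyl (w @ v)" using x by (auto simp: cyl_def)
qed

lemma cyl_snoc: "cyl (w @ [a]) = {x\<in>cyl w. f x (length w) = a}"
  by (auto simp: cyl_append)

lemma cyl_append_subset: "cyl (w @ v) \<subseteq> cyl w"
  by (auto simp: cyl_append)

lemma cyl_Int:
  assumes "length w \<le> length v"
  shows "cyl w \<inter> cyl v = cyl v \<or> cyl w \<inter> cyl v = {}"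
proof (cases "take (length w) v = w")
  case True
  then have "cyl v \<subseteq> cyl w" by (metis append_take_drop_id cyl_append_subset)
  then show ?thesis by blast
next
  case False
  then obtain j where "j < length w" "v ! j \<noteq> w ! j"
    using assms by (auto simp: list_eq_iff_nth_eq)
  then show ?thesis using assms by (fastforce simp: cyl_def)
qed

lemma coordinate_measurable[measurable]: "{x\<in>space N. f x n = a} \<in> sets N"
proof (cases "a \<in> A")
  case True
  then show ?thesis unfolding sets_coordinates by (intro sigma_sets.Basic) auto
next
  case False
  then have "{x\<in>space N. f x n = a} = {}" using letter by auto
  then show ?thesis by (simp only: sets.empty_sets)
qed

lemma cyl_measurable[measurable]: "cyl w \<in> sets N"
proof -
  have "cyl w = {x\<in>space N. \<forall>j\<in>{..<length w}. f x j = w ! j}" by (auto simp: cyl_def)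
  then show ?thesis by (auto intro!: sets.sets_Collect_finite_All)
qed

lemma ex_cyl: "x \<in> space N \<Longrightarrow> \<exists>w\<in>lists A. length w = k \<and> x \<in> cyl w"
  using letter by (intro bexI[of _ "map (f x) [0..<k]"]) (auto simp: cyl_def)

lemma sets_generated_by_cylinders: "sets N = sigma_sets (space N) (insert {} (cyl ` lists A))"
proof
  have sub: "insert {} (cyl ` lists A) \<subseteq> Pow (space N)" using cyl_subset_space by auto
  show "sigma_sets (space N) (insert {} (cyl ` lists A)) \<subseteq> sets N"
    by (rule sets.sigma_sets_subset) auto
  show "sets N \<subseteq> sigma_sets (space N) (insert {} (cyl ` lists A))"
    unfolding sets_coordinates
  proof (rule sigma_sets_mono, clarify)
    fix n a assume a: "a \<in> A"
    have eq: "{x\<in>space N. f x n = a} = (\<Union>w\<in>{w\<in>lists A. length w = n}. cyl (w @ [a]))"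
    proof (intro set_eqI iffI)
      fix x assume "x \<in> {x\<in>space N. f x n = a}"
      then show "x \<in> (\<Union>w\<in>{w\<in>lists A. length w = n}. cyl (w @ [a]))"
        using ex_cyl[of x n] by (auto simp: cyl_snoc)
    qed (auto simp: cyl_snoc cyl_def)
    have "countable {w\<in>lists A. length w = n}"
      using countable_letters by (auto intro: countable_subset[OF _ countable_lists])
    then show "{x\<in>space N. f x n = a} \<in> sigma_sets (space N) (insert {} (cyl ` lists A))"
      unfolding eq
      by (rule sigma_sets_UNION[OF countable_image, of _ "\<lambda>w. cyl (w @ [a])", simplified])
         (use a in \<open>auto intro!: sigma_sets.Basic imageI\<close>)
  qed
qed

lemma Int_stable_cylinders: "Int_stable (insert {} (cyl ` lists A))"
proof (rule Int_stableI)
  fix a b assume ab: "a \<in> insert {} (cyl ` lists A)" "b \<in> insert {} (cyl ` lists A)"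
  show "a \<inter> b \<in> insert {} (cyl ` lists A)"
  proof (cases "a = {} \<or> b = {}")
    case False
    then obtain w v where w: "w \<in> lists A" "v \<in> lists A" "a = cyl w" "b = cyl v" using ab by auto
    then show ?thesis
      using cyl_Int[of w v] cyl_Int[of v w]
      by (cases "length w \<le> length v") (auto simp: Int_commute)
  qed auto
qed

lemma cylinders_subset_Pow: "insert {} (cyl ` lists A) \<subseteq> Pow (space N)"
  using cyl_subset_space by auto

lemma measure_eqI_cylinders:
  assumes "sets P = sets N" "sets Q = sets N" "emeasure P (space N) \<noteq> \<infinity>"
    and "\<And>w. w \<in> lists A \<Longrightarrow> emeasure P (cyl w) = emeasure Q (cyl w)"
  shows "P = Q"
proof (rule measure_eqI_generator_eq_countable[OF Int_stable_cylinders, where A = "{space N}"])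
  show "{space N} \<subseteq> insert {} (cyl ` lists A)"
    using imageI[of "[]" "lists A" cyl] by auto
qed (use assms cylinders_subset_Pow sets_generated_by_cylinders in auto)

lemma kernel_measurable:
  assumes "\<And>x. x \<in> space R \<Longrightarrow> prob_space (k x)" "\<And>x. x \<in> space R \<Longrightarrow> sets (k x) = sets N"
    and "\<And>w. w \<in> lists A \<Longrightarrow> (\<lambda>x. emeasure (k x) (cyl w)) \<in> borel_measurable R"
  shows "k \<in> measurable R (prob_algebra N)"
  by (rule measurable_prob_algebra_generated[OF sets_generated_by_cylinders Int_stable_cylinders
        cylinders_subset_Pow]) (use assms in auto)

text \<open>The law of \<open>\<phi>\<close> is a mixture of the kernel \<open>k\<close> as soon as this holds on cylinders.\<close>

lemma kernel_disintegration:
  assumes fin: "emeasure R (space R) \<noteq> \<infinity>" and \<phi>[measurable]: "\<phi> \<in> measurable R N"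
    and k: "k \<in> measurable R (prob_algebra N)"
    and eq: "\<And>w. w \<in> lists A \<Longrightarrow>
      emeasure R (\<phi> -` cyl w \<inter> space R) = (\<integral>\<^sup>+x. emeasure (k x) (cyl w) \<partial>R)"
    and B: "B \<in> sets N"
  shows "emeasure R (\<phi> -` B \<inter> space R) = (\<integral>\<^sup>+x. emeasure (k x) B \<partial>R)"
proof (cases "space R = {}")
  case True
  then show ?thesis by (simp add: nn_integral_empty)
next
  case False
  have k'[measurable]: "k \<in> measurable R (subprob_algebra N)"
    using k by (rule measurable_prob_algebraD)
  have em: "emeasure (R \<bind> k) C = (\<integral>\<^sup>+x. emeasure (k x) C \<partial>R)" if "C \<in> sets N" for C
    by (rule emeasure_bind[OF False k' that])
  have "distr R N \<phi> = R \<bind> k"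
  proof (rule measure_eqI_cylinders)
    show "sets (R \<bind> k) = sets N"
      by (rule sets_bind[OF _ False]) (rule sets_kernel[OF k'])
    have "\<phi> -` space N \<inter> space R = space R" using measurable_space[OF \<phi>] by auto
    then show "emeasure (distr R N \<phi>) (space N) \<noteq> \<infinity>"
      using fin by (simp add: emeasure_distr)
  qed (use eq em in \<open>auto simp: emeasure_distr\<close>)
  then show ?thesis using em[OF B] B by (metis \<phi> emeasure_distr)
qed

end

lemma coordinates_PiM:
  fixes A :: "'b set"
  assumes A: "countable A"
  shows "coordinates (PiM UNIV (\<lambda>_::nat. count_space A)) (\<lambda>s. s) A"
proof
  let ?N = "PiM UNIV (\<lambda>_::nat. count_space A)"
  show "s n \<in> A" if "s \<in> space ?N" for s n
    using that by (auto simp: space_PiM PiE_iff)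
  let ?G = "{{s\<in>space ?N. s n = a} | n a. a \<in> A}"
  show "sets ?N = sigma_sets (space ?N) ?G"
  proof
    show "sigma_sets (space ?N) ?G \<subseteq> sets ?N"
    proof (rule sets.sigma_sets_subset, clarify)
      fix n :: nat and a assume "a \<in> A"
      then have "(\<lambda>s. s n) -` {a} \<inter> space ?N \<in> sets ?N"
        by (intro measurable_sets[OF measurable_component_singleton]) auto
      moreover have "(\<lambda>s. s n) -` {a} \<inter> space ?N = {s\<in>space ?N. s n = a}" by auto
      ultimately show "{s\<in>space ?N. s n = a} \<in> sets ?N" by simp
    qed
    show "sets ?N \<subseteq> sigma_sets (space ?N) ?G"
      unfolding sets_PiM_single space_PiM
    proof (rule sigma_sets_mono, clarify)
      fix n :: nat and B assume B: "B \<in> sets (count_space A)"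
      have eq: "{s \<in> \<Pi>\<^sub>E i\<in>UNIV. space (count_space A). s n \<in> B} =
          (\<Union>b\<in>B. {s \<in> \<Pi>\<^sub>E i\<in>UNIV. space (count_space A). s n = b})" by auto
      have "countable B" using B A by (auto intro: countable_subset)
      then show "{s \<in> \<Pi>\<^sub>E i\<in>UNIV. space (count_space A). s n \<in> B} \<in>
          sigma_sets (\<Pi>\<^sub>E i\<in>UNIV. space (count_space A))
            {{s \<in> \<Pi>\<^sub>E i\<in>UNIV. space (count_space A). s n = a} | n a. a \<in> A}"
        unfolding eq using B by (intro sigma_sets_UNION) (auto intro!: sigma_sets.Basic)
    qed
  qed
qed (rule A)

section \<open>Rearrangements in full fibred systems\<close>

context fibred_system
begin

lemma funpow_measurable[measurable]: "(T ^^ n) \<in> measurable M M"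
proof (induction n)
  case (Suc n)
  from measurable_comp[OF this T_measurable] show ?case by (simp add: comp_def)
qed simp

lemma funpow_space: "x \<in> space M \<Longrightarrow> (T ^^ n) x \<in> space M"
  using measurable_space[OF funpow_measurable] by blast

lemma coding_in:
  assumes x: "x \<in> space M"
  shows "coding T \<alpha> x n \<in> \<alpha> \<and> (T ^^ n) x \<in> coding T \<alpha> x n"
proof -
  have "(T ^^ n) x \<in> \<Union>\<alpha>" using partition funpow_space[OF x] by (auto simp: partition_on_def)
  then obtain B where B: "B \<in> \<alpha>" "(T ^^ n) x \<in> B" by blast
  show ?thesis
    unfolding coding_def
    by (rule theI[where P = "\<lambda>A. A \<in> \<alpha> \<and> (T ^^ n) x \<in> A" and a = B])
      (use B partition in \<open>auto simp: partition_on_def disjoint_def\<close>)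
qed

lemma coding_eq_iff:
  assumes "x \<in> space M" "A \<in> \<alpha>"
  shows "coding T \<alpha> x n = A \<longleftrightarrow> (T ^^ n) x \<in> A"
  using coding_in[OF assms(1), of n] assms(2) partition
  by (auto simp: partition_on_def disjoint_def)

lemma coding_shift: "coding T \<alpha> ((T ^^ k) x) n = coding T \<alpha> x (k + n)"
  using funpow_add[of n k T] by (simp add: coding_def add.commute)

sublocale coordinates M "coding T \<alpha>" \<alpha>
proof
  show "countable \<alpha>" by (rule countable_partition)
  show in_\<alpha>: "coding T \<alpha> x n \<in> \<alpha>" if "x \<in> space M" for x n
    using coding_in[OF that] by blast
  have E: "(T ^^ i) -` A \<inter> space M = {x\<in>space M. coding T \<alpha> x i = A}" if "A \<in> \<alpha>" for i A
    using coding_eq_iff[OF _ that] by auto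
  then have "(\<exists>i A. S = (T ^^ i) -` A \<inter> space M \<and> A \<in> \<alpha>) \<longleftrightarrow>
      (\<exists>i A. S = {x\<in>space M. coding T \<alpha> x i = A} \<and> A \<in> \<alpha>)" for S
    using E by metis
  then show "sets M = sigma_sets (space M) {{x\<in>space M. coding T \<alpha> x n = a} | n a. a \<in> \<alpha>}"
    unfolding generating by presburger
qed

lemma coding_measurable_PiM: "coding T \<alpha> \<in> measurable M (PiM UNIV (\<lambda>_. count_space \<alpha>))"
proof (rule measurable_PiM_single')
  fix n :: nat
  show "(\<lambda>x. coding T \<alpha> x n) \<in> measurable M (count_space \<alpha>)"
    unfolding measurable_count_space_eq_countable[OF countable_letters]
    using letter coordinate_measurable by (auto simp: vimage_def Int_def conj_commute)
qed (use letter in \<open>auto simp: PiE_iff extensional_def\<close>)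

lemma cylinder_eq_cyl:
  assumes a: "\<And>j. j < k \<Longrightarrow> a j \<in> \<alpha>"
  shows "cylinder M T k a = cyl (map a [0..<k])"
proof -
  have "coding T \<alpha> x j = a j \<longleftrightarrow> (T ^^ j) x \<in> a j" if "x \<in> space M" "j < k" for x j
    using coding_eq_iff[OF that(1) a[OF that(2)]] .
  then show ?thesis by (simp add: cylinder_def cyl_def cong: conj_cong)
qed

lemma visits_eq:
  assumes x: "x \<in> space M" and a: "a \<in> \<alpha>"
  shows "visits T a x = emeasure (count_space UNIV) {n. coding T \<alpha> x n = a}"
proof -
  have "visits T a x = (\<Sum>n. indicator {n. coding T \<alpha> x n = a} n)"
    unfolding visits_def using coding_eq_iff[OF x a] by (intro suminf_cong) (simp add: indicator_def)
  also have "\<dots> = (\<integral>\<^sup>+n. indicator {n. coding T \<alpha> x n = a} n \<partial>count_space UNIV)"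
    by (rule nn_integral_count_space_nat[symmetric])
  finally show ?thesis by simp
qed

text \<open>In a standard space singletons are measurable, so the generating coordinates separate points.\<close>

lemma coding_inject:
  assumes x: "x \<in> space M" and y: "y \<in> space M" and eq: "coding T \<alpha> x = coding T \<alpha> y"
  shows "x = y"
proof -
  have sep: "x \<in> B \<longleftrightarrow> y \<in> B" if "B \<in> sets M" for B
    using that unfolding sets_coordinates
  proof (induction rule: sigma_sets.induct)
    case (Basic a) then show ?case using x y eq by auto
  qed (use x y in auto)
  obtain S where S: "completely_metrizable_space S" "topspace S = space M"
      "sets M = sigma_sets (space M) {U. openin S U}"
    using standard by (auto simp: standard_measurable_space_def)
  have "Hausdorff_space S"
    using S(1) completely_metrizable_imp_metrizable_space metrizable_imp_Hausdorff_space by blast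
  then have "closedin S {x}"
    using x S(2) Hausdorff_imp_t1_space by (auto simp: t1_space_closedin_singleton)
  then have "{x} \<in> sets M" by (rule closedin_borel[OF S(2,3)])
  then show ?thesis using sep by blast
qed

end

context full_fibred_system
begin

text \<open>Fullness: any finite word may be put in front of any point.\<close>

lemma ex_prefix:
  assumes x: "x \<in> space M" and w: "w \<in> lists \<alpha>"
  shows "\<exists>y\<in>cyl w. (T ^^ length w) y = x"
  using w
proof (induction w)
  case Nil then show ?case using x by simp
next
  case (Cons a w)
  then obtain y where y: "y \<in> cyl w" "(T ^^ length w) y = x" by auto
  then have "y \<in> T ` a" using full[of a] Cons by (auto simp: cyl_def)
  then obtain z where z: "z \<in> a" "T z = y" by auto
  have zM: "z \<in> space M" using z Cons partition by (auto simp: partition_on_def)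
  have "coding T \<alpha> z j = (a # w) ! j" if "j < length (a # w)" for j
  proof (cases j)
    case 0
    then show ?thesis using z Cons coding_eq_iff[OF zM, of a 0] by simp
  next
    case (Suc i)
    then have "coding T \<alpha> z j = coding T \<alpha> y i" using coding_shift[of 1 z i] z by simp
    then show ?thesis using y that Suc by (auto simp: cyl_def)
  qed
  moreover have "(T ^^ length (a # w)) z = x" using y z by (simp add: funpow_swap1)
  ultimately show ?case using zM by (auto simp: cyl_def)
qed

text \<open>
  The point whose code is the code of \<open>x\<close> with its coordinates permuted by \<open>p\<close>. For a finite permutation
  it exists, because it arises from a tail of \<open>x\<close> by a change of prefix.
\<close>

definition rearrange :: "(nat \<Rightarrow> nat) \<Rightarrow> 'a \<Rightarrow> 'a" where
  "rearrange p x = (THE y. y \<in> space M \<and> coding T \<alpha> y = coding T \<alpha> x \<circ> p)"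

lemma rearrange:
  assumes p: "p permutes S" "finite S" and x: "x \<in> space M"
  shows "rearrange p x \<in> space M" "coding T \<alpha> (rearrange p x) n = coding T \<alpha> x (p n)"
proof -
  obtain k where k: "S \<subseteq> {..<k}" using p(2) finite_nat_iff_bounded by blast
  let ?w = "map (\<lambda>j. coding T \<alpha> x (p j)) [0..<k]"
  have "?w \<in> lists \<alpha>" using letter[OF x] by auto
  then obtain y where y: "y \<in> cyl ?w" "(T ^^ k) y = (T ^^ k) x"
    using ex_prefix[OF funpow_space[OF x], of ?w k] by auto
  have "coding T \<alpha> y n = coding T \<alpha> x (p n)" for n
  proof (cases "n < k")
    case True then show ?thesis using y by (auto simp: cyl_def)
  next
    case False
    then have "p n = n" using k p(1) by (auto simp: permutes_def)
    moreover have "coding T \<alpha> y (k + (n - k)) = coding T \<alpha> x (k + (n - k))"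
      using y(2) by (metis coding_shift)
    ultimately show ?thesis using False by simp
  qed
  then have "y \<in> space M \<and> coding T \<alpha> y = coding T \<alpha> x \<circ> p" using y by (auto simp: cyl_def)
  then have "rearrange p x \<in> space M \<and> coding T \<alpha> (rearrange p x) = coding T \<alpha> x \<circ> p"
    unfolding rearrange_def
    by (rule theI) (metis coding_inject \<open>y \<in> space M \<and> _\<close>)
  then show "rearrange p x \<in> space M" "coding T \<alpha> (rearrange p x) n = coding T \<alpha> x (p n)"
    by auto
qed

lemma rearrange_related:
  assumes p: "p permutes S" "finite S" and x: "x \<in> space M"
  shows "(x, rearrange p x) \<in> exchangeable_relation M T \<alpha>"
proof -
  have "{n. p n \<noteq> n} \<subseteq> S" using p(1) by (auto simp: permutes_def)
  then have "finite {n. p n \<noteq> n}" using p(2) by (rule finite_subset)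
  then show ?thesis
    using rearrange[OF p x] x permutes_bij[OF p(1)] by (auto simp: exchangeable_relation_def)
qed

lemma rearrange_measurable:
  assumes p: "p permutes S" "finite S"
  shows "rearrange p \<in> measurable M M"
proof (rule measurable_sigma_sets[OF sets_coordinates])
  show "{{x\<in>space M. coding T \<alpha> x n = a} | n a. a \<in> \<alpha>} \<subseteq> Pow (space M)" by auto
  show "rearrange p \<in> space M \<rightarrow> space M" using rearrange[OF p] by auto
  fix B assume "B \<in> {{x\<in>space M. coding T \<alpha> x n = a} | n a. a \<in> \<alpha>}"
  then obtain n a where B: "B = {x\<in>space M. coding T \<alpha> x n = a}" by blast
  have "rearrange p -` B \<inter> space M = {x\<in>space M. coding T \<alpha> x (p n) = a}"
    using rearrange[OF p] by (auto simp: B)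
  then show "rearrange p -` B \<inter> space M \<in> sets M" by simp
qed

lemma rearrange_inverse:
  assumes p: "p permutes S" "finite S" and x: "x \<in> space M"
  shows "rearrange (inv p) (rearrange p x) = x" "rearrange p (rearrange (inv p) x) = x"
proof -
  note ip = permutes_inv[OF p(1)] p(2)
  show "rearrange (inv p) (rearrange p x) = x"
    using rearrange[OF p x] rearrange[OF ip rearrange(1)[OF p x]] x permutes_inverses[OF p(1)]
    by (intro coding_inject) auto
  show "rearrange p (rearrange (inv p) x) = x"
    using rearrange[OF ip x] rearrange[OF p rearrange(1)[OF ip x]] x permutes_inverses[OF p(1)]
    by (intro coding_inject) auto
qed

end

text \<open>Invariance of a function under a relation; it is used for the exchangeable relation.\<close>

definition exchangeable_fun :: "('a \<times> 'a) set \<Rightarrow> ('a \<Rightarrow> 'c) \<Rightarrow> bool" where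
  "exchangeable_fun R h \<longleftrightarrow> (\<forall>x y. (x, y) \<in> R \<longrightarrow> h x = h y)"

text \<open>
  A measure on a full fibred system that is invariant under the exchangeable relation. It need not be
  \<open>\<sigma>\<close>-finite.
\<close>

locale exchangeable_measure = full_fibred_system M T \<alpha> for M T \<alpha> +
  fixes \<mu> :: "'a measure"
  assumes sets_mu: "sets \<mu> = sets M"
    and invariant: "relation_invariant (exchangeable_relation M T \<alpha>) \<mu>"
begin

lemma space_mu: "space \<mu> = space M"
  using sets_mu by (rule sets_eq_imp_space_eq)

lemma measurable_mu[simp]: "measurable \<mu> N = measurable M N"
  using sets_mu by (rule measurable_cong_sets) simp

text \<open>The measurable functions that do not see finite rearrangements.\<close>

abbreviation exch :: "('a \<Rightarrow> ennreal) \<Rightarrow> bool" where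
  "exch h \<equiv> h \<in> borel_measurable M \<and> exchangeable_fun (exchangeable_relation M T \<alpha>) h"

lemma exch_rearrange:
  assumes "exch h" "p permutes S" "finite S" "x \<in> space M"
  shows "h (rearrange p x) = h x"
  using assms(1) rearrange_related[OF assms(2,3,4)] unfolding exchangeable_fun_def by metis

lemma emeasure_rearrange:
  assumes p: "p permutes S" "finite S" and C: "C \<in> sets M"
  shows "emeasure \<mu> (rearrange p ` C) = emeasure \<mu> C"
proof -
  note ip = permutes_inv[OF p(1)] p(2)
  have inj: "inj_on (rearrange p) (space M)"
    by (rule inj_on_inverseI) (rule rearrange_inverse(1)[OF p])
  have bij: "bij_betw (rearrange p) (space M) (space M)"
    by (rule bij_betwI[where g = "rearrange (inv p)"])
      (use rearrange(1)[OF p] rearrange(1)[OF ip] rearrange_inverse[OF p] in auto)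
  have "the_inv_into (space M) (rearrange p) x = rearrange (inv p) x" if "x \<in> space M" for x
    using rearrange_inverse(2)[OF p that] rearrange(1)[OF ip that]
    by (intro the_inv_into_f_eq[OF inj]) auto
  then have inv: "the_inv_into (space M) (rearrange p) \<in> measurable M M"
    using rearrange_measurable[OF ip] by (simp cong: measurable_cong)
  have r: "sets (restrict_space \<mu> (space M)) = sets M"
    using sets_mu sets_restrict_space_iff[of "space M" \<mu>] sets.sets_into_space[of _ M] space_mu
    by auto
  have "holonomy \<mu> (exchangeable_relation M T \<alpha>) (space M) (space M) (rearrange p)"
    unfolding holonomy_def bimeasurable_bij_def
    using bij inv rearrange_measurable[OF p] rearrange_related[OF p] sets_mu measurable_cong_sets[OF r r] by auto
  then show ?thesis
    using invariant C sets_mu sets.sets_into_space[OF C] unfolding relation_invariant_def by blast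
qed

lemma nn_integral_rearrange:
  assumes p: "p permutes S" "finite S" and h: "h \<in> borel_measurable M"
  shows "(\<integral>\<^sup>+x. h (rearrange p x) \<partial>\<mu>) = (\<integral>\<^sup>+x. h x \<partial>\<mu>)"
proof -
  note ip = permutes_inv[OF p(1)] p(2)
  have rm: "rearrange p \<in> measurable \<mu> M" using rearrange_measurable[OF p] by simp
  have "distr \<mu> M (rearrange p) = \<mu>"
  proof (rule measure_eqI)
    fix C assume "C \<in> sets (distr \<mu> M (rearrange p))"
    then have C: "C \<in> sets M" by simp
    then have sub: "C \<subseteq> space M" by (rule sets.sets_into_space)
    have "rearrange p -` C \<inter> space M = rearrange (inv p) ` C"
    proof (intro set_eqI iffI)
      fix x assume "x \<in> rearrange p -` C \<inter> space M"
      then show "x \<in> rearrange (inv p) ` C"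
        using rearrange_inverse(1)[OF p, of x] by (intro image_eqI[of _ _ "rearrange p x"]) auto
    next
      fix x assume "x \<in> rearrange (inv p) ` C"
      then show "x \<in> rearrange p -` C \<inter> space M"
        using rearrange_inverse(2)[OF p] rearrange(1)[OF ip] sub by auto
    qed
    then show "emeasure (distr \<mu> M (rearrange p)) C = emeasure \<mu> C"
      using emeasure_rearrange[OF ip C] C rm by (simp add: emeasure_distr space_mu)
  qed (simp add: sets_mu)
  then show ?thesis using nn_integral_distr[OF rm, of h] h by simp
qed

end

section \<open>Convergence of averages\<close>

text \<open>
  If all products of two different terms have the same integral, and all squares have the same
  integral, then the averages converge in \<open>L\<^sup>2\<close>:
  the squared distance of the averages of lengths \<open>m \<le> n\<close> is at most a constant times \<open>1/m\<close>. Along the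
  powers of 4 the increments are absolutely summable, which gives convergence almost everywhere.
\<close>

lemma averages_converge_AE:
  fixes f :: "nat \<Rightarrow> 'x \<Rightarrow> real"
  assumes Q: "finite_measure Q" and f[measurable]: "\<And>i. f i \<in> borel_measurable Q"
    and f01: "\<And>i x. 0 \<le> f i x" "\<And>i x. f i x \<le> 1"
    and off: "\<And>i j. i \<noteq> j \<Longrightarrow> (\<integral>x. f i x * f j x \<partial>Q) = u"
    and diag: "\<And>i. (\<integral>x. f i x * f i x \<partial>Q) = v"
  shows "AE x in Q. convergent (\<lambda>j. (\<Sum>i<4 ^ j. f i x) / 4 ^ j)"
proof -
  interpret Q: finite_measure Q by fact
  define S where "S n x = (\<Sum>i<n. f i x) / real n" for n x
  have [measurable]: "S n \<in> borel_measurable Q" for n unfolding S_def by measurable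
  have int[simp]: "integrable Q (\<lambda>x. f i x * f j x)" for i j
    using f01 by (intro Q.integrable_const_bound[where B = 1]) (auto simp: mult_le_one)
  have prodS: "S m x * S n x = (\<Sum>i<m. \<Sum>j<n. f i x * f j x) / (real m * real n)" for m n x
    by (simp add: S_def sum_product)
  have intS[simp]: "integrable Q (\<lambda>x. S m x * S n x)" for m n
    unfolding prodS by simp
  have SS: "(\<integral>x. S m x * S n x \<partial>Q) = u + (v - u) / real n" if "0 < m" "m \<le> n" for m n
  proof -
    have "(\<integral>x. S m x * S n x \<partial>Q) = (\<Sum>i<m. \<Sum>j<n. (\<integral>x. f i x * f j x \<partial>Q)) / (real m * real n)"
      unfolding prodS by simp
    also have "(\<Sum>i<m. \<Sum>j<n. (\<integral>x. f i x * f j x \<partial>Q)) = (\<Sum>i<m. real n * u + (v - u))"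
    proof (rule sum.cong[OF refl])
      fix i assume "i \<in> {..<m}"
      then have i: "i < n" using that by simp
      have "(\<Sum>j<n. (\<integral>x. f i x * f j x \<partial>Q)) = (\<Sum>j<n. u + (if j = i then v - u else 0))"
        by (rule sum.cong) (auto simp: off diag)
      also have "\<dots> = real n * u + (v - u)" using i by (simp add: sum.distrib)
      finally show "(\<Sum>j<n. (\<integral>x. f i x * f j x \<partial>Q)) = real n * u + (v - u)" .
    qed
    also have "\<dots> / (real m * real n) = u + (v - u) / real n"
      using that by (simp add: field_simps)
    finally show ?thesis .
  qed
  define D where "D j x = S (4 ^ Suc j) x - S (4 ^ j) x" for j x
  have [measurable]: "D j \<in> borel_measurable Q" for j unfolding D_def by measurable
  have Dsq: "D j x * D j x = S (4 ^ Suc j) x * S (4 ^ Suc j) x - 2 * (S (4 ^ j) x * S (4 ^ Suc j) x)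
      + S (4 ^ j) x * S (4 ^ j) x" for j x
    unfolding D_def by algebra
  have intD: "integrable Q (\<lambda>x. D j x * D j x)" for j unfolding Dsq by simp
  have Dint: "(\<integral>x. D j x * D j x \<partial>Q) = (v - u) * (3 / 4) / 4 ^ j" for j
    unfolding Dsq by (simp add: SS del: power_Suc) (simp add: field_simps)
  let ?q = "measure Q (space Q)"
  define C where "C = (\<bar>v - u\<bar> + ?q) / 2"
  \<comment> \<open>From \<open>L\<^sup>2\<close> to \<open>L\<^sup>1\<close> by the arithmetic-geometric mean inequality.\<close>
  have Dle: "(\<integral>\<^sup>+x. ennreal \<bar>D j x\<bar> \<partial>Q) \<le> ennreal (C * (1 / 2) ^ j)" for j
  proof -
    have am: "\<bar>t\<bar> \<le> (2 ^ j * (t * t) + (1 / 2) ^ j) / 2" for t :: real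
    proof -
      have "0 \<le> (2 ^ j * \<bar>t\<bar> - 1) ^ 2 / 2 ^ j" by simp
      also have "\<dots> = 2 ^ j * (t * t) + (1 / 2) ^ j - 2 * \<bar>t\<bar>"
        by (simp add: power2_eq_square field_simps power_one_over)
      finally show ?thesis by simp
    qed
    have "(\<integral>\<^sup>+x. ennreal \<bar>D j x\<bar> \<partial>Q) \<le> (\<integral>\<^sup>+x. ennreal ((2 ^ j * (D j x * D j x) + (1 / 2) ^ j) / 2) \<partial>Q)"
      by (intro nn_integral_mono ennreal_leI am)
    also have "\<dots> = ennreal (\<integral>x. (2 ^ j * (D j x * D j x) + (1 / 2) ^ j) / 2 \<partial>Q)"
      using intD by (intro nn_integral_eq_integral) auto
    also have "(\<integral>x. (2 ^ j * (D j x * D j x) + (1 / 2) ^ j) / 2 \<partial>Q) =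
        (2 ^ j * ((v - u) * (3 / 4) / 4 ^ j) + (1 / 2) ^ j * ?q) / 2"
      using intD by (simp add: Dint mult.commute)
    also have "\<dots> \<le> C * (1 / 2) ^ j"
    proof -
      have "(2::real) ^ j / 4 ^ j = (1 / 2) ^ j" by (simp flip: power_divide)
      then have "2 ^ j * ((v - u) * (3 / 4) / 4 ^ j) = (v - u) * (3 / 4) * (1 / 2) ^ j"
        by (metis mult.commute times_divide_eq_left times_divide_eq_right)
      also have "\<dots> \<le> \<bar>v - u\<bar> * (1 / 2) ^ j"
      proof (rule mult_right_mono)
        show "(v - u) * (3 / 4) \<le> \<bar>v - u\<bar>"
          using mult_mono[OF abs_ge_self[of "v - u"], of "3 / 4" 1] by simp
      qed simp
      finally have "2 ^ j * ((v - u) * (3 / 4) / 4 ^ j) \<le> \<bar>v - u\<bar> * (1 / 2) ^ j" .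
      moreover have "C * (1 / 2) ^ j = (\<bar>v - u\<bar> * (1 / 2) ^ j + (1 / 2) ^ j * ?q) / 2"
        by (simp add: C_def algebra_simps)
      ultimately show ?thesis by simp
    qed
    finally show ?thesis by (simp add: ennreal_leI)
  qed
  have "(\<integral>\<^sup>+x. (\<Sum>j. ennreal \<bar>D j x\<bar>) \<partial>Q) = (\<Sum>j. \<integral>\<^sup>+x. ennreal \<bar>D j x\<bar> \<partial>Q)"
    by (intro nn_integral_suminf) simp
  also have "\<dots> \<le> (\<Sum>j. ennreal (C * (1 / 2) ^ j))" by (intro suminf_le Dle) auto
  also have "\<dots> = ennreal (\<Sum>j. C * (1 / 2) ^ j)"
    by (intro suminf_ennreal2 summable_mult summable_geometric) (auto simp: C_def)
  finally have "(\<integral>\<^sup>+x. (\<Sum>j. ennreal \<bar>D j x\<bar>) \<partial>Q) \<noteq> \<infinity>" by (auto simp: top_unique)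
  then have "AE x in Q. (\<Sum>j. ennreal \<bar>D j x\<bar>) \<noteq> \<infinity>" by (intro nn_integral_PInf_AE) auto
  then show ?thesis
  proof eventually_elim
    case (elim x)
    then have "summable (\<lambda>j. \<bar>D j x\<bar>)" by (intro summable_suminf_not_top) auto
    then have "summable (\<lambda>j. D j x)" by (rule summable_rabs_cancel)
    then have "convergent (\<lambda>n. \<Sum>j<n. D j x)" by (simp add: summable_iff_convergent)
    moreover have "(\<Sum>j<n. D j x) = S (4 ^ n) x - S 1 x" for n
      unfolding D_def by (subst sum_lessThan_telescope) simp
    ultimately have "convergent (\<lambda>n. (S (4 ^ n) x - S 1 x) + S 1 x)"
      by (intro convergent_add convergent_const) simp
    then show ?case by (simp add: S_def)
  qed
qed

section \<open>Frequencies of letters and the product formula\<close>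

context exchangeable_measure
begin

text \<open>The frequency of the letter \<open>a\<close> among the \<open>n\<close> coordinates from number \<open>k\<close> on.\<close>

definition freq :: "nat \<Rightarrow> 'a set \<Rightarrow> nat \<Rightarrow> 'a \<Rightarrow> real" where
  "freq k a n x = (\<Sum>i<n. indicator {a} (coding T \<alpha> x (k + i))) / real n"

text \<open>
  The limit frequency of a letter, along the powers of 4. The upper limit is taken so that it is
  defined everywhere and is invariant under finite rearrangements at every point.
\<close>

definition lim_freq :: "'a set \<Rightarrow> 'a \<Rightarrow> ennreal" where
  "lim_freq a x = limsup (\<lambda>j. ennreal (freq 0 a (4 ^ j) x))"

text \<open>The probability of a word under the product measure with the limit frequencies as weights.\<close>

definition word_freq :: "'a set list \<Rightarrow> 'a \<Rightarrow> ennreal" where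
  "word_freq w x = (\<Prod>a\<leftarrow>w. lim_freq a x)"

text \<open>The words whose cylinders have finite measure. Local finiteness means that they cover the space.\<close>

definition good_words :: "'a set list set" where
  "good_words = {w\<in>lists \<alpha>. emeasure \<mu> (cyl w) < \<infinity>}"

lemma word_freq_simps[simp]:
  "word_freq [] x = 1" "word_freq (a # w) x = lim_freq a x * word_freq w x"
  by (auto simp: word_freq_def)

lemma coding_pred[measurable]: "Measurable.pred M (\<lambda>x. coding T \<alpha> x n = a)"
  using coordinate_measurable by (simp add: pred_def)

lemma indicator_coding: "indicator {a} (coding T \<alpha> x n) = (if coding T \<alpha> x n = a then 1 else 0)"
  by (auto simp: indicator_def)

lemma freq_measurable[measurable]: "freq k a n \<in> borel_measurable M"
  unfolding freq_def indicator_coding by measurable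

lemma freq_bounds: "0 \<le> freq k a n x" "freq k a n x \<le> 1"
proof -
  show "0 \<le> freq k a n x" unfolding freq_def by (intro divide_nonneg_nonneg sum_nonneg) auto
  have "(\<Sum>i<n. indicator {a} (coding T \<alpha> x (k + i))) \<le> (\<Sum>i<n. 1::real)"
    by (intro sum_mono) (auto simp: indicator_def)
  then show "freq k a n x \<le> 1" unfolding freq_def by (auto simp: divide_le_eq_1)
qed

lemma lim_freq_measurable[measurable]: "lim_freq a \<in> borel_measurable M"
  unfolding lim_freq_def by measurable

lemma lim_freq_le_1: "lim_freq a x \<le> 1"
  unfolding lim_freq_def
  by (intro Limsup_bounded always_eventually allI) (use freq_bounds in \<open>simp add: ennreal_le_1\<close>)

lemma word_freq_measurable[measurable]: "word_freq w \<in> borel_measurable M"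
  by (induction w) (simp_all add: fun_eq_iff[of "word_freq _", symmetric] word_freq_def[abs_def])

lemma word_freq_le_1: "word_freq w x \<le> 1"
proof (induction w)
  case (Cons a w)
  have "lim_freq a x * word_freq w x \<le> 1 * 1" using Cons lim_freq_le_1 by (intro mult_mono) auto
  then show ?case by simp
qed simp

lemma lim_freq_exch: "exch (lim_freq a)"
proof (intro conjI lim_freq_measurable, unfold exchangeable_fun_def, intro allI impI)
  fix x y assume "(x, y) \<in> exchangeable_relation M T \<alpha>"
  then obtain p :: "nat \<Rightarrow> nat" where p: "bij p" "finite {n. p n \<noteq> n}"
    and xy: "\<And>n. coding T \<alpha> y n = coding T \<alpha> x (p n)"
    by (auto simp: exchangeable_relation_def)
  obtain N where N: "{n. p n \<noteq> n} \<subseteq> {..<N}" using p(2) finite_nat_iff_bounded by blast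
  have "freq 0 a n y = freq 0 a n x" if n: "n \<ge> N" for n
  proof -
    have perm: "p permutes {..<n}"
      unfolding permutes_def using p(1) N n by (auto simp: bij_iff)
    have "(\<Sum>i<n. indicator {a} (coding T \<alpha> y i)) = (\<Sum>i<n. (\<lambda>i. indicator {a} (coding T \<alpha> x i)) (p i) :: real)"
      by (simp add: xy)
    also have "\<dots> = (\<Sum>i<n. indicator {a} (coding T \<alpha> x i))"
      using sum.permute[OF perm, of "\<lambda>i. indicator {a} (coding T \<alpha> x i) :: real"] by (simp add: comp_def)
    finally show ?thesis by (simp add: freq_def)
  qed
  note eq = this
  have "eventually (\<lambda>j. ennreal (freq 0 a (4 ^ j) x) = ennreal (freq 0 a (4 ^ j) y)) sequentially"
    unfolding eventually_sequentially
  proof (intro exI allI impI)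
    fix j assume "N \<le> j"
    also have "j \<le> 4 ^ j" by (rule less_imp_le[OF power_gt_expt]) simp
    finally show "ennreal (freq 0 a (4 ^ j) x) = ennreal (freq 0 a (4 ^ j) y)" using eq by simp
  qed
  then show "lim_freq a x = lim_freq a y" unfolding lim_freq_def by (rule Limsup_eq)
qed

lemma exch_mult: "exch g \<Longrightarrow> exch h \<Longrightarrow> exch (\<lambda>x. g x * h x)"
  by (auto simp: exchangeable_fun_def)

lemma word_freq_exch: "exch (word_freq w)"
proof (induction w)
  case (Cons a w)
  then show ?case using exch_mult[OF lim_freq_exch[of a] Cons]
    by (simp add: word_freq_def[abs_def])
qed (auto simp: exchangeable_fun_def word_freq_def[abs_def])

lemma good_append: "w \<in> good_words \<Longrightarrow> v \<in> lists \<alpha> \<Longrightarrow> w @ v \<in> good_words"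
  using emeasure_mono[OF cyl_append_subset, of w \<mu> v] sets_mu cyl_measurable[of w]
  by (auto simp: good_words_def intro: le_less_trans)

lemma countable_good_words: "countable good_words"
  unfolding good_words_def using countable_letters
  by (auto intro: countable_subset[OF _ countable_lists])

text \<open>Permuting the letters of a word does not change the mass of exchangeable events on its cylinder.\<close>

lemma nn_integral_cyl_mset:
  assumes h: "exch h" and wv: "mset w = mset v"
  shows "(\<integral>\<^sup>+x\<in>cyl w. h x \<partial>\<mu>) = (\<integral>\<^sup>+x\<in>cyl v. h x \<partial>\<mu>)"
proof -
  obtain p where p: "p permutes {..<length v}" "permute_list p v = w"
    using mset_eq_permutation[OF wv] .
  have len: "length w = length v" using wv by (rule mset_eq_length)
  have iff: "rearrange p x \<in> cyl w \<longleftrightarrow> x \<in> cyl v" if x: "x \<in> space M" for x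
  proof -
    have "rearrange p x \<in> cyl w \<longleftrightarrow> (\<forall>j<length v. coding T \<alpha> x (p j) = v ! p j)"
      using rearrange[OF p(1) _ x] p len by (auto simp: cyl_def permute_list_nth)
    also have "\<dots> \<longleftrightarrow> (\<forall>j\<in>p ` {..<length v}. coding T \<alpha> x j = v ! j)" by auto
    also have "\<dots> \<longleftrightarrow> x \<in> cyl v" using permutes_image[OF p(1)] x by (auto simp: cyl_def)
    finally show ?thesis .
  qed
  have "(\<integral>\<^sup>+x\<in>cyl w. h x \<partial>\<mu>) = (\<integral>\<^sup>+x. h (rearrange p x) * indicator (cyl w) (rearrange p x) \<partial>\<mu>)"
    using h by (subst nn_integral_rearrange[OF p(1)]) auto
  also have "\<dots> = (\<integral>\<^sup>+x\<in>cyl v. h x \<partial>\<mu>)"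
  proof (rule nn_integral_cong)
    fix x assume "x \<in> space \<mu>"
    then have x: "x \<in> space M" by (simp add: space_mu)
    show "h (rearrange p x) * indicator (cyl w) (rearrange p x) = h x * indicator (cyl v) x"
      using exch_rearrange[OF h p(1) _ x] iff[OF x] by (simp add: indicator_def)
  qed
  finally show ?thesis .
qed

lemma emeasure_cyl_mset: "mset w = mset v \<Longrightarrow> emeasure \<mu> (cyl w) = emeasure \<mu> (cyl v)"
  using nn_integral_cyl_mset[of "\<lambda>_. 1" w v] sets_mu by (simp add: exchangeable_fun_def)

lemma good_mset: "w \<in> good_words \<Longrightarrow> mset w = mset v \<Longrightarrow> v \<in> good_words"
  using emeasure_cyl_mset[of w v] mset_eq_setD[of w v] by (auto simp: good_words_def)

lemma emeasure_rearrange_vimage: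
  assumes p: "p permutes S" "finite S" and C: "C \<in> sets M"
  shows "emeasure \<mu> (rearrange p -` C \<inter> space M) = emeasure \<mu> C"
proof -
  have "emeasure \<mu> (rearrange p -` C \<inter> space M) = (\<integral>\<^sup>+x. indicator C (rearrange p x) \<partial>\<mu>)"
  proof -
    have "rearrange p -` C \<inter> space M \<in> sets \<mu>"
      using measurable_sets[OF rearrange_measurable[OF p] C] sets_mu by simp
    then have "emeasure \<mu> (rearrange p -` C \<inter> space M) = (\<integral>\<^sup>+x. indicator (rearrange p -` C \<inter> space M) x \<partial>\<mu>)"
      by (rule nn_integral_indicator[symmetric])
    also have "\<dots> = (\<integral>\<^sup>+x. indicator C (rearrange p x) \<partial>\<mu>)"
      by (rule nn_integral_cong) (auto simp: indicator_def space_mu)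
    finally show ?thesis .
  qed
  also have "\<dots> = emeasure \<mu> C"
    using nn_integral_rearrange[OF p, of "indicator C"] C sets_mu by simp
  finally show ?thesis .
qed

lemma nn_integral_coordinate_exch:
  assumes h: "exch h" and i: "length w \<le> i" and j: "length w \<le> j"
  shows "(\<integral>\<^sup>+x\<in>cyl w. h x * indicator {a} (coding T \<alpha> x i) \<partial>\<mu>) =
    (\<integral>\<^sup>+x\<in>cyl w. h x * indicator {a} (coding T \<alpha> x j) \<partial>\<mu>)"
proof -
  let ?p = "Transposition.transpose i j"
  have p: "?p permutes {i, j}" "finite {i, j}" by (auto intro: permutes_swap_id)
  let ?g = "\<lambda>x. h x * indicator {a} (coding T \<alpha> x i) * indicator (cyl w) x"
  have "(\<integral>\<^sup>+x. ?g x \<partial>\<mu>) = (\<integral>\<^sup>+x. ?g (rearrange ?p x) \<partial>\<mu>)"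
    using h[THEN conjunct1, measurable] unfolding indicator_coding
    by (intro nn_integral_rearrange[OF p, symmetric]) measurable
  also have "\<dots> = (\<integral>\<^sup>+x\<in>cyl w. h x * indicator {a} (coding T \<alpha> x j) \<partial>\<mu>)"
  proof (rule nn_integral_cong)
    fix x assume "x \<in> space \<mu>"
    then have x: "x \<in> space M" by (simp add: space_mu)
    have "rearrange ?p x \<in> cyl w \<longleftrightarrow> x \<in> cyl w"
      using rearrange[OF p x] x i j by (auto simp: cyl_def transpose_def)
    then show "?g (rearrange ?p x) = h x * indicator {a} (coding T \<alpha> x j) * indicator (cyl w) x"
      using exch_rearrange[OF h p x] rearrange(2)[OF p x] by (simp add: indicator_def)
  qed
  finally show ?thesis .
qed

text \<open>A shift of the window by \<open>k\<close> changes the frequency by a vanishing amount.\<close>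

lemma freq_shift_diff: "\<bar>freq k a n x - freq 0 a n x\<bar> \<le> real k / real n"
proof -
  let ?g = "\<lambda>i. indicator {a} (coding T \<alpha> x i) :: real"
  have le: "0 \<le> (\<Sum>i<k. ?g (m + i))" "(\<Sum>i<k. ?g (m + i)) \<le> real k" for m
  proof -
    have "(\<Sum>i<k. ?g (m + i)) \<le> (\<Sum>i<k. 1)" by (intro sum_mono) (auto simp: indicator_def)
    then show "(\<Sum>i<k. ?g (m + i)) \<le> real k" by simp
  qed (auto intro: sum_nonneg)
  have split: "(\<Sum>i<m + n. ?g i) = (\<Sum>i<m. ?g i) + (\<Sum>i<n. ?g (m + i))" for m n
    by (induction n) auto
  have "(\<Sum>i<n. ?g (k + i)) - (\<Sum>i<n. ?g (0 + i)) = (\<Sum>i<k. ?g (n + i)) - (\<Sum>i<k. ?g (0 + i))"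
    using split[of k n] split[of n k] by (simp add: add.commute)
  then have "\<bar>(\<Sum>i<n. ?g (k + i)) - (\<Sum>i<n. ?g (0 + i))\<bar> \<le> real k"
    using le[of n] le[of 0] by auto
  moreover have "freq k a n x - freq 0 a n x = ((\<Sum>i<n. ?g (k + i)) - (\<Sum>i<n. ?g (0 + i))) / real n"
    by (simp add: freq_def diff_divide_distrib)
  ultimately show ?thesis by (simp add: divide_right_mono)
qed

text \<open>
  On a good cylinder, frequencies converge; they are taken over the coordinates behind the word,
  because only these are exchangeable under the measure restricted to the cylinder.
\<close>

lemma lim_freq_converges:
  assumes w: "w \<in> good_words"
  shows "AE x in \<mu>. x \<in> cyl w \<longrightarrow> (\<lambda>j. ennreal (freq (length w) a (4 ^ j) x)) \<longlonglongrightarrow> lim_freq a x"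
proof -
  let ?k = "length w"
  let ?Q = "restrict_space \<mu> (cyl w)"
  have cylm: "cyl w \<inter> space \<mu> \<in> sets \<mu>" using cyl_measurable cyl_subset_space sets_mu space_mu by auto
  have cylw: "cyl w \<in> sets \<mu>" using sets_mu by simp
  have spQ: "space ?Q = cyl w" using cyl_subset_space by (auto simp: space_restrict_space space_mu)
  have finQ: "finite_measure ?Q"
    using w emeasure_restrict_space[OF cylm, of "cyl w"]
    by (intro finite_measureI) (auto simp: spQ good_words_def)
  define f where "f r x = (indicator {a} (coding T \<alpha> x (?k + r)) :: real)" for r x
  have fm: "f r \<in> borel_measurable ?Q" for r
    unfolding f_def indicator_coding by (rule measurable_restrict_space1) simp
  define C where "C r s = {x\<in>cyl w. coding T \<alpha> x (?k + r) = a \<and> coding T \<alpha> x (?k + s) = a}" for r s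
  have Cm: "C r s \<in> sets M" for r s
  proof -
    have "C r s = cyl w \<inter> {x\<in>space M. coding T \<alpha> x (?k + r) = a} \<inter> {x\<in>space M. coding T \<alpha> x (?k + s) = a}"
      using cyl_subset_space by (auto simp: C_def)
    then show ?thesis by simp
  qed
  have ff: "(\<integral>x. f r x * f s x \<partial>?Q) = measure \<mu> (C r s)" for r s
  proof -
    have "(\<integral>x. f r x * f s x \<partial>?Q) = (\<integral>x. indicator (C r s) x \<partial>?Q)"
      by (rule Bochner_Integration.integral_cong) (auto simp: f_def C_def spQ indicator_def)
    also have "\<dots> = measure ?Q (C r s)"
      using spQ by (auto simp: C_def intro!: arg_cong[of _ _ "measure _"])
    also have "\<dots> = measure \<mu> (C r s)"
      by (rule measure_restrict_space[OF cylm]) (auto simp: C_def)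
    finally show ?thesis .
  qed
  have step: "measure \<mu> (C r s) = measure \<mu> (C r' s)" if "r \<noteq> s" "r' \<noteq> s" for r r' s
  proof -
    let ?p = "Transposition.transpose (?k + r) (?k + r')"
    have p: "?p permutes {?k + r, ?k + r'}" "finite {?k + r, ?k + r'}" by (auto intro: permutes_swap_id)
    have "rearrange ?p -` C r s \<inter> space M = C r' s"
      using rearrange[OF p] that cyl_subset_space by (auto simp: C_def cyl_def transpose_def)
    then show ?thesis using emeasure_rearrange_vimage[OF p Cm[of r s]] by (simp add: measure_def)
  qed
  have C_comm: "C r s = C s r" for r s by (auto simp: C_def)
  have stepd: "measure \<mu> (C r r) = measure \<mu> (C 0 0)" for r
  proof -
    let ?p = "Transposition.transpose (?k + r) (?k + 0)"
    have p: "?p permutes {?k + r, ?k + 0}" "finite {?k + r, ?k + 0}" by (auto intro: permutes_swap_id)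
    have "rearrange ?p -` C r r \<inter> space M = C 0 0"
      using rearrange[OF p] cyl_subset_space by (auto simp: C_def cyl_def transpose_def)
    then show ?thesis using emeasure_rearrange_vimage[OF p Cm[of r r]] by (simp add: measure_def)
  qed
  have off: "measure \<mu> (C r s) = measure \<mu> (C 0 1)" if "r \<noteq> s" for r s
  proof (cases "s = 0")
    case True
    then show ?thesis using step[of r 0 1] that C_comm[of 1 0] by simp
  next
    case False
    then show ?thesis
      using step[of r s 0] step[of s 0 1] that C_comm[of 0 s] C_comm[of 1 0] by simp
  qed
  have "AE x in ?Q. convergent (\<lambda>j. (\<Sum>i<4 ^ j. f i x) / 4 ^ j)"
  proof (rule averages_converge_AE[OF finQ fm])
    show "(\<integral>x. f r x * f s x \<partial>?Q) = measure \<mu> (C 0 1)" if "r \<noteq> s" for r s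
      unfolding ff by (rule off[OF that])
    show "(\<integral>x. f r x * f r x \<partial>?Q) = measure \<mu> (C 0 0)" for r
      unfolding ff by (rule stepd)
  qed (auto simp: f_def)
  then have "AE x in \<mu>. x \<in> cyl w \<longrightarrow> convergent (\<lambda>j. freq ?k a (4 ^ j) x)"
    by (simp add: AE_restrict_space_iff[OF cylm] f_def freq_def)
  then show ?thesis
  proof eventually_elim
    case (elim x)
    show ?case
    proof
      assume "x \<in> cyl w"
      with elim obtain l where l: "(\<lambda>j. freq ?k a (4 ^ j) x) \<longlonglongrightarrow> l" by (auto simp: convergent_def)
      have "(\<lambda>j. freq ?k a (4 ^ j) x - freq 0 a (4 ^ j) x) \<longlonglongrightarrow> 0"
      proof (rule Lim_null_comparison)
        show "\<forall>\<^sub>F j in sequentially. norm (freq ?k a (4 ^ j) x - freq 0 a (4 ^ j) x) \<le> real ?k * (1 / 4) ^ j"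
        proof (intro always_eventually allI)
          fix j
          have "real ?k / real (4 ^ j) = real ?k * (1 / 4) ^ j" by (simp add: power_divide)
          then show "norm (freq ?k a (4 ^ j) x - freq 0 a (4 ^ j) x) \<le> real ?k * (1 / 4) ^ j"
            using freq_shift_diff[of ?k a "4 ^ j" x] by simp
        qed
        show "(\<lambda>j. real ?k * (1 / 4) ^ j) \<longlonglongrightarrow> 0"
          by (intro tendsto_mult_right_zero LIMSEQ_power_zero) simp
      qed
      from tendsto_diff[OF l this] have "(\<lambda>j. freq 0 a (4 ^ j) x) \<longlonglongrightarrow> l" by simp
      then have "lim_freq a x = ennreal l"
        unfolding lim_freq_def by (intro lim_imp_Limsup) (auto intro: tendsto_ennrealI)
      then show "(\<lambda>j. ennreal (freq ?k a (4 ^ j) x)) \<longlonglongrightarrow> lim_freq a x"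
        using tendsto_ennrealI[OF l] by simp
    qed
  qed
qed

end

lemma borel_measurable_nn_integral_count_space:
  fixes g :: "'i \<Rightarrow> 'x \<Rightarrow> ennreal"
  assumes I: "countable I" and g: "\<And>i. i \<in> I \<Longrightarrow> g i \<in> borel_measurable N"
  shows "(\<lambda>x. \<integral>\<^sup>+i. g i x \<partial>count_space I) \<in> borel_measurable N"
proof -
  interpret sigma_finite_measure "count_space I"
    using I by (rule sigma_finite_measure_count_space_countable)
  have "(\<lambda>p. g (snd p) (fst p)) \<in> borel_measurable (N \<Otimes>\<^sub>M count_space I)"
    using I g by (intro measurable_compose_countable'[where f = "\<lambda>i p. g i (fst p)" and g = snd and I = I]
      measurable_compose[OF measurable_fst]) auto
  then show ?thesis by (intro borel_measurable_nn_integral) (simp add: case_prod_beta')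
qed

lemma AE_eq_1_if_nn_integral:
  fixes g :: "'x \<Rightarrow> ennreal"
  assumes B: "B \<in> sets N" "emeasure N B < \<infinity>" and g: "g \<in> borel_measurable N"
    and le: "AE x in N. x \<in> B \<longrightarrow> g x \<le> 1" and int: "(\<integral>\<^sup>+x\<in>B. g x \<partial>N) = emeasure N B"
  shows "AE x in N. x \<in> B \<longrightarrow> g x = 1"
proof -
  have m: "(\<lambda>x. g x * indicator B x) \<in> borel_measurable N" using B g by simp
  have "(\<integral>\<^sup>+x. indicator B x - g x * indicator B x \<partial>N) =
      (\<integral>\<^sup>+x. indicator B x \<partial>N) - (\<integral>\<^sup>+x\<in>B. g x \<partial>N)"
    using B m int le by (intro nn_integral_diff) (auto simp: indicator_def elim!: eventually_mono)
  also have "\<dots> = 0" using B int by (simp add: less_top)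
  finally have "AE x in N. indicator B x - g x * indicator B x = 0"
    using B m by (subst (asm) nn_integral_0_iff_AE) auto
  then show ?thesis
    using le
  proof eventually_elim
    case (elim x)
    then show ?case by (auto simp: diff_eq_0_iff_ennreal)
  qed
qed

context exchangeable_measure
begin

lemma borel_mu: "borel_measurable \<mu> = borel_measurable M" by simp

lemma cyl_mu[measurable, simp]: "cyl w \<in> sets \<mu>"
  using sets_mu by simp

lemma ennreal_freq:
  "n > 0 \<Longrightarrow> ennreal (freq k a n x) =
    ennreal (1 / n) * (\<Sum>i<n. indicator {a} (coding T \<alpha> x (k + i)))"
  by (simp add: freq_def ennreal_mult[symmetric] sum_nonneg flip: ennreal_indicator)

text \<open>
  Conditionally on a good word and on the exchangeable events, the next letter is \<open>a\<close> with probability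
  \<open>lim_freq a\<close>: all coordinates behind the word may be averaged over.
\<close>

lemma lim_freq_step_bounded:
  assumes w: "w \<in> good_words" and h: "exch h" and bd: "\<And>x. h x \<le> of_nat N"
  shows "(\<integral>\<^sup>+x\<in>cyl (w @ [a]). h x \<partial>\<mu>) = (\<integral>\<^sup>+x\<in>cyl w. h x * lim_freq a x \<partial>\<mu>)"
proof -
  let ?k = "length w"
  note [measurable] = h[THEN conjunct1]
  define I where "I = (\<integral>\<^sup>+x\<in>cyl w. h x * indicator {a} (coding T \<alpha> x ?k) \<partial>\<mu>)"
  have Ieq: "I = (\<integral>\<^sup>+x\<in>cyl (w @ [a]). h x \<partial>\<mu>)"
    unfolding I_def by (rule nn_integral_cong) (auto simp: cyl_snoc indicator_def)
  define u where "u n x = h x * ennreal (freq ?k a n x) * indicator (cyl w) x" for n x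
  have um[measurable]: "u n \<in> borel_measurable M" for n unfolding u_def by simp
  have int: "(\<integral>\<^sup>+x. u n x \<partial>\<mu>) = I" if n: "n > 0" for n
  proof -
    have "(\<integral>\<^sup>+x. u n x \<partial>\<mu>) = (\<integral>\<^sup>+x. ennreal (1 / n) *
        (\<Sum>i<n. h x * indicator {a} (coding T \<alpha> x (?k + i)) * indicator (cyl w) x) \<partial>\<mu>)"
      unfolding u_def ennreal_freq[OF n]
      by (intro nn_integral_cong) (simp only: sum_distrib_left sum_distrib_right mult_ac)
    also have "\<dots> = ennreal (1 / n) *
        (\<Sum>i<n. (\<integral>\<^sup>+x\<in>cyl w. h x * indicator {a} (coding T \<alpha> x (?k + i)) \<partial>\<mu>))"
    proof -
      have m: "(\<lambda>x. h x * indicator {a} (coding T \<alpha> x (?k + i)) * indicator (cyl w) x) \<in> borel_measurable \<mu>" for i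
        unfolding indicator_coding by simp
      show ?thesis
        by (subst nn_integral_cmult[OF borel_measurable_sum[OF m]], subst nn_integral_sum[OF m]) (rule refl)
    qed
    also have "\<dots> = ennreal (1 / n) * (of_nat n * I)"
      unfolding I_def
      by (simp add: nn_integral_coordinate_exch[OF h, of w "?k + _" ?k a])
    also have "\<dots> = I"
    proof -
      have "ennreal (1 / n) * of_nat n = 1"
        using n by (simp add: ennreal_of_nat_eq_real_of_nat ennreal_mult[symmetric])
      then show ?thesis by (simp only: mult.assoc[symmetric] mult_1)
    qed
    finally show ?thesis .
  qed
  have "(\<lambda>j. (\<integral>\<^sup>+x. u (4 ^ j) x \<partial>\<mu>)) \<longlonglongrightarrow> (\<integral>\<^sup>+x\<in>cyl w. h x * lim_freq a x \<partial>\<mu>)"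
  proof (rule nn_integral_dominated_convergence[where w = "\<lambda>x. of_nat N * indicator (cyl w) x"])
    show "AE x in \<mu>. u (4 ^ j) x \<le> of_nat N * indicator (cyl w) x" for j
    proof (intro AE_I2)
      fix x
      have "h x * ennreal (freq ?k a (4 ^ j) x) \<le> of_nat N * 1"
        using bd[of x] freq_bounds(2)[of ?k a "4 ^ j" x] by (intro mult_mono) (auto simp: ennreal_le_1)
      then show "u (4 ^ j) x \<le> of_nat N * indicator (cyl w) x"
        by (auto simp: u_def indicator_def)
    qed
    have "(\<integral>\<^sup>+x. of_nat N * indicator (cyl w) x \<partial>\<mu>) = of_nat N * emeasure \<mu> (cyl w)"
      by (simp add: nn_integral_cmult_indicator)
    then show "(\<integral>\<^sup>+x. of_nat N * indicator (cyl w) x \<partial>\<mu>) < \<infinity>"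
      using w by (simp add: good_words_def ennreal_mult_less_top of_nat_less_top)
    show "AE x in \<mu>. (\<lambda>j. u (4 ^ j) x) \<longlonglongrightarrow> h x * lim_freq a x * indicator (cyl w) x"
      using lim_freq_converges[OF w, of a]
    proof eventually_elim
      case (elim x)
      have "h x \<noteq> \<infinity>" using bd[of x] by (auto simp: top_unique)
      with elim show ?case
        by (cases "x \<in> cyl w") (auto simp: u_def intro!: ennreal_tendsto_cmult simp: less_top)
    qed
  qed (auto simp: um)
  moreover have "(\<lambda>j. (\<integral>\<^sup>+x. u (4 ^ j) x \<partial>\<mu>)) = (\<lambda>j. I)" using int by simp
  ultimately have "I = (\<integral>\<^sup>+x\<in>cyl w. h x * lim_freq a x \<partial>\<mu>)"
    using LIMSEQ_unique[OF tendsto_const] by metis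
  then show ?thesis by (simp add: Ieq)
qed

lemma lim_freq_step:
  assumes w: "w \<in> good_words" and h: "exch h"
  shows "(\<integral>\<^sup>+x\<in>cyl (w @ [a]). h x \<partial>\<mu>) = (\<integral>\<^sup>+x\<in>cyl w. h x * lim_freq a x \<partial>\<mu>)"
proof -
  note [measurable] = h[THEN conjunct1]
  define g where "g N x = inf (h x) (of_nat N)" for N x
  have g: "exch (g N)" for N
    using h unfolding g_def[abs_def] by (auto simp: exchangeable_fun_def) 
  have gm[measurable]: "g N \<in> borel_measurable M" for N using g by blast
  have gmono: "g N x \<le> g N' x" if "N \<le> N'" for N N' x
    unfolding g_def using that by (intro inf_mono) auto
  have hg: "h x = (SUP N. g N x)" for x
    unfolding g_def by (simp add: inf_SUP[symmetric] ennreal_SUP_of_nat_eq_top)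
  have "(\<integral>\<^sup>+x\<in>cyl (w @ [a]). h x \<partial>\<mu>) = (\<integral>\<^sup>+x. (SUP N. g N x * indicator (cyl (w @ [a])) x) \<partial>\<mu>)"
    by (simp add: hg SUP_mult_right_ennreal)
  also have "\<dots> = (SUP N. \<integral>\<^sup>+x\<in>cyl (w @ [a]). g N x \<partial>\<mu>)"
    using gmono by (intro nn_integral_monotone_convergence_SUP)
      (auto simp: incseq_def le_fun_def intro!: mult_right_mono)
  also have "\<dots> = (SUP N. \<integral>\<^sup>+x\<in>cyl w. g N x * lim_freq a x \<partial>\<mu>)"
  proof (intro SUP_cong refl)
    fix N show "(\<integral>\<^sup>+x\<in>cyl (w @ [a]). g N x \<partial>\<mu>) = (\<integral>\<^sup>+x\<in>cyl w. g N x * lim_freq a x \<partial>\<mu>)"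
      by (rule lim_freq_step_bounded[OF w g, where N = N]) (simp add: g_def)
  qed
  also have "\<dots> = (\<integral>\<^sup>+x. (SUP N. g N x * lim_freq a x * indicator (cyl w) x) \<partial>\<mu>)"
    using gmono by (intro nn_integral_monotone_convergence_SUP[symmetric])
      (auto simp: incseq_def le_fun_def intro!: mult_right_mono)
  also have "\<dots> = (\<integral>\<^sup>+x\<in>cyl w. h x * lim_freq a x \<partial>\<mu>)"
    by (simp add: hg SUP_mult_right_ennreal)
  finally show ?thesis .
qed

text \<open>
  De Finetti's theorem on a good cylinder: behind the word \<open>w\<close>, and given the exchangeable events, the
  coordinates are independent and distributed according to the limit frequencies.
\<close>

theorem product_formula:
  assumes "w \<in> good_words" "v \<in> lists \<alpha>" "exch h"
  shows "(\<integral>\<^sup>+x\<in>cyl (w @ v). h x \<partial>\<mu>) = (\<integral>\<^sup>+x\<in>cyl w. h x * word_freq v x \<partial>\<mu>)"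
  using assms
proof (induction v arbitrary: w)
  case (Cons a v)
  have wa: "w @ [a] \<in> good_words" using Cons.prems by (intro good_append) auto
  have "(\<integral>\<^sup>+x\<in>cyl (w @ a # v). h x \<partial>\<mu>) = (\<integral>\<^sup>+x\<in>cyl (w @ [a]). h x * word_freq v x \<partial>\<mu>)"
    using Cons.IH[OF wa] Cons.prems by simp
  also have "\<dots> = (\<integral>\<^sup>+x\<in>cyl w. h x * word_freq v x * lim_freq a x \<partial>\<mu>)"
    by (rule lim_freq_step[OF Cons.prems(1)]) (intro exch_mult Cons.prems word_freq_exch)
  finally show ?case by (simp add: ac_simps)
qed simp

text \<open>The word \<open>w @ v\<close> is a rearrangement of \<open>v @ w\<close>. This relates the measure on any two good cylinders.\<close>

lemma word_freq_swap:
  assumes w: "w \<in> good_words" and v: "v \<in> good_words" and h: "exch h"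
  shows "(\<integral>\<^sup>+x\<in>cyl w. h x * word_freq v x \<partial>\<mu>) = (\<integral>\<^sup>+x\<in>cyl v. h x * word_freq w x \<partial>\<mu>)"
proof -
  have "(\<integral>\<^sup>+x\<in>cyl (w @ v). h x \<partial>\<mu>) = (\<integral>\<^sup>+x\<in>cyl (v @ w). h x \<partial>\<mu>)"
    by (rule nn_integral_cyl_mset[OF h]) simp
  then show ?thesis
    using product_formula[OF w _ h, of v] product_formula[OF v _ h, of w] w v
    by (simp add: good_words_def)
qed

lemma exch_const: "exch (\<lambda>_. c)"
  by (auto simp: exchangeable_fun_def)

text \<open>
  No mass is lost in the limit: the sum is at most 1 by Fatou's lemma, and its integral over the
  cylinder is the full measure because the next letter is some letter.
\<close>

lemma sum_lim_freq:
  assumes w: "w \<in> good_words"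
  shows "AE x in \<mu>. x \<in> cyl w \<longrightarrow> (\<integral>\<^sup>+a. lim_freq a x \<partial>count_space \<alpha>) = 1"
proof (rule AE_eq_1_if_nn_integral)
  let ?k = "length w"
  have wl: "w \<in> lists \<alpha>" using w by (simp add: good_words_def)
  show "emeasure \<mu> (cyl w) < \<infinity>" using w by (simp add: good_words_def)
  show "(\<lambda>x. \<integral>\<^sup>+a. lim_freq a x \<partial>count_space \<alpha>) \<in> borel_measurable \<mu>"
    unfolding borel_mu by (rule borel_measurable_nn_integral_count_space[OF countable_letters]) simp
  have one: "(\<integral>\<^sup>+a. ennreal (freq ?k a n x) \<partial>count_space \<alpha>) = 1" if n: "n > 0" and x: "x \<in> space M" for n x
  proof -
    have ind: "(\<integral>\<^sup>+a. indicator {a} (coding T \<alpha> x i) \<partial>count_space \<alpha>) = 1" for i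
    proof -
      have "(\<integral>\<^sup>+a. indicator {a} (coding T \<alpha> x i) \<partial>count_space \<alpha>) =
          (\<integral>\<^sup>+a. indicator {coding T \<alpha> x i} a \<partial>count_space \<alpha>)"
        by (intro nn_integral_cong) (auto simp: indicator_def)
      also have "\<dots> = 1" using letter[OF x] by (subst nn_integral_indicator) auto
      finally show ?thesis .
    qed
    have "(\<integral>\<^sup>+a. ennreal (freq ?k a n x) \<partial>count_space \<alpha>) = ennreal (1 / n) * (\<Sum>i<n. 1)"
      unfolding ennreal_freq[OF n] by (simp add: nn_integral_cmult nn_integral_sum ind)
    also have "\<dots> = 1"
      using n by (simp add: ennreal_of_nat_eq_real_of_nat ennreal_mult[symmetric])
    finally show ?thesis .
  qed
  have "AE x in \<mu>. \<forall>a\<in>\<alpha>. x \<in> cyl w \<longrightarrow> (\<lambda>j. ennreal (freq ?k a (4 ^ j) x)) \<longlonglongrightarrow> lim_freq a x"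
    using lim_freq_converges[OF w] by (intro AE_ball_countable' countable_letters) auto
  then show "AE x in \<mu>. x \<in> cyl w \<longrightarrow> (\<integral>\<^sup>+a. lim_freq a x \<partial>count_space \<alpha>) \<le> 1"
  proof eventually_elim
    case (elim x)
    show ?case
    proof
      assume x: "x \<in> cyl w"
      then have xM: "x \<in> space M" using cyl_subset_space by auto
      have "(\<integral>\<^sup>+a. lim_freq a x \<partial>count_space \<alpha>) =
          (\<integral>\<^sup>+a. liminf (\<lambda>j. ennreal (freq ?k a (4 ^ j) x)) \<partial>count_space \<alpha>)"
        using elim x by (intro nn_integral_cong lim_imp_Liminf[symmetric]) auto
      also have "\<dots> \<le> liminf (\<lambda>j. (\<integral>\<^sup>+a. ennreal (freq ?k a (4 ^ j) x) \<partial>count_space \<alpha>))"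
        by (rule nn_integral_liminf) simp
      also have "\<dots> = 1" using one[OF _ xM] by (simp add: Liminf_const)
      finally show "(\<integral>\<^sup>+a. lim_freq a x \<partial>count_space \<alpha>) \<le> 1" .
    qed
  qed
  have split: "indicator (cyl w) x = (\<integral>\<^sup>+a. indicator (cyl (w @ [a])) x \<partial>count_space \<alpha>)"
    if x: "x \<in> space M" for x :: 'a
  proof -
    have "(\<integral>\<^sup>+a. indicator (cyl (w @ [a])) x \<partial>count_space \<alpha>) =
        (\<integral>\<^sup>+a. indicator (cyl w) x * indicator {coding T \<alpha> x ?k} a \<partial>count_space \<alpha>)"
      by (intro nn_integral_cong) (auto simp: cyl_snoc indicator_def)
    also have "\<dots> = indicator (cyl w) x"
      using letter[OF x] by (subst nn_integral_cmult_indicator) auto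
    finally show ?thesis by simp
  qed
  have "(\<integral>\<^sup>+x\<in>cyl w. (\<integral>\<^sup>+a. lim_freq a x \<partial>count_space \<alpha>) \<partial>\<mu>) =
      (\<integral>\<^sup>+x. (\<integral>\<^sup>+a. lim_freq a x * indicator (cyl w) x \<partial>count_space \<alpha>) \<partial>\<mu>)"
    by (intro nn_integral_cong) (simp add: nn_integral_multc)
  also have "\<dots> = (\<integral>\<^sup>+a. (\<integral>\<^sup>+x\<in>cyl w. lim_freq a x \<partial>\<mu>) \<partial>count_space \<alpha>)"
    by (rule nn_integral_count_space_nn_integral[OF countable_letters]) simp
  also have "\<dots> = (\<integral>\<^sup>+a. (\<integral>\<^sup>+x. indicator (cyl (w @ [a])) x \<partial>\<mu>) \<partial>count_space \<alpha>)"
    by (rule nn_integral_cong) (use lim_freq_step[OF w exch_const[of 1]] in simp)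
  also have "\<dots> = (\<integral>\<^sup>+x. (\<integral>\<^sup>+a. indicator (cyl (w @ [a])) x \<partial>count_space \<alpha>) \<partial>\<mu>)"
    by (rule nn_integral_count_space_nn_integral[OF countable_letters, symmetric]) simp
  also have "\<dots> = (\<integral>\<^sup>+x. indicator (cyl w) x \<partial>\<mu>)"
    using split by (intro nn_integral_cong) (simp add: space_mu)
  also have "\<dots> = emeasure \<mu> (cyl w)" by simp
  finally show "(\<integral>\<^sup>+x\<in>cyl w. (\<integral>\<^sup>+a. lim_freq a x \<partial>count_space \<alpha>) \<partial>\<mu>) = emeasure \<mu> (cyl w)" .
qed simp

section \<open>Recurrence\<close>

lemma recurrent_letters:
  assumes rec: "recurrent_measure T \<alpha> \<mu>"
  shows "AE x in \<mu>. \<forall>i. infinite {n. coding T \<alpha> x n = coding T \<alpha> x i}"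
proof -
  have "AE x in \<mu>. \<forall>a\<in>\<alpha>. visits T a x \<in> {0, \<infinity>}"
    using rec unfolding recurrent_measure_def by (intro AE_ball_countable' countable_letters) auto
  moreover have "AE x in \<mu>. x \<in> space M" by (rule AE_I2) (simp add: space_mu)
  ultimately show ?thesis
  proof eventually_elim
    case (elim x)
    show ?case
    proof
      fix i
      let ?a = "coding T \<alpha> x i"
      have a: "?a \<in> \<alpha>" using letter elim by blast
      have "indicator ?a ((T ^^ i) x) \<le> visits T ?a x"
        unfolding visits_def using sum_le_suminf[OF summableI, of "{i}" "\<lambda>n. indicator ?a ((T ^^ n) x) :: ennreal"]
        by simp
      then have "visits T ?a x \<noteq> 0" using coding_in[of x i] elim by (auto simp: indicator_def)
      then have "visits T ?a x = \<infinity>" using elim a by auto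
      then show "infinite {n. coding T \<alpha> x n = ?a}"
        using visits_eq[of x ?a] elim a by (auto simp: emeasure_count_space split: if_splits)
    qed
  qed
qed

text \<open>
  Almost surely, a letter of limit frequency zero does not occur behind a good word; by recurrence it
  then is no letter of the word either.
\<close>

lemma word_freq_pos:
  assumes rec: "recurrent_measure T \<alpha> \<mu>" and w: "w \<in> good_words"
  shows "AE x in \<mu>. x \<in> cyl w \<longrightarrow> 0 < word_freq w x"
proof -
  let ?k = "length w"
  have "AE x in \<mu>. \<forall>a\<in>\<alpha>. \<forall>r. \<not> (x \<in> cyl w \<and> lim_freq a x = 0 \<and> coding T \<alpha> x (?k + r) = a)"
  proof (intro AE_ball_countable' countable_letters, subst AE_all_countable, rule allI)
    fix a r
    define h :: "'a \<Rightarrow> ennreal" where "h x = (if lim_freq a x = 0 then 1 else 0)" for x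
    have h: "exch h" using lim_freq_exch[of a] unfolding h_def[abs_def] exchangeable_fun_def by simp
    then have hm[measurable]: "h \<in> borel_measurable M" by blast
    have "(\<integral>\<^sup>+x\<in>cyl w. h x * indicator {a} (coding T \<alpha> x (?k + r)) \<partial>\<mu>) =
        (\<integral>\<^sup>+x\<in>cyl w. h x * indicator {a} (coding T \<alpha> x ?k) \<partial>\<mu>)"
      by (rule nn_integral_coordinate_exch[OF h]) auto
    also have "\<dots> = (\<integral>\<^sup>+x\<in>cyl (w @ [a]). h x \<partial>\<mu>)"
      by (rule nn_integral_cong) (auto simp: cyl_snoc indicator_def)
    also have "\<dots> = (\<integral>\<^sup>+x\<in>cyl w. h x * lim_freq a x \<partial>\<mu>)" by (rule lim_freq_step[OF w h])
    also have "\<dots> = (\<integral>\<^sup>+x. 0 \<partial>\<mu>)" by (rule nn_integral_cong) (auto simp: h_def)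
    finally have "(\<integral>\<^sup>+x\<in>cyl w. h x * indicator {a} (coding T \<alpha> x (?k + r)) \<partial>\<mu>) = 0" by simp
    moreover have "(\<lambda>x. h x * indicator {a} (coding T \<alpha> x (?k + r)) * indicator (cyl w) x) \<in> borel_measurable \<mu>"
      unfolding indicator_coding by simp
    ultimately have "AE x in \<mu>. h x * indicator {a} (coding T \<alpha> x (?k + r)) * indicator (cyl w) x = 0"
      using nn_integral_0_iff_AE by blast
    then show "AE x in \<mu>. \<not> (x \<in> cyl w \<and> lim_freq a x = 0 \<and> coding T \<alpha> x (?k + r) = a)"
      by eventually_elim (auto simp: h_def indicator_def split: if_splits)
  qed
  with recurrent_letters[OF rec] show ?thesis
  proof eventually_elim
    case (elim x)
    show ?case
    proof
      assume x: "x \<in> cyl w"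
      have "lim_freq a x \<noteq> 0" if aw: "a \<in> set w" for a
      proof
        assume z: "lim_freq a x = 0"
        obtain i where i: "i < ?k" "a = w ! i" using aw by (auto simp: in_set_conv_nth)
        then have "a = coding T \<alpha> x i" using x by (simp add: cyl_def)
        then have "infinite {n. coding T \<alpha> x n = a}" using elim by simp
        then obtain n where n: "n \<ge> ?k" "coding T \<alpha> x n = a"
          unfolding infinite_nat_iff_unbounded_le by blast
        then have "coding T \<alpha> x (?k + (n - ?k)) = a" by simp
        moreover have "a \<in> \<alpha>" using aw w by (auto simp: good_words_def)
        ultimately show False using elim(2) x z by blast
      qed
      then have "word_freq w x \<noteq> 0" by (auto simp: word_freq_def prod_list_zero_iff)
      then show "0 < word_freq w x" by (simp only: zero_less_iff_neq_zero not_False_eq_True)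
    qed
  qed
qed

end

context exchangeable_measure
begin

section \<open>The mixing measure\<close>

text \<open>
  The word \<open>v\<close> is the first good word, in a fixed enumeration, that has positive probability under the
  product measure of \<open>x\<close>.
\<close>

definition first_charged :: "'a set list \<Rightarrow> 'a \<Rightarrow> bool" where
  "first_charged v x \<longleftrightarrow> word_freq v x \<noteq> 0 \<and>
     (\<forall>u\<in>good_words. to_nat_on good_words u < to_nat_on good_words v \<longrightarrow> word_freq u x = 0)"

text \<open>
  The density of the mixing measure with respect to the given measure. Each product measure is
  accounted for on the cylinder of its first charged word only, and there it is divided by the
  probability of this word, so that its total mass is right.
\<close>

definition weight :: "'a \<Rightarrow> ennreal" where
  "weight x = (\<integral>\<^sup>+v. of_bool (first_charged v x) / word_freq v x * indicator (cyl v) x \<partial>count_space good_words)"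

lemma word_freq_related:
  "(x, y) \<in> exchangeable_relation M T \<alpha> \<Longrightarrow> word_freq w x = word_freq w y"
  using word_freq_exch[of w] unfolding exchangeable_fun_def by blast

lemma first_charged_pred[measurable]: "Measurable.pred M (first_charged v)"
proof -
  have "{x\<in>space M. first_charged v x} = {x\<in>space M. word_freq v x \<noteq> 0} -
     (\<Union>u\<in>{u\<in>good_words. to_nat_on good_words u < to_nat_on good_words v}. {x\<in>space M. word_freq u x \<noteq> 0})"
    by (auto simp: first_charged_def)
  also have "\<dots> \<in> sets M"
    using countable_good_words
    by (intro sets.Diff sets.countable_UN') (auto intro: countable_subset)
  finally show ?thesis by (simp add: pred_def)
qed

lemma weight_measurable[measurable]: "weight \<in> borel_measurable M"
  unfolding weight_def
  by (rule borel_measurable_nn_integral_count_space[OF countable_good_words]) simp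

lemma first_charged_exch: "exch (\<lambda>x. of_bool (first_charged v x) / word_freq v x)"
proof -
  have fc: "first_charged v x = first_charged v y" if "(x, y) \<in> exchangeable_relation M T \<alpha>" for x y
    using word_freq_related[OF that] by (simp add: first_charged_def)
  then have "exchangeable_fun (exchangeable_relation M T \<alpha>) (\<lambda>x. of_bool (first_charged v x) / word_freq v x)"
    unfolding exchangeable_fun_def
  proof (intro allI impI)
    fix x y assume R: "(x, y) \<in> exchangeable_relation M T \<alpha>"
    show "of_bool (first_charged v x) / word_freq v x = of_bool (first_charged v y) / word_freq v y"
      unfolding fc[OF R] word_freq_related[OF R, of v] ..
  qed
  then show ?thesis by simp
qed

lemma sum_first_charged:
  assumes "w \<in> good_words" "word_freq w x \<noteq> 0"
  shows "(\<integral>\<^sup>+v. of_bool (first_charged v x) \<partial>count_space good_words) = 1"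
proof -
  define n where "n = (LEAST n. \<exists>u\<in>good_words. to_nat_on good_words u = n \<and> word_freq u x \<noteq> 0)"
  have "\<exists>u\<in>good_words. to_nat_on good_words u = n \<and> word_freq u x \<noteq> 0"
    unfolding n_def by (rule LeastI_ex) (use assms in blast)
  then obtain v where v: "v \<in> good_words" "to_nat_on good_words v = n" "word_freq v x \<noteq> 0" by blast
  have min: "word_freq u x = 0" if "u \<in> good_words" "to_nat_on good_words u < n" for u
    using not_less_Least[OF that(2)[unfolded n_def]] that by blast
  have "first_charged u x \<longleftrightarrow> u = v" if u: "u \<in> good_words" for u
  proof
    assume fc: "first_charged u x"
    have "\<not> to_nat_on good_words u < n" using fc min[OF u] by (auto simp: first_charged_def)
    moreover have "\<not> n < to_nat_on good_words u" using fc v by (auto simp: first_charged_def)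
    ultimately have "to_nat_on good_words u = to_nat_on good_words v" using v by simp
    then show "u = v" using u v(1) countable_good_words by simp
  qed (use v min in \<open>auto simp: first_charged_def\<close>)
  then have "(\<integral>\<^sup>+v. of_bool (first_charged v x) \<partial>count_space good_words) =
      (\<integral>\<^sup>+u. indicator {v} u \<partial>count_space good_words)"
    by (intro nn_integral_cong) (auto simp: indicator_def)
  also have "\<dots> = 1" using v by (subst nn_integral_indicator) auto
  finally show ?thesis .
qed

lemma weight_integral:
  assumes h[measurable]: "h \<in> borel_measurable M"
  shows "(\<integral>\<^sup>+x. weight x * h x \<partial>\<mu>) = (\<integral>\<^sup>+v. (\<integral>\<^sup>+x\<in>cyl v.
    of_bool (first_charged v x) / word_freq v x * h x \<partial>\<mu>) \<partial>count_space good_words)"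
proof -
  have "(\<integral>\<^sup>+x. weight x * h x \<partial>\<mu>) = (\<integral>\<^sup>+x. (\<integral>\<^sup>+v.
      of_bool (first_charged v x) / word_freq v x * h x * indicator (cyl v) x \<partial>count_space good_words) \<partial>\<mu>)"
    unfolding weight_def
    by (intro nn_integral_cong, subst nn_integral_multc[symmetric], simp)
      (intro nn_integral_cong, simp only: mult_ac)
  also have "\<dots> = (\<integral>\<^sup>+v. (\<integral>\<^sup>+x\<in>cyl v.
    of_bool (first_charged v x) / word_freq v x * h x \<partial>\<mu>) \<partial>count_space good_words)"
    by (rule nn_integral_count_space_nn_integral[OF countable_good_words]) simp
  finally show ?thesis .
qed

lemma weight_word_freq:
  assumes rec: "recurrent_measure T \<alpha> \<mu>" and d: "d \<in> good_words"
  shows "(\<integral>\<^sup>+x. weight x * word_freq d x \<partial>\<mu>) = emeasure \<mu> (cyl d)"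
proof -
  have "(\<integral>\<^sup>+x. weight x * word_freq d x \<partial>\<mu>) = (\<integral>\<^sup>+v. (\<integral>\<^sup>+x\<in>cyl v.
    of_bool (first_charged v x) / word_freq v x * word_freq d x \<partial>\<mu>) \<partial>count_space good_words)"
    by (rule weight_integral) simp
  also have "\<dots> = (\<integral>\<^sup>+v. (\<integral>\<^sup>+x\<in>cyl d. of_bool (first_charged v x) \<partial>\<mu>) \<partial>count_space good_words)"
  proof (rule nn_integral_cong)
    fix v assume "v \<in> space (count_space good_words)"
    then have v: "v \<in> good_words" by simp
    have "(\<integral>\<^sup>+x\<in>cyl v. of_bool (first_charged v x) / word_freq v x * word_freq d x \<partial>\<mu>) =
        (\<integral>\<^sup>+x\<in>cyl d. of_bool (first_charged v x) / word_freq v x * word_freq v x \<partial>\<mu>)"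
      by (rule word_freq_swap[OF v d first_charged_exch])
    also have "\<dots> = (\<integral>\<^sup>+x\<in>cyl d. of_bool (first_charged v x) \<partial>\<mu>)"
    proof (rule nn_integral_cong)
      fix x
      have "word_freq v x < \<infinity>" using word_freq_le_1[of v x] by (rule le_less_trans) simp
      then have "of_bool (first_charged v x) / word_freq v x * word_freq v x = (of_bool (first_charged v x) :: ennreal)"
        by (cases "first_charged v x")
          (auto simp: first_charged_def ennreal_divide_times ennreal_divide_self less_top)
      then show "of_bool (first_charged v x) / word_freq v x * word_freq v x * indicator (cyl d) x =
          of_bool (first_charged v x) * indicator (cyl d) x" by simp
    qed
    finally show "(\<integral>\<^sup>+x\<in>cyl v. of_bool (first_charged v x) / word_freq v x * word_freq d x \<partial>\<mu>) =
      (\<integral>\<^sup>+x\<in>cyl d. of_bool (first_charged v x) \<partial>\<mu>)" .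
  qed
  also have "\<dots> = (\<integral>\<^sup>+x. (\<integral>\<^sup>+v. of_bool (first_charged v x) * indicator (cyl d) x \<partial>count_space good_words) \<partial>\<mu>)"
    by (rule nn_integral_count_space_nn_integral[OF countable_good_words, symmetric]) simp
  also have "\<dots> = (\<integral>\<^sup>+x. indicator (cyl d) x \<partial>\<mu>)"
  proof (rule nn_integral_cong_AE)
    show "AE x in \<mu>. (\<integral>\<^sup>+v. of_bool (first_charged v x) * indicator (cyl d) x \<partial>count_space good_words) =
        indicator (cyl d) x"
      using word_freq_pos[OF rec d]
    proof eventually_elim
      case (elim x)
      then show ?case using sum_first_charged[OF d, of x]
        by (cases "x \<in> cyl d") (auto simp: nn_integral_multc)
    qed
  qed
  also have "\<dots> = emeasure \<mu> (cyl d)" by simp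
  finally show ?thesis .
qed

lemma weight_finite:
  assumes rec: "recurrent_measure T \<alpha> \<mu>" and good: "AE x in \<mu>. \<exists>w\<in>good_words. x \<in> cyl w"
  shows "AE x in \<mu>. weight x \<noteq> \<infinity>"
proof -
  have "AE x in \<mu>. \<forall>d\<in>good_words. (x \<in> cyl d \<longrightarrow> 0 < word_freq d x) \<and> weight x * word_freq d x \<noteq> \<infinity>"
  proof (intro AE_ball_countable' countable_good_words AE_conjI word_freq_pos[OF rec])
    fix d assume d: "d \<in> good_words"
    show "AE x in \<mu>. weight x * word_freq d x \<noteq> \<infinity>"
      using weight_word_freq[OF rec d] d by (intro nn_integral_PInf_AE) (auto simp: good_words_def)
  qed
  with good show ?thesis
  proof eventually_elim
    case (elim x)
    then obtain d where "d \<in> good_words" "0 < word_freq d x" "weight x * word_freq d x \<noteq> \<infinity>" by blast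
    then show ?case by (auto simp: ennreal_mult_eq_top_iff ennreal_top_mult)
  qed
qed

section \<open>Product measures on the space\<close>

text \<open>The product measure on sequences with the frequencies of \<open>x\<close> as one-coordinate law.\<close>

definition sequence_law :: "'a \<Rightarrow> (nat \<Rightarrow> 'a set) measure" where
  "sequence_law x = PiM UNIV (\<lambda>_. density (count_space \<alpha>) (\<lambda>a. lim_freq a x))"

interpretation Seq: coordinates "PiM UNIV (\<lambda>_::nat. count_space \<alpha>)" "\<lambda>s. s" \<alpha>
  by (rule coordinates_PiM[OF countable_letters])

lemma sets_sequence_law: "sets (sequence_law x) = sets (PiM UNIV (\<lambda>_. count_space \<alpha>))"
  unfolding sequence_law_def by (intro sets_PiM_cong) auto

lemma sequence_law:
  assumes x: "(\<integral>\<^sup>+a. lim_freq a x \<partial>count_space \<alpha>) = 1"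
  shows prob_space_sequence_law: "prob_space (sequence_law x)"
    and emeasure_sequence_law: "w \<in> lists \<alpha> \<Longrightarrow> emeasure (sequence_law x) (Seq.cyl w) = word_freq w x"
proof -
  let ?D = "density (count_space \<alpha>) (\<lambda>a. lim_freq a x)"
  have "prob_space ?D"
  proof
    have "emeasure ?D (space ?D) = (\<integral>\<^sup>+a\<in>\<alpha>. lim_freq a x \<partial>count_space \<alpha>)"
      by (subst emeasure_density) auto
    also have "\<dots> = (\<integral>\<^sup>+a. lim_freq a x \<partial>count_space \<alpha>)"
      by (rule nn_integral_cong) simp
    finally show "emeasure ?D (space ?D) = 1" using x by simp
  qed
  then interpret D: prob_space ?D .
  interpret P: product_prob_space "\<lambda>_::nat. ?D" UNIV by unfold_locales
  show "prob_space (sequence_law x)" unfolding sequence_law_def by (rule P.prob_space_axioms)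
  assume w: "w \<in> lists \<alpha>"
  have sp: "space (sequence_law x) = space (PiM UNIV (\<lambda>_. count_space \<alpha>))"
    by (rule sets_eq_imp_space_eq[OF sets_sequence_law])
  have single: "emeasure ?D {a} = lim_freq a x" if "a \<in> \<alpha>" for a
    using that by (subst emeasure_density) (simp_all add: nn_integral_indicator_singleton)
  have "Seq.cyl w = {s\<in>space (sequence_law x). \<forall>j\<in>{..<length w}. s j \<in> {w ! j}}"
    unfolding Seq.cyl_def sp by auto
  then have "emeasure (sequence_law x) (Seq.cyl w) = (\<Prod>j<length w. emeasure ?D {w ! j})"
    unfolding sequence_law_def using w
    by (simp only:) (rule P.emeasure_PiM_Collect; auto)
  also have "\<dots> = (\<Prod>j<length w. lim_freq (w ! j) x)"
    using w by (intro prod.cong) (auto intro!: single)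
  also have "\<dots> = word_freq w x"
    unfolding word_freq_def by (simp add: prod.list_conv_set_nth atLeast0LessThan)
  finally show "emeasure (sequence_law x) (Seq.cyl w) = word_freq w x" .
qed

end

lemma measure_eqI_countable_cover:
  assumes sets: "sets Q = sets P" and D: "\<And>n::nat. D n \<in> sets P"
    and eq: "\<And>n B. B \<in> sets P \<Longrightarrow> B \<subseteq> D n \<Longrightarrow> emeasure P B = emeasure Q B"
    and null: "emeasure P (space P - (\<Union>n. D n)) = 0" "emeasure Q (space P - (\<Union>n. D n)) = 0"
  shows "P = Q"
proof (rule measure_eqI)
  fix B assume B: "B \<in> sets P"
  have dm: "disjointed D n \<in> sets P" for n
    using sets.range_disjointed_sets[of D P] D by auto
  have dec: "emeasure R B = (\<Sum>n. emeasure R (B \<inter> disjointed D n))"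
    if R: "sets R = sets P" "emeasure R (space P - (\<Union>n. D n)) = 0" for R
  proof -
    have N: "space P - (\<Union>n. D n) \<in> null_sets R" using R D by auto
    have "B - (\<Union>n. D n) \<in> null_sets R"
      by (rule null_sets_subset[OF N]) (use B D R sets.sets_into_space[OF B] in auto)
    then have "emeasure R B = emeasure R (B - (B - (\<Union>n. D n)))"
      using B R by (intro emeasure_Diff_null_set[symmetric]) auto
    also have "B - (B - (\<Union>n. D n)) = (\<Union>n. B \<inter> disjointed D n)"
      using UN_disjointed_eq[of D] by auto
    also have "emeasure R \<dots> = (\<Sum>n. emeasure R (B \<inter> disjointed D n))"
    proof (rule suminf_emeasure[symmetric])
      show "disjoint_family (\<lambda>n. B \<inter> disjointed D n)"
        using disjoint_family_disjointed[of D] unfolding disjoint_family_on_def by fast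
    qed (use B dm R in auto)
    finally show ?thesis .
  qed
  have "emeasure P (B \<inter> disjointed D n) = emeasure Q (B \<inter> disjointed D n)" for n
    using B dm disjointed_subset[of D n] by (intro eq[where n = n]) auto
  then show "emeasure P B = emeasure Q B"
    using dec[of P] dec[of Q] sets null by simp
qed (use sets in simp)

context exchangeable_measure
begin

interpretation Seq: coordinates "PiM UNIV (\<lambda>_::nat. count_space \<alpha>)" "\<lambda>s. s" \<alpha>
  by (rule coordinates_PiM[OF countable_letters])

text \<open>
  The law of the tail behind a good word \<open>w\<close> is the mixture of any probability measures \<open>\<kappa> x\<close> that give
  words the probabilities \<open>word_freq v x\<close>. It is applied to sequences and to points of the space.
\<close>

lemma kernel_on_cylinder:
  assumes w: "w \<in> good_words" and N: "coordinates N f \<alpha>"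
    and \<phi>: "\<phi> \<in> measurable M N" "\<And>x j. x \<in> space M \<Longrightarrow> f (\<phi> x) j = coding T \<alpha> x (length w + j)"
    and G: "G \<in> sets M" "AE x in \<mu>. x \<in> cyl w \<longrightarrow> x \<in> G"
    and \<kappa>: "\<And>x. x \<in> G \<Longrightarrow> prob_space (\<kappa> x)" "\<And>x. x \<in> G \<Longrightarrow> sets (\<kappa> x) = sets N"
      "\<And>x v. x \<in> G \<Longrightarrow> v \<in> lists \<alpha> \<Longrightarrow> emeasure (\<kappa> x) (coordinates.cyl N f v) = word_freq v x"
    and B: "B \<in> sets N"
  shows "emeasure \<mu> (\<phi> -` B \<inter> (G \<inter> cyl w)) = (\<integral>\<^sup>+x\<in>G \<inter> cyl w. emeasure (\<kappa> x) B \<partial>\<mu>)"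
proof -
  interpret N: coordinates N f \<alpha> by (rule N)
  let ?R = "restrict_space \<mu> (G \<inter> cyl w)"
  have Gw: "G \<inter> cyl w \<in> sets \<mu>" using G sets_mu by auto
  have Gs: "(G \<inter> cyl w) \<inter> space \<mu> \<in> sets \<mu>" using Gw by auto
  have sub: "G \<inter> cyl w \<subseteq> space M" using cyl_subset_space by auto
  have spR: "space ?R = G \<inter> cyl w" using sub by (auto simp: space_restrict_space space_mu)
  have eR: "emeasure ?R C = emeasure \<mu> C" if "C \<subseteq> G \<inter> cyl w" for C
    by (rule emeasure_restrict_space[OF Gs that])
  have "emeasure ?R (\<phi> -` B \<inter> space ?R) = (\<integral>\<^sup>+x. emeasure (\<kappa> x) B \<partial>?R)"
  proof (rule N.kernel_disintegration[OF _ _ _ _ B])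
    have "emeasure \<mu> (G \<inter> cyl w) \<le> emeasure \<mu> (cyl w)" by (rule emeasure_mono) auto
    then show "emeasure ?R (space ?R) \<noteq> \<infinity>"
      using w eR[of "G \<inter> cyl w"] by (auto simp: spR good_words_def top_unique)
    show "\<phi> \<in> measurable ?R N" using \<phi>(1) by (intro measurable_restrict_space1) simp
    show "\<kappa> \<in> measurable ?R (prob_algebra N)"
    proof (rule N.kernel_measurable)
      fix v assume "v \<in> lists \<alpha>"
      then have "emeasure (\<kappa> x) (N.cyl v) = word_freq v x" if "x \<in> space ?R" for x
        using \<kappa>(3)[of x v] that spR by auto
      moreover have "word_freq v \<in> borel_measurable ?R" by (intro measurable_restrict_space1) simp
      ultimately show "(\<lambda>x. emeasure (\<kappa> x) (N.cyl v)) \<in> borel_measurable ?R"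
        by (simp cong: measurable_cong)
    qed (use \<kappa> spR in auto)
    fix v assume v: "v \<in> lists \<alpha>"
    have eq: "\<phi> -` N.cyl v \<inter> space ?R = G \<inter> cyl (w @ v)"
      using \<phi> sub measurable_space[OF \<phi>(1)] by (auto simp: spR cyl_append N.cyl_def) 
    have "emeasure ?R (\<phi> -` N.cyl v \<inter> space ?R) = emeasure \<mu> (G \<inter> cyl (w @ v))"
      unfolding eq by (rule eR) (auto simp: cyl_append)
    also have "\<dots> = emeasure \<mu> (cyl (w @ v))"
    proof (rule emeasure_eq_AE)
      show "AE x in \<mu>. (x \<in> G \<inter> cyl (w @ v)) = (x \<in> cyl (w @ v))"
        using G(2) by eventually_elim (auto simp: cyl_append)
    qed (use G sets_mu in auto)
    also have "\<dots> = (\<integral>\<^sup>+x\<in>cyl w. word_freq v x \<partial>\<mu>)"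
      using product_formula[OF w v exch_const[of 1]] by simp
    also have "\<dots> = (\<integral>\<^sup>+x\<in>G \<inter> cyl w. emeasure (\<kappa> x) (N.cyl v) \<partial>\<mu>)"
    proof (rule nn_integral_cong_AE)
      show "AE x in \<mu>. word_freq v x * indicator (cyl w) x =
          emeasure (\<kappa> x) (N.cyl v) * indicator (G \<inter> cyl w) x"
        using G(2) by eventually_elim (use \<kappa>(3) v in \<open>auto simp: indicator_def\<close>)
    qed
    also have "\<dots> = (\<integral>\<^sup>+x. emeasure (\<kappa> x) (N.cyl v) \<partial>?R)"
      by (rule nn_integral_restrict_space[OF Gs, symmetric])
    finally show "emeasure ?R (\<phi> -` N.cyl v \<inter> space ?R) = (\<integral>\<^sup>+x. emeasure (\<kappa> x) (N.cyl v) \<partial>?R)" .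
  qed
  then show ?thesis
    unfolding nn_integral_restrict_space[OF Gs] spR by (subst (asm) eR) auto
qed

text \<open>A measurable set of codes of points that contains almost every tail behind every good word.\<close>

lemma ex_code_set:
  "\<exists>Z\<in>sets (PiM UNIV (\<lambda>_. count_space \<alpha>)). Z \<subseteq> coding T \<alpha> ` space M \<and>
     (\<forall>w\<in>good_words. AE x in \<mu>. x \<in> cyl w \<longrightarrow> coding T \<alpha> ((T ^^ length w) x) \<in> Z)"
proof -
  let ?\<Sigma> = "PiM UNIV (\<lambda>_::nat. count_space \<alpha>)"
  have ex: "\<exists>Z. Z \<in> sets ?\<Sigma> \<and> Z \<subseteq> coding T \<alpha> ` space M \<and>
      (AE x in \<mu>. x \<in> cyl w \<longrightarrow> coding T \<alpha> ((T ^^ length w) x) \<in> Z)" if w: "w \<in> good_words" for w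
  proof -
    let ?Q = "restrict_space \<mu> (cyl w)" and ?F = "T ^^ length w"
    have cylm: "cyl w \<inter> space \<mu> \<in> sets \<mu>" by auto
    have spQ: "space ?Q = cyl w" using cyl_subset_space by (auto simp: space_restrict_space space_mu)
    have F: "?F \<in> measurable ?Q M" by (intro measurable_restrict_space1) simp
    interpret Q: finite_measure ?Q
      using w emeasure_restrict_space[OF cylm, of "cyl w"]
      by (intro finite_measureI) (auto simp: spQ good_words_def)
    obtain Z where Z: "Z \<in> sets ?\<Sigma>" "Z \<subseteq> coding T \<alpha> ` space M"
        "AE y in distr ?Q M ?F. coding T \<alpha> y \<in> Z"
      using standard_sequence_image[OF standard Q.finite_measure_distr[OF F] _ countable_letters coding_measurable_PiM]
      by auto
    have "{y\<in>space M. coding T \<alpha> y \<in> Z} \<in> sets M"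
      using measurable_sets[OF coding_measurable_PiM Z(1)] by (simp add: vimage_def Int_def conj_commute)
    then have "AE x in ?Q. coding T \<alpha> (?F x) \<in> Z"
      using Z(3) by (simp add: AE_distr_iff[OF F])
    then have "AE x in \<mu>. x \<in> cyl w \<longrightarrow> coding T \<alpha> (?F x) \<in> Z"
      by (simp only: AE_restrict_space_iff[OF cylm])
    then show ?thesis using Z(1,2) by (intro exI[of _ Z] conjI)
  qed
  define Z where "Z w = (SOME Z. Z \<in> sets ?\<Sigma> \<and> Z \<subseteq> coding T \<alpha> ` space M \<and>
      (AE x in \<mu>. x \<in> cyl w \<longrightarrow> coding T \<alpha> ((T ^^ length w) x) \<in> Z))" for w
  have Z: "Z w \<in> sets ?\<Sigma>" "Z w \<subseteq> coding T \<alpha> ` space M"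
      "AE x in \<mu>. x \<in> cyl w \<longrightarrow> coding T \<alpha> ((T ^^ length w) x) \<in> Z w" if "w \<in> good_words" for w
    using someI_ex[OF ex[OF that]] unfolding Z_def by blast+
  show ?thesis
  proof (intro bexI[of _ "\<Union>w\<in>good_words. Z w"] conjI ballI)
    show "(\<Union>w\<in>good_words. Z w) \<in> sets ?\<Sigma>"
      by (rule sets.countable_UN'[OF countable_good_words]) (use Z(1) in auto)
    show "(\<Union>w\<in>good_words. Z w) \<subseteq> coding T \<alpha> ` space M" using Z(2) by blast
    fix w assume w: "w \<in> good_words"
    show "AE x in \<mu>. x \<in> cyl w \<longrightarrow> coding T \<alpha> ((T ^^ length w) x) \<in> (\<Union>w\<in>good_words. Z w)"
      using Z(3)[OF w] by eventually_elim (use w in blast)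
  qed
qed

text \<open>A product measure on sequences that is carried by codes of points comes from the space itself.\<close>

lemma product_kernel_at:
  assumes x: "(\<integral>\<^sup>+a. lim_freq a x \<partial>count_space \<alpha>) = 1"
    and Z: "Z \<in> sets (PiM UNIV (\<lambda>_. count_space \<alpha>))" "Z \<subseteq> coding T \<alpha> ` space M"
    and null: "emeasure (sequence_law x) (space (PiM UNIV (\<lambda>_. count_space \<alpha>)) - Z) = 0"
  shows "\<exists>m. prob_space m \<and> sets m = sets M \<and> (\<forall>v\<in>lists \<alpha>. emeasure m (cyl v) = word_freq v x)"
proof -
  let ?\<Sigma> = "PiM UNIV (\<lambda>_::nat. count_space \<alpha>)"
  interpret L: prob_space "sequence_law x" by (rule prob_space_sequence_law[OF x])
  note sL = sets_sequence_law[of x]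
  have spL: "space (sequence_law x) = space ?\<Sigma>" by (rule sets_eq_imp_space_eq[OF sL])
  define dec where "dec = the_inv_into (space M) (coding T \<alpha>)"
  have inj: "inj_on (coding T \<alpha>) (space M)" by (rule inj_onI) (rule coding_inject)
  have dec: "dec s \<in> space M" "coding T \<alpha> (dec s) = s" if "s \<in> Z" for s
    using that Z(2) the_inv_into_into[OF inj, of s "space M"] f_the_inv_into_f[OF inj, of s]
    by (auto simp: dec_def)
  let ?R = "restrict_space (sequence_law x) Z"
  have Zs: "Z \<inter> space (sequence_law x) \<in> sets (sequence_law x)" using Z(1) sL by auto
  have ZL: "Z \<subseteq> space ?\<Sigma>" using Z(1) by (rule sets.sets_into_space)
  have spR: "space ?R = Z" using ZL spL by (auto simp: space_restrict_space)
  have eR: "emeasure ?R (C \<inter> Z) = emeasure (sequence_law x) C" if C: "C \<in> sets ?\<Sigma>" for C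
  proof -
    have N: "space ?\<Sigma> - Z \<in> null_sets (sequence_law x)" using null Z(1) sL by auto
    have "emeasure ?R (C \<inter> Z) = emeasure (sequence_law x) (C \<inter> Z)"
      by (rule emeasure_restrict_space[OF Zs]) auto
    also have "\<dots> = emeasure (sequence_law x) (C - (space ?\<Sigma> - Z))"
      using sets.sets_into_space[OF C] ZL by (intro arg_cong[where f = "emeasure (sequence_law x)"]) auto
    also have "\<dots> = emeasure (sequence_law x) C"
      using C sL by (intro emeasure_Diff_null_set N) auto
    finally show ?thesis .
  qed
  have cylR: "dec -` cyl v \<inter> space ?R = Seq.cyl v \<inter> Z" for v
    using dec ZL by (auto simp: spR cyl_def Seq.cyl_def)
  have decm: "dec \<in> measurable ?R M"
  proof (rule measurable_sigma_sets[OF sets_generated_by_cylinders cylinders_subset_Pow])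
    show "dec \<in> space ?R \<rightarrow> space M" using dec spR by auto
    fix C assume "C \<in> insert {} (cyl ` lists \<alpha>)"
    then consider "C = {}" | v where "C = cyl v" by auto
    then show "dec -` C \<inter> space ?R \<in> sets ?R"
    proof cases
      case 2
      have "Seq.cyl v \<inter> Z \<in> sets (sequence_law x)" using Z(1) sL by auto
      then show ?thesis unfolding 2 cylR using sets_restrict_space_iff[OF Zs] by auto
    qed simp
  qed
  show ?thesis
  proof (intro exI[of _ "distr ?R M dec"] conjI ballI)
    have "prob_space ?R"
      using eR[of "space ?\<Sigma>"] ZL L.emeasure_space_1 spL by (intro prob_spaceI) (simp add: spR Int_absorb1)
    then show "prob_space (distr ?R M dec)" using decm by (rule prob_space.prob_space_distr)
    fix v assume v: "v \<in> lists \<alpha>"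
    show "emeasure (distr ?R M dec) (cyl v) = word_freq v x"
      using decm eR[of "Seq.cyl v"] emeasure_sequence_law[OF x v] by (simp add: emeasure_distr cylR)
  qed simp
qed

text \<open>
  The mixture formula for sequences, applied to the complement of the set of codes from \<open>ex_code_set\<close>,
  shows that almost every product measure is carried by this set.
\<close>

lemma ex_product_kernel:
  assumes good: "AE x in \<mu>. \<exists>w\<in>good_words. x \<in> cyl w"
  shows "\<exists>G\<in>sets M. \<exists>m. (AE x in \<mu>. x \<in> G) \<and> (\<forall>x\<in>G. prob_space (m x) \<and> sets (m x) = sets M \<and>
    (\<forall>v\<in>lists \<alpha>. emeasure (m x) (cyl v) = word_freq v x))"
proof -
  let ?\<Sigma> = "PiM UNIV (\<lambda>_::nat. count_space \<alpha>)"
  obtain Z where Z: "Z \<in> sets ?\<Sigma>" "Z \<subseteq> coding T \<alpha> ` space M"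
     "\<And>w. w \<in> good_words \<Longrightarrow> AE x in \<mu>. x \<in> cyl w \<longrightarrow> coding T \<alpha> ((T ^^ length w) x) \<in> Z"
    using ex_code_set by blast
  define S where "S x \<longleftrightarrow> (\<integral>\<^sup>+a. lim_freq a x \<partial>count_space \<alpha>) = 1" for x
  have null: "AE x in \<mu>. x \<in> cyl w \<longrightarrow> S x \<and> emeasure (sequence_law x) (space ?\<Sigma> - Z) = 0"
    if w: "w \<in> good_words" for w
  proof -
    let ?\<phi> = "\<lambda>x. coding T \<alpha> ((T ^^ length w) x)"
    define G where "G = {x\<in>space M. S x}"
    have "(\<lambda>x. \<integral>\<^sup>+a. lim_freq a x \<partial>count_space \<alpha>) \<in> borel_measurable M"
      by (rule borel_measurable_nn_integral_count_space[OF countable_letters]) simp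
    then have G: "G \<in> sets M" unfolding G_def S_def by measurable
    have Sw: "AE x in \<mu>. x \<in> cyl w \<longrightarrow> S x" using sum_lim_freq[OF w] by (simp add: S_def)
    then have AEG: "AE x in \<mu>. x \<in> cyl w \<longrightarrow> x \<in> G"
      by eventually_elim (use cyl_subset_space in \<open>auto simp: G_def\<close>)
    have \<phi>: "?\<phi> \<in> measurable M ?\<Sigma>"
      by (rule measurable_compose[OF funpow_measurable coding_measurable_PiM])
    let ?B = "space ?\<Sigma> - Z"
    have B: "?B \<in> sets ?\<Sigma>" using Z(1) by auto
    have km: "(\<lambda>x. emeasure (sequence_law x) ?B) \<in> borel_measurable (restrict_space \<mu> G)"
    proof -
      have spG: "space (restrict_space \<mu> G) \<subseteq> G" by (auto simp: space_restrict_space)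
      have "sequence_law \<in> measurable (restrict_space \<mu> G) (prob_algebra ?\<Sigma>)"
      proof (rule Seq.kernel_measurable)
        fix x assume "x \<in> space (restrict_space \<mu> G)"
        then show "prob_space (sequence_law x)" "sets (sequence_law x) = sets ?\<Sigma>"
          using spG prob_space_sequence_law sets_sequence_law by (auto simp: G_def S_def)
      next
        fix v assume v: "v \<in> lists \<alpha>"
        have "emeasure (sequence_law x) (Seq.cyl v) = word_freq v x" if "x \<in> space (restrict_space \<mu> G)" for x
          using emeasure_sequence_law[OF _ v] spG that by (auto simp: G_def S_def)
        moreover have "word_freq v \<in> borel_measurable (restrict_space \<mu> G)"
          by (intro measurable_restrict_space1) simp
        ultimately show "(\<lambda>x. emeasure (sequence_law x) (Seq.cyl v)) \<in> borel_measurable (restrict_space \<mu> G)"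
          by (simp cong: measurable_cong)
      qed
      then show ?thesis using B
        by (intro measurable_emeasure_kernel[OF measurable_prob_algebraD])
    qed
    have m0: "(\<lambda>x. emeasure (sequence_law x) ?B * indicator (G \<inter> cyl w) x) \<in> borel_measurable \<mu>"
    proof -
      have "(\<lambda>x. emeasure (sequence_law x) ?B * indicator G x) \<in> borel_measurable \<mu>"
        using km G sets_mu by (subst (asm) borel_measurable_restrict_space_iff_ennreal) auto
      then have "(\<lambda>x. emeasure (sequence_law x) ?B * indicator G x * indicator (cyl w) x) \<in> borel_measurable \<mu>"
        by (rule borel_measurable_times_ennreal) simp
      then show ?thesis by (simp add: indicator_inter_arith mult.assoc)
    qed
    have "(\<integral>\<^sup>+x\<in>G \<inter> cyl w. emeasure (sequence_law x) ?B \<partial>\<mu>) = emeasure \<mu> (?\<phi> -` ?B \<inter> (G \<inter> cyl w))"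
      by (rule kernel_on_cylinder[OF w Seq.coordinates_axioms \<phi> _ G AEG _ sets_sequence_law _ B, symmetric])
        (auto simp: coding_shift G_def S_def prob_space_sequence_law emeasure_sequence_law)
    also have "\<dots> = 0"
    proof -
      have "?\<phi> -` ?B \<inter> (G \<inter> cyl w) \<in> sets \<mu>"
      proof -
        have "?\<phi> -` ?B \<inter> space M \<in> sets M" using \<phi> B by (rule measurable_sets)
        moreover have "?\<phi> -` ?B \<inter> (G \<inter> cyl w) = (?\<phi> -` ?B \<inter> space M) \<inter> (G \<inter> cyl w)"
          using cyl_subset_space by auto
        moreover have "G \<inter> cyl w \<in> sets M" using G by auto
        ultimately show ?thesis unfolding sets_mu by (metis sets.Int)
      qed
      moreover have "AE x in \<mu>. x \<notin> ?\<phi> -` ?B \<inter> (G \<inter> cyl w)"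
        using Z(3)[OF w] by eventually_elim auto
      ultimately have "?\<phi> -` ?B \<inter> (G \<inter> cyl w) \<in> null_sets \<mu>" using AE_iff_null_sets by blast
      then show ?thesis by (rule null_setsD1)
    qed
    finally have "AE x in \<mu>. emeasure (sequence_law x) ?B * indicator (G \<inter> cyl w) x = 0"
      using nn_integral_0_iff_AE[OF m0] by blast
    with AEG Sw show ?thesis by eventually_elim (auto simp: indicator_def)
  qed
  have "AE x in \<mu>. \<forall>w\<in>good_words. x \<in> cyl w \<longrightarrow> S x \<and> emeasure (sequence_law x) (space ?\<Sigma> - Z) = 0"
    using null by (intro AE_ball_countable' countable_good_words) auto
  with good have "AE x in \<mu>. S x \<and> emeasure (sequence_law x) (space ?\<Sigma> - Z) = 0"
    by eventually_elim blast
  then obtain N where N: "{x\<in>space \<mu>. \<not> (S x \<and> emeasure (sequence_law x) (space ?\<Sigma> - Z) = 0)} \<subseteq> N"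
      "emeasure \<mu> N = 0" "N \<in> sets \<mu>"
    by (rule AE_E)
  have "\<exists>m. prob_space m \<and> sets m = sets M \<and> (\<forall>v\<in>lists \<alpha>. emeasure m (cyl v) = word_freq v x)"
    if "x \<in> space M - N" for x
    using that N(1) by (intro product_kernel_at[OF _ Z(1,2)]) (auto simp: space_mu S_def)
  then have "\<exists>m. \<forall>x\<in>space M - N. prob_space (m x) \<and> sets (m x) = sets M \<and>
      (\<forall>v\<in>lists \<alpha>. emeasure (m x) (cyl v) = word_freq v x)"
    by (intro bchoice) blast
  moreover have "AE x in \<mu>. x \<in> space M - N"
  proof -
    have "AE x in \<mu>. x \<notin> N" using N(2,3) by (intro AE_not_in null_setsI)
    then show ?thesis using AE_space[of \<mu>] by eventually_elim (simp add: space_mu)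
  qed
  moreover have "space M - N \<in> sets M" using N(3) sets_mu by auto
  ultimately show ?thesis by blast
qed

end

section \<open>The mixture\<close>

lemma infinite_letters_prefix:
  fixes g :: "nat \<Rightarrow> 'b"
  assumes "\<And>a. a \<in> set v \<Longrightarrow> infinite {n. g n = a}"
  shows "\<exists>l. mset v \<subseteq># mset (map g [0..<l])"
  using assms
proof (induction v)
  case (Cons a v)
  then obtain l where l: "mset v \<subseteq># mset (map g [0..<l])" by auto
  have "infinite {n. g n = a}" using Cons.prems by simp
  then obtain n where n: "n \<ge> l" "g n = a"
    unfolding infinite_nat_iff_unbounded_le by blast
  have "[0..<Suc n] = [0..<l] @ [l..<n] @ [n]"
    using n(1) upt_add_eq_append[of 0 l "n - l"] by simp
  then have "mset (map g [0..<Suc n]) = mset (map g [0..<l]) + mset (map g [l..<n]) + {#a#}"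
    using n(2) by simp
  moreover have "mset v + {#a#} \<subseteq># mset (map g [0..<l]) + mset (map g [l..<n]) + {#a#}"
    using l by (simp add: subset_mset.le_iff_add) (metis add.assoc)
  ultimately have "mset (a # v) \<subseteq># mset (map g [0..<Suc n])" by simp
  then show ?case by blast
qed simp

context exchangeable_measure
begin

text \<open>
  The tail behind a good word again starts with a good word: by recurrence some prefix of it contains
  the letters of the word with multiplicity, so it is a rearrangement of a longer good word.
\<close>

lemma tail_good:
  assumes rec: "recurrent_measure T \<alpha> \<mu>" and v: "v \<in> good_words"
  shows "AE x in \<mu>. x \<in> cyl v \<longrightarrow> (\<exists>u\<in>good_words. (T ^^ length v) x \<in> cyl u)"
  using recurrent_letters[OF rec]
proof eventually_elim
  case (elim x)
  show ?case
  proof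
    assume x: "x \<in> cyl v"
    then have xM: "x \<in> space M" using cyl_subset_space by auto
    let ?y = "(T ^^ length v) x"
    have yM: "?y \<in> space M" using xM by (rule funpow_space)
    have "infinite {n. coding T \<alpha> ?y n = a}" if a: "a \<in> set v" for a
    proof -
      obtain i where "i < length v" "a = v ! i" using a by (auto simp: in_set_conv_nth)
      then have "a = coding T \<alpha> x i" using x by (simp add: cyl_def)
      then have inf: "infinite {n. coding T \<alpha> x n = a}" using elim by simp
      show ?thesis
        unfolding infinite_nat_iff_unbounded_le
      proof (intro allI)
        fix m
        obtain n where n: "n \<ge> length v + m" "coding T \<alpha> x n = a"
          using inf unfolding infinite_nat_iff_unbounded_le by blast
        then have "coding T \<alpha> ?y (n - length v) = a" by (simp add: coding_shift)
        then show "\<exists>n\<ge>m. n \<in> {n. coding T \<alpha> ?y n = a}"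
          using n by (intro exI[of _ "n - length v"]) auto
      qed
    qed
    then obtain l where "mset v \<subseteq># mset (map (coding T \<alpha> ?y) [0..<l])"
      using infinite_letters_prefix[of v "coding T \<alpha> ?y"] by blast
    then obtain D where D: "mset (map (coding T \<alpha> ?y) [0..<l]) = mset v + D"
      by (auto simp: subset_mset.le_iff_add)
    obtain v' where v': "mset v' = D" using ex_mset by blast
    let ?u = "map (coding T \<alpha> ?y) [0..<l]"
    have mu: "mset (v @ v') = mset ?u" using D v' by simp
    have "set v' \<subseteq> set ?u" using mset_eq_setD[OF mu] by auto
    then have "v' \<in> lists \<alpha>" using letter[OF yM] by auto
    then have "?u \<in> good_words" using good_mset[OF good_append[OF v] mu] by blast
    moreover have "?y \<in> cyl ?u" using yM by (simp add: cyl_def)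
    ultimately show "\<exists>u\<in>good_words. ?y \<in> cyl u" by blast
  qed
qed

lemma good_Int:
  assumes "d \<in> good_words" "v \<in> lists \<alpha>"
  shows "cyl d \<inter> cyl v = {} \<or> (\<exists>e\<in>good_words. cyl d \<inter> cyl v = cyl e)"
proof (cases "length d \<le> length v")
  case True
  have "cyl d \<inter> cyl v = {}" if "cyl d \<inter> cyl v \<noteq> cyl v" using cyl_Int[OF True] that by blast
  moreover have "v \<in> good_words" if "cyl d \<inter> cyl v = cyl v"
  proof -
    have "emeasure \<mu> (cyl v) \<le> emeasure \<mu> (cyl d)" using that by (intro emeasure_mono) auto
    then show ?thesis using assms by (auto simp: good_words_def)
  qed
  ultimately show ?thesis by blast
next
  case False
  then show ?thesis using cyl_Int[of v d] assms by (auto simp: Int_commute)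
qed

text \<open>
  The mixture formula with index space inside the space itself. On good cylinders it is
  \<open>weight_word_freq\<close>; the points without good prefix have measure zero on both sides.
\<close>

theorem mixture_on_space:
  assumes rec: "recurrent_measure T \<alpha> \<mu>" and good: "AE x in \<mu>. \<exists>w\<in>good_words. x \<in> cyl w"
    and sf: "sigma_finite_measure \<mu>"
  shows "\<exists>\<nu> m. sigma_finite_measure (\<nu> :: 'a measure) \<and> m \<in> measurable \<nu> (prob_algebra M) \<and>
    (\<forall>x\<in>space \<nu>. \<forall>v\<in>lists \<alpha>. emeasure (m x) (cyl v) = word_freq v x) \<and>
    (\<forall>B\<in>sets M. emeasure \<mu> B = (\<integral>\<^sup>+x. emeasure (m x) B \<partial>\<nu>))"
proof -
  obtain G m where G: "G \<in> sets M" "AE x in \<mu>. x \<in> G"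
    and m: "\<And>x. x \<in> G \<Longrightarrow> prob_space (m x)" "\<And>x. x \<in> G \<Longrightarrow> sets (m x) = sets M"
      "\<And>x v. x \<in> G \<Longrightarrow> v \<in> lists \<alpha> \<Longrightarrow> emeasure (m x) (cyl v) = word_freq v x"
    using ex_product_kernel[OF good] by blast
  define \<nu> where "\<nu> = restrict_space (density \<mu> weight) G"
  have GM: "G \<subseteq> space M" using G(1) by (rule sets.sets_into_space)
  have Gd: "G \<inter> space (density \<mu> weight) \<in> sets (density \<mu> weight)" using G sets_mu by auto
  have sp\<nu>: "space \<nu> = G" using GM by (auto simp: \<nu>_def space_restrict_space space_mu)
  have sets\<nu>: "sets \<nu> = sets (restrict_space M G)"
    unfolding \<nu>_def using sets_mu by (simp add: sets_restrict_space)
  interpret sf: sigma_finite_measure \<mu> by (rule sf)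
  have "sigma_finite_measure (density \<mu> weight)"
    using weight_finite[OF rec good] by (subst sf.sigma_finite_iff_density_finite) auto
  then have sf\<nu>: "sigma_finite_measure \<nu>"
    unfolding \<nu>_def using G sets_mu by (intro sigma_finite_measure_restrict_space) auto
  have mk: "m \<in> measurable \<nu> (prob_algebra M)"
  proof (rule kernel_measurable)
    fix w assume w: "w \<in> lists \<alpha>"
    have "word_freq w \<in> borel_measurable (restrict_space M G)"
      by (intro measurable_restrict_space1) simp
    then have "word_freq w \<in> borel_measurable \<nu>"
      using measurable_cong_sets[OF sets\<nu> refl] by blast
    then show "(\<lambda>x. emeasure (m x) (cyl w)) \<in> borel_measurable \<nu>"
      using m(3)[OF _ w] by (subst measurable_cong[where g = "word_freq w"]) (auto simp: sp\<nu>)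
  qed (use m sp\<nu> in auto)
  have km: "(\<lambda>x. emeasure (m x) B) \<in> borel_measurable \<nu>" if "B \<in> sets M" for B
    using measurable_emeasure_kernel[OF measurable_prob_algebraD[OF mk] that] .
  have kmG: "(\<lambda>x. emeasure (m x) B * indicator G x) \<in> borel_measurable M" if B: "B \<in> sets M" for B
  proof -
    have "(\<lambda>x. emeasure (m x) B) \<in> borel_measurable (restrict_space M G)"
      using km[OF B] measurable_cong_sets[OF sets\<nu> refl] by blast
    then show ?thesis using G by (subst (asm) borel_measurable_restrict_space_iff_ennreal) auto
  qed
  have int\<nu>: "(\<integral>\<^sup>+x. emeasure (m x) B \<partial>\<nu>) = (\<integral>\<^sup>+x. weight x * (emeasure (m x) B * indicator G x) \<partial>\<mu>)"
    if B: "B \<in> sets M" for B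
    unfolding \<nu>_def nn_integral_restrict_space[OF Gd]
    using kmG[OF B] by (intro nn_integral_density) simp_all
  have cyl_int: "(\<integral>\<^sup>+x. emeasure (m x) (cyl d) \<partial>\<nu>) = emeasure \<mu> (cyl d)" if d: "d \<in> good_words" for d
  proof -
    have "(\<integral>\<^sup>+x. emeasure (m x) (cyl d) \<partial>\<nu>) = (\<integral>\<^sup>+x. weight x * word_freq d x \<partial>\<mu>)"
      unfolding int\<nu>[OF cyl_measurable]
    proof (rule nn_integral_cong_AE)
      have dl: "d \<in> lists \<alpha>" using d by (simp add: good_words_def)
      show "AE x in \<mu>. weight x * (emeasure (m x) (cyl d) * indicator G x) = weight x * word_freq d x"
        using G(2) by eventually_elim (simp add: m(3)[OF _ dl])
    qed
    then show ?thesis using weight_word_freq[OF rec d] by simp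
  qed
  define bad where "bad = space M - (\<Union>w\<in>good_words. cyl w)"
  have badM: "bad \<in> sets M"
    unfolding bad_def by (intro sets.Diff sets.top sets.countable_UN'[OF countable_good_words]) auto
  have bad_int: "(\<integral>\<^sup>+x. emeasure (m x) bad \<partial>\<nu>) = 0"
  proof -
    have "(\<integral>\<^sup>+x\<in>cyl v. of_bool (first_charged v x) / word_freq v x * (emeasure (m x) bad * indicator G x) \<partial>\<mu>) = 0"
      if v: "v \<in> good_words" for v
    proof -
      let ?\<phi> = "T ^^ length v"
      have "(\<integral>\<^sup>+x\<in>G \<inter> cyl v. emeasure (m x) bad \<partial>\<mu>) = emeasure \<mu> (?\<phi> -` bad \<inter> (G \<inter> cyl v))"
        by (rule kernel_on_cylinder[OF v coordinates_axioms funpow_measurable _ G(1) _ m badM, symmetric])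
          (use G(2) in \<open>auto simp: coding_shift elim!: eventually_mono\<close>)
      also have "\<dots> = 0"
      proof -
        have "?\<phi> -` bad \<inter> space M \<in> sets M" using funpow_measurable badM by (rule measurable_sets)
        moreover have "?\<phi> -` bad \<inter> (G \<inter> cyl v) = (?\<phi> -` bad \<inter> space M) \<inter> (G \<inter> cyl v)"
          using cyl_subset_space by auto
        moreover have "G \<inter> cyl v \<in> sets M" using G by auto
        ultimately have "?\<phi> -` bad \<inter> (G \<inter> cyl v) \<in> sets \<mu>" unfolding sets_mu by (metis sets.Int)
        moreover have "AE x in \<mu>. x \<notin> ?\<phi> -` bad \<inter> (G \<inter> cyl v)"
          using tail_good[OF rec v] by eventually_elim (auto simp: bad_def)
        ultimately have "?\<phi> -` bad \<inter> (G \<inter> cyl v) \<in> null_sets \<mu>" using AE_iff_null_sets by blast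
        then show ?thesis by (rule null_setsD1)
      qed
      finally have z: "(\<integral>\<^sup>+x. emeasure (m x) bad * indicator G x * indicator (cyl v) x \<partial>\<mu>) = 0"
        by (simp add: indicator_inter_arith mult.assoc)
      have "(\<lambda>x. emeasure (m x) bad * indicator G x * indicator (cyl v) x) \<in> borel_measurable \<mu>"
        using borel_measurable_times_ennreal[OF kmG[OF badM], of "indicator (cyl v)"] by simp
      from z nn_integral_0_iff_AE[OF this] have
        "AE x in \<mu>. emeasure (m x) bad * indicator G x * indicator (cyl v) x = 0" by blast
      then have "AE x in \<mu>. of_bool (first_charged v x) / word_freq v x *
          (emeasure (m x) bad * indicator G x) * indicator (cyl v) x = 0"
        by eventually_elim (simp add: mult.assoc)
      then have "(\<integral>\<^sup>+x\<in>cyl v. of_bool (first_charged v x) / word_freq v x * (emeasure (m x) bad * indicator G x) \<partial>\<mu>) =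
          (\<integral>\<^sup>+x. 0 \<partial>\<mu>)" by (rule nn_integral_cong_AE)
      then show ?thesis by simp
    qed
    then show ?thesis
      unfolding int\<nu>[OF badM] weight_integral[OF kmG[OF badM]]
      by (simp cong: nn_integral_cong_simp)
  qed
  have "emeasure \<mu> B = (\<integral>\<^sup>+x. emeasure (m x) B \<partial>\<nu>)" if B: "B \<in> sets M" for B
  proof (cases "G = {}")
    case True
    then have "AE x in \<mu>. x \<notin> B" using G(2) by (auto elim!: eventually_mono)
    moreover have "B \<in> sets \<mu>" using B sets_mu by simp
    ultimately have "B \<in> null_sets \<mu>" using AE_iff_null_sets by blast
    then have "emeasure \<mu> B = 0" by (rule null_setsD1)
    then show ?thesis using True sp\<nu> by (simp add: nn_integral_empty)
  next
    case False
    then have ne: "space \<nu> \<noteq> {}" by (simp add: sp\<nu>)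
    have mk': "m \<in> measurable \<nu> (subprob_algebra M)" by (rule measurable_prob_algebraD[OF mk])
    let ?\<mu> = "\<nu> \<bind> m"
    have s': "sets ?\<mu> = sets M"
      by (rule sets_bind[OF _ ne]) (rule sets_kernel[OF mk'])
    have e': "emeasure ?\<mu> C = (\<integral>\<^sup>+x. emeasure (m x) C \<partial>\<nu>)" if "C \<in> sets M" for C
      by (rule emeasure_bind[OF ne mk' that])
    have on_good: "emeasure \<mu> C = emeasure ?\<mu> C" if d: "d \<in> good_words" and C: "C \<in> sets M" "C \<subseteq> cyl d" for d C
    proof -
      have eqd: "emeasure \<mu> (cyl d \<inter> cyl v) = emeasure ?\<mu> (cyl d \<inter> cyl v)" if "v \<in> lists \<alpha>" for v
        using good_Int[OF d that] cyl_int e' by auto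
      have dens: "emeasure (density R (indicator (cyl d))) E = emeasure R (cyl d \<inter> E)"
        if "E \<in> sets M" "sets R = sets M" for E R
        using that by (subst emeasure_density) (auto simp: indicator_inter_arith[symmetric] mult.commute Int_commute)
      have "density \<mu> (indicator (cyl d)) = density ?\<mu> (indicator (cyl d))"
        using d eqd dens sets_mu s' cyl_subset_space
        by (intro measure_eqI_cylinders) (auto simp: good_words_def Int_absorb2)
      then have "emeasure \<mu> (cyl d \<inter> C) = emeasure ?\<mu> (cyl d \<inter> C)"
        using dens[OF C(1) sets_mu] dens[OF C(1) s'] by simp
      then show ?thesis using C by (simp add: Int_absorb1)
    qed
    define D where "D n = (if n \<in> to_nat_on good_words ` good_words then cyl (from_nat_into good_words n) else {})" for n
    have D_in: "D n = {} \<or> (\<exists>d\<in>good_words. D n = cyl d)" for n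
      using countable_good_words by (auto simp: D_def)
    have UD: "(\<Union>n. D n) = (\<Union>w\<in>good_words. cyl w)"
    proof
      show "(\<Union>n. D n) \<subseteq> (\<Union>w\<in>good_words. cyl w)" using D_in by blast
      have "cyl w = D (to_nat_on good_words w)" if "w \<in> good_words" for w
        using that countable_good_words by (simp add: D_def)
      then show "(\<Union>w\<in>good_words. cyl w) \<subseteq> (\<Union>n. D n)" by blast
    qed
    have "\<mu> = ?\<mu>"
    proof (rule measure_eqI_countable_cover[where D = D])
      show "sets ?\<mu> = sets \<mu>" using s' sets_mu by simp
      show "D n \<in> sets \<mu>" for n using D_in[of n] by auto
      show "emeasure \<mu> C = emeasure ?\<mu> C" if "C \<in> sets \<mu>" "C \<subseteq> D n" for n C
        using D_in[of n] that on_good sets_mu by auto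
      have "AE x in \<mu>. x \<notin> bad" using good by eventually_elim (auto simp: bad_def)
      moreover have "bad \<in> sets \<mu>" using badM sets_mu by simp
      ultimately have "bad \<in> null_sets \<mu>" using AE_iff_null_sets by blast
      then show "emeasure \<mu> (space \<mu> - (\<Union>n. D n)) = 0"
        unfolding UD space_mu bad_def by (rule null_setsD1)
      show "emeasure ?\<mu> (space \<mu> - (\<Union>n. D n)) = 0"
        using bad_int e'[OF badM] unfolding UD space_mu bad_def by simp
    qed
    then show ?thesis using e'[OF B] by simp
  qed
  then show ?thesis using sf\<nu> mk m(3) sp\<nu> by (intro exI[of _ \<nu>] exI[of _ m]) auto
qed

theorem mixture:
  assumes rec: "recurrent_measure T \<alpha> \<mu>" and good: "AE x in \<mu>. \<exists>w\<in>good_words. x \<in> cyl w"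
    and sf: "sigma_finite_measure \<mu>"
  shows "is_mixture (product_measure M T \<alpha>) \<mu>"
proof -
  obtain \<nu> m where \<nu>: "sigma_finite_measure (\<nu> :: 'a measure)" "m \<in> measurable \<nu> (prob_algebra M)"
    and m: "\<And>x v. x \<in> space \<nu> \<Longrightarrow> v \<in> lists \<alpha> \<Longrightarrow> emeasure (m x) (cyl v) = word_freq v x"
    and rep: "\<And>B. B \<in> sets M \<Longrightarrow> emeasure \<mu> B = (\<integral>\<^sup>+x. emeasure (m x) B \<partial>\<nu>)"
    using mixture_on_space[OF assms] by blast
  have prod: "product_measure M T \<alpha> (m x)" if x: "x \<in> space \<nu>" for x
    unfolding product_measure_def
  proof (intro conjI allI impI)
    have "m x \<in> space (prob_algebra M)" using \<nu>(2) x by (rule measurable_space)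
    then show "prob_space (m x)" "sets (m x) = sets M" by (auto simp: space_prob_algebra)
    fix n and A :: "nat \<Rightarrow> 'a set" assume A: "\<forall>j\<le>n. A j \<in> \<alpha>"
    have one: "emeasure (m x) (A j) = lim_freq (A j) x" if "j \<le> n" for j
    proof -
      have "A j = cyl [A j]"
        using A that coding_eq_iff[of _ "A j" 0] partition by (auto simp: cyl_def partition_on_def)
      then show ?thesis using m[OF x, of "[A j]"] A that by simp
    qed
    have "cylinder M T (Suc n) A = cyl (map A [0..<Suc n])"
      using A by (intro cylinder_eq_cyl) auto
    moreover have "map A [0..<Suc n] \<in> lists \<alpha>" using A by (auto simp: less_Suc_eq_le simp del: upt_Suc)
    ultimately have "emeasure (m x) (cylinder M T (Suc n) A) = word_freq (map A [0..<Suc n]) x"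
      by (simp only: m[OF x])
    also have "\<dots> = (\<Prod>j<Suc n. lim_freq (A j) x)"
      unfolding word_freq_def by (simp add: prod.list_conv_set_nth atLeast0LessThan del: upt_Suc prod.lessThan_Suc)
    also have "\<dots> = (\<Prod>j\<le>n. emeasure (m x) (A j))"
      unfolding lessThan_Suc_atMost by (intro prod.cong) (auto simp: one)
    finally show "emeasure (m x) (cylinder M T (Suc n) A) = (\<Prod>j\<le>n. emeasure (m x) (A j))" .
  qed
  \<comment> \<open>The index space has to consist of measures, so points are replaced by Dirac measures. The full
    power set is used, which makes this injective.\<close>
  define \<delta> :: "'a \<Rightarrow> 'a measure" where "\<delta> x = return (count_space UNIV) x" for x
  have inj: "inj \<delta>"
  proof (rule injI)
    fix x y assume "\<delta> x = \<delta> y"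
    then have "emeasure (\<delta> x) {x} = emeasure (\<delta> y) {x}" by simp
    then show "x = y" by (simp add: \<delta>_def indicator_def split: if_splits)
  qed
  have inv: "inv \<delta> (\<delta> x) = x" for x using inj by simp
  have "mixture_over (embed_measure \<nu> \<delta>) (m \<circ> inv \<delta>) (product_measure M T \<alpha>) \<mu>"
    unfolding mixture_over_def
  proof (intro conjI ballI)
    show "sigma_finite_measure (embed_measure \<nu> \<delta>)" using \<nu>(1) inj by (rule sigma_finite_embed_measure)
    show "product_measure M T \<alpha> ((m \<circ> inv \<delta>) \<omega>)" if "\<omega> \<in> space (embed_measure \<nu> \<delta>)" for \<omega>
      using that prod inv by (auto simp: space_embed_measure)
    fix B assume "B \<in> sets \<mu>"
    then have B: "B \<in> sets M" using sets_mu by simp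
    have "(\<lambda>x. emeasure (m x) B) \<in> borel_measurable \<nu>"
      using measurable_emeasure_kernel[OF measurable_prob_algebraD[OF \<nu>(2)] B] .
    then show meas: "(\<lambda>\<omega>. emeasure ((m \<circ> inv \<delta>) \<omega>) B) \<in> borel_measurable (embed_measure \<nu> \<delta>)"
      by (intro measurable_embed_measure1) (simp add: inv)
    show "emeasure \<mu> B = (\<integral>\<^sup>+\<omega>. emeasure ((m \<circ> inv \<delta>) \<omega>) B \<partial>embed_measure \<nu> \<delta>)"
      using rep[OF B] nn_integral_embed_measure[OF inj meas] by (simp add: inv)
  qed
  then show ?thesis unfolding is_mixture_def by blast
qed

end

section \<open>The cylinder topology\<close>

context full_fibred_system
begin

lemma cylinder_topology_nhd:
  assumes "openin (cylinder_topology M T \<alpha>) U" "x \<in> U"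
  shows "\<exists>w\<in>lists \<alpha>. x \<in> cyl w \<and> cyl w \<subseteq> U"
  using assms unfolding cylinder_topology_def openin_topology_generated_by_iff
proof (induction arbitrary: x rule: generate_topology_on.induct)
  case (Int a b)
  then have x: "x \<in> a" "x \<in> b" by auto
  obtain w where w: "w \<in> lists \<alpha>" "x \<in> cyl w" "cyl w \<subseteq> a" using Int.IH(1)[OF x(1)] by blast
  obtain v where v: "v \<in> lists \<alpha>" "x \<in> cyl v" "cyl v \<subseteq> b" using Int.IH(2)[OF x(2)] by blast
  show ?case
  proof (cases "length w \<le> length v")
    case True
    then show ?thesis using cyl_Int[of w v] w v by (intro bexI[of _ v]) auto
  next
    case False
    then show ?thesis using cyl_Int[of v w] w v by (intro bexI[of _ w]) auto
  qed
next
  case (UN K)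
  then obtain k where k: "k \<in> K" "x \<in> k" by blast
  then obtain w where "w \<in> lists \<alpha>" "x \<in> cyl w" "cyl w \<subseteq> k" using UN.IH[OF k] by blast
  then show ?case using k by blast
next
  case (Basis s)
  then obtain k a where s: "s = cylinder M T k a" "\<forall>j<k. a j \<in> \<alpha>" by blast
  then have "s = cyl (map a [0..<k])" by (simp add: cylinder_eq_cyl)
  moreover have "map a [0..<k] \<in> lists \<alpha>" using s by auto
  ultimately show ?case using Basis.prems by blast
qed simp

lemma openin_cylinder_topology_measurable:
  assumes U: "openin (cylinder_topology M T \<alpha>) U"
  shows "U \<in> sets M"
proof -
  have "U = (\<Union>w\<in>{w\<in>lists \<alpha>. cyl w \<subseteq> U}. cyl w)" using cylinder_topology_nhd[OF U] by blast
  moreover have "(\<Union>w\<in>{w\<in>lists \<alpha>. cyl w \<subseteq> U}. cyl w) \<in> sets M"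
    using countable_lists[OF countable_letters] 
    by (intro sets.countable_UN') (auto intro: countable_subset)
  ultimately show ?thesis by simp
qed

lemma topspace_cylinder_topology: "topspace (cylinder_topology M T \<alpha>) = space M"
proof -
  have "x \<in> topspace (cylinder_topology M T \<alpha>)" if x: "x \<in> space M" for x
  proof -
    have "x \<in> cylinder M T 1 (\<lambda>_. coding T \<alpha> x 0)"
      using coding_in[OF x, of 0] x by (simp add: cylinder_def)
    moreover have "coding T \<alpha> x 0 \<in> \<alpha>" using letter[OF x] .
    ultimately show ?thesis
      unfolding cylinder_topology_def topology_generated_by_topspace
      by (intro UnionI[of "cylinder M T 1 (\<lambda>_. coding T \<alpha> x 0)"]) auto
  qed
  moreover have "topspace (cylinder_topology M T \<alpha>) \<subseteq> space M"
    unfolding cylinder_topology_def topology_generated_by_topspace by (auto simp: cylinder_def)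
  ultimately show ?thesis by blast
qed

end

context exchangeable_measure
begin

lemma locally_finite_good:
  assumes Y: "Y \<in> sets M" "emeasure \<mu> (space M - Y) = 0"
    and fin: "locally_finite_measure (subtopology (cylinder_topology M T \<alpha>) Y) \<mu>"
    and x: "x \<in> Y"
  shows "\<exists>w\<in>good_words. x \<in> cyl w"
proof -
  have YM: "Y \<subseteq> space M" using Y(1) by (rule sets.sets_into_space)
  obtain \<U> where U: "\<forall>U\<in>\<U>. openin (subtopology (cylinder_topology M T \<alpha>) Y) U \<and> emeasure \<mu> U < \<infinity>"
      "\<Union>\<U> = topspace (subtopology (cylinder_topology M T \<alpha>) Y)"
    using fin unfolding locally_finite_measure_def by blast
  have "x \<in> \<Union>\<U>" unfolding U(2) using x YM by (auto simp: topspace_cylinder_topology)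
  then obtain U where "U \<in> \<U>" "x \<in> U" by blast
  with U(1) have "openin (subtopology (cylinder_topology M T \<alpha>) Y) U" "emeasure \<mu> U < \<infinity>" by auto
  then obtain V where V: "openin (cylinder_topology M T \<alpha>) V" "U = V \<inter> Y"
    by (auto simp: openin_subtopology)
  obtain w where w: "w \<in> lists \<alpha>" "x \<in> cyl w" "cyl w \<subseteq> V"
    using cylinder_topology_nhd[OF V(1)] \<open>x \<in> U\<close> V(2) by blast
  have N: "space M - Y \<in> null_sets \<mu>" using Y sets_mu by auto
  have "emeasure \<mu> (cyl w) = emeasure \<mu> (cyl w - (space M - Y))"
    by (rule emeasure_Diff_null_set[OF N, symmetric]) simp
  also have "\<dots> \<le> emeasure \<mu> U"
    using w V Y openin_cylinder_topology_measurable[OF V(1)] cyl_subset_space[of w] sets_mu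
    by (intro emeasure_mono) auto
  finally have "emeasure \<mu> (cyl w) < \<infinity>" using \<open>emeasure \<mu> U < \<infinity>\<close> by (rule le_less_trans)
  then show ?thesis using w by (auto simp: good_words_def)
qed

section \<open>Local finiteness implies recurrence\<close>

lemma good_prefix:
  assumes "w \<in> good_words" "x \<in> cyl w" "length w \<le> n"
  shows "map (coding T \<alpha> x) [0..<n] \<in> good_words"
proof -
  have x: "x \<in> space M" using assms cyl_subset_space by auto
  have "map (coding T \<alpha> x) [0..<n] = w @ map (coding T \<alpha> x) [length w..<n]"
    using assms by (intro nth_equalityI) (auto simp: nth_append cyl_def)
  moreover have "map (coding T \<alpha> x) [length w..<n] \<in> lists \<alpha>" using letter[OF x] by auto
  ultimately show ?thesis using good_append[OF assms(1)] by metis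
qed

text \<open>
  Suppose that with positive measure the letter \<open>a\<close> at position \<open>i\<close> of a good word \<open>w\<close> does not return
  behind the word. Some letter \<open>b\<close> then occurs there with positive measure at every late time \<open>n\<close>, and the
  transposition of \<open>i\<close> and \<open>n\<close> moves the last \<open>a\<close> to time \<open>n\<close>. For different \<open>n\<close> this yields disjoint sets
  of the same positive measure. They accumulate at a point that arises when the letter at position \<open>i\<close> of
  a suitable point is replaced by \<open>b\<close>, and every cylinder of this point has infinite measure.
\<close>

lemma last_occurrence_null:
  assumes good: "\<And>x. x \<in> space M \<Longrightarrow> \<exists>w\<in>good_words. x \<in> cyl w"
    and w: "w \<in> good_words" and i: "i < length w"
  shows "emeasure \<mu> {x\<in>cyl w. \<forall>n\<ge>length w. coding T \<alpha> x n \<noteq> w ! i} = 0"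
proof (rule ccontr)
  let ?k = "length w" and ?a = "w ! i"
  define E where "E = {x\<in>cyl w. \<forall>n\<ge>?k. coding T \<alpha> x n \<noteq> ?a}"
  assume "emeasure \<mu> {x\<in>cyl w. \<forall>n\<ge>length w. coding T \<alpha> x n \<noteq> w ! i} \<noteq> 0"
  then have pos: "emeasure \<mu> E \<noteq> 0" by (simp add: E_def)
  have wl: "w \<in> lists \<alpha>" using w by (simp add: good_words_def)
  have subM: "cyl v \<subseteq> space M" for v by (rule cyl_subset_space)
  have letter_cyl: "coding T \<alpha> x n \<in> \<alpha>" if "x \<in> cyl v" for x v n using letter subM that by blast
  have Em: "E \<in> sets M"
  proof -
    have "E = cyl w \<inter> {x\<in>space M. \<forall>n\<ge>?k. coding T \<alpha> x n \<noteq> ?a}" using subM by (auto simp: E_def)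
    also have "\<dots> \<in> sets M" by (intro sets.Int cyl_measurable) measurable
    finally show ?thesis .
  qed
  \<comment> \<open>\<open>F v b n\<close>: the point lies in \<open>E\<close>, goes on with \<open>v\<close>, and has letter \<open>b\<close> at time \<open>n\<close>.\<close>
  define F where "F v b n = {x\<in>E \<inter> cyl (w @ v). coding T \<alpha> x n = b}" for v b n
  have Fm: "F v b n \<in> sets M" for v b n
  proof -
    have "F v b n = E \<inter> cyl (w @ v) \<inter> {x\<in>space M. coding T \<alpha> x n = b}" using subM by (auto simp: F_def)
    then show ?thesis using Em by auto
  qed
  have Fexch: "emeasure \<mu> (F v b n) = emeasure \<mu> (F v b (?k + length v))" if n: "n \<ge> ?k + length v" for v b n
  proof -
    let ?m = "?k + length v"
    let ?p = "Transposition.transpose ?m n"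
    have p: "?p permutes {?m, n}" "finite {?m, n}" by (auto intro: permutes_swap_id)
    have ge: "?k \<le> ?p j \<longleftrightarrow> ?k \<le> j" for j using n by (auto simp: Transposition.transpose_def)
    have "rearrange ?p -` F v b n \<inter> space M = F v b ?m"
    proof (intro set_eqI)
      fix x
      show "x \<in> rearrange ?p -` F v b n \<inter> space M \<longleftrightarrow> x \<in> F v b ?m"
      proof (cases "x \<in> space M")
        case x: True
        note r = rearrange[OF p x]
        have 1: "rearrange ?p x \<in> cyl w \<longleftrightarrow> x \<in> cyl w"
          using n x r by (auto simp: cyl_def Transposition.transpose_def)
        have 2: "rearrange ?p x \<in> cyl (w @ v) \<longleftrightarrow> x \<in> cyl (w @ v)"
          using n x r by (auto simp: cyl_def Transposition.transpose_def)
        have 3: "(\<forall>j\<ge>?k. coding T \<alpha> (rearrange ?p x) j \<noteq> ?a) \<longleftrightarrow> (\<forall>j\<ge>?k. coding T \<alpha> x j \<noteq> ?a)"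
          unfolding r(2) by (metis ge transpose_involutory)
        have 4: "coding T \<alpha> (rearrange ?p x) n = coding T \<alpha> x ?m" unfolding r(2) by simp
        show ?thesis using x 1 2 3 4 by (auto simp: F_def E_def)
      qed (use subM in \<open>auto simp: F_def E_def\<close>)
    qed
    then show ?thesis using emeasure_rearrange_vimage[OF p Fm[of v b n]] by simp
  qed
  obtain b where b: "emeasure \<mu> (F [] b ?k) \<noteq> 0"
  proof -
    have "E = (\<Union>b\<in>\<alpha>. F [] b ?k)" using letter_cyl by (auto simp: F_def E_def)
    then have "\<not> (\<forall>b\<in>\<alpha>. F [] b ?k \<in> null_sets \<mu>)"
      using pos null_sets_UN'[OF countable_letters, of "\<lambda>b. F [] b ?k" \<mu>] by auto
    then obtain b where "F [] b ?k \<notin> null_sets \<mu>" by blast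
    then have "emeasure \<mu> (F [] b ?k) \<noteq> 0" using Fm sets_mu by (auto simp: null_sets_def)
    then show ?thesis by (rule that)
  qed
  have finw: "emeasure \<mu> (cyl w) < \<infinity>" using w by (simp add: good_words_def)
  \<comment> \<open>With positive measure the letter \<open>b\<close> occurs infinitely often.\<close>
  define H where "H N = (\<Union>n\<in>{N + ?k..}. F [] b n)" for N
  have Hm: "H N \<in> sets \<mu>" for N using Fm sets_mu by (auto simp: H_def)
  have "(INF N. emeasure \<mu> (H N)) = emeasure \<mu> (\<Inter>N. H N)"
  proof (rule INF_emeasure_decseq)
    show "decseq H"
      unfolding decseq_def H_def
    proof (intro allI impI UN_mono subset_refl)
      fix m n :: nat assume "m \<le> n"
      then show "{n + ?k..} \<subseteq> {m + ?k..}" by auto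
    qed
    fix N
    have "emeasure \<mu> (H N) \<le> emeasure \<mu> (cyl w)"
      by (rule emeasure_mono) (auto simp: H_def F_def E_def)
    then show "emeasure \<mu> (H N) \<noteq> \<infinity>" using finw by (auto simp: top_unique)
  qed (use Hm in auto)
  moreover have "emeasure \<mu> (F [] b ?k) \<le> (INF N. emeasure \<mu> (H N))"
  proof (rule INF_greatest)
    fix N
    have "emeasure \<mu> (F [] b ?k) = emeasure \<mu> (F [] b (N + ?k))" using Fexch[of "[]" "N + ?k" b] by simp
    also have "\<dots> \<le> emeasure \<mu> (H N)" using Hm by (intro emeasure_mono) (auto simp: H_def)
    finally show "emeasure \<mu> (F [] b ?k) \<le> emeasure \<mu> (H N)" .
  qed
  ultimately have "emeasure \<mu> (F [] b ?k) \<le> emeasure \<mu> (\<Inter>N. H N)" by simp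
  then have posH: "emeasure \<mu> (\<Inter>N. H N) \<noteq> 0" using b by auto
  \<comment> \<open>If \<open>b\<close> has measure zero right behind \<open>w @ v\<close>, then also at all later times. Hence almost every point
    with infinitely many \<open>b\<close> avoids all such words \<open>v\<close>.\<close>
  have "AE x in \<mu>. \<forall>v\<in>lists \<alpha>. \<forall>n. emeasure \<mu> (F v b (?k + length v)) = 0 \<longrightarrow> n \<ge> ?k + length v \<longrightarrow> x \<notin> F v b n"
  proof (intro AE_ball_countable' countable_lists countable_letters, subst AE_all_countable, rule allI)
    fix v n
    show "AE x in \<mu>. emeasure \<mu> (F v b (?k + length v)) = 0 \<longrightarrow> n \<ge> ?k + length v \<longrightarrow> x \<notin> F v b n"
    proof (cases "emeasure \<mu> (F v b (?k + length v)) = 0 \<and> n \<ge> ?k + length v")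
      case True
      then have "F v b n \<in> null_sets \<mu>" using Fexch[of v n b] Fm sets_mu by auto
      then have "AE x in \<mu>. x \<notin> F v b n" by (rule AE_not_in)
      then show ?thesis by eventually_elim simp
    qed auto
  qed
  then obtain N where N: "{x\<in>space \<mu>. \<not> (\<forall>v\<in>lists \<alpha>. \<forall>n. emeasure \<mu> (F v b (?k + length v)) = 0 \<longrightarrow>
      n \<ge> ?k + length v \<longrightarrow> x \<notin> F v b n)} \<subseteq> N" "emeasure \<mu> N = 0" "N \<in> sets \<mu>" by (rule AE_E)
  have "\<not> (\<Inter>N. H N) \<subseteq> N"
    using posH N(2,3) emeasure_mono[of "\<Inter>N. H N" N \<mu>] by auto
  then obtain x where xH: "\<And>N. x \<in> H N" and xN: "x \<notin> N" by blast
  then have xE: "x \<in> E" by (auto simp: H_def F_def)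
  then have xM: "x \<in> space M" and xw: "x \<in> cyl w" using subM by (auto simp: E_def)
  let ?z = "(T ^^ ?k) x"
  have zM: "?z \<in> space M" using xM by (rule funpow_space)
  define v where "v l = map (coding T \<alpha> ?z) [0..<l]" for l
  have vl: "v l \<in> lists \<alpha>" "length (v l) = l" for l using letter[OF zM] by (auto simp: v_def)
  have xv: "x \<in> cyl (w @ v l)" for l
    using xw by (simp add: cyl_append v_def coding_shift)
  have Fpos: "emeasure \<mu> (F (v l) b (?k + l)) \<noteq> 0" for l
  proof
    assume z: "emeasure \<mu> (F (v l) b (?k + l)) = 0"
    obtain n where n: "n \<ge> l + ?k" "x \<in> F [] b n" using xH[of l] by (auto simp: H_def)
    then have "x \<in> F (v l) b n" using xv by (auto simp: F_def)
    moreover have "x \<notin> F (v l) b n"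
    proof -
      have "x \<in> space \<mu>" using xM by (simp add: space_mu)
      then have P: "\<forall>v\<in>lists \<alpha>. \<forall>n. emeasure \<mu> (F v b (?k + length v)) = 0 \<longrightarrow>
          n \<ge> ?k + length v \<longrightarrow> x \<notin> F v b n"
        using N(1) xN by blast
      have "n \<ge> ?k + length (v l)" "emeasure \<mu> (F (v l) b (?k + length (v l))) = 0"
        using n(1) z vl(2)[of l] by auto
      then show ?thesis using P vl(1)[of l] by blast
    qed
    ultimately show False by simp
  qed
  \<comment> \<open>The point of accumulation \<open>y\<close> arises from \<open>x\<close> when the letter at time \<open>i\<close> is replaced by \<open>b\<close>.\<close>
  let ?w' = "w[i := b]"
  have ba: "b \<in> \<alpha>"
  proof -
    have "F [] b ?k \<noteq> {}" using b by auto
    then show ?thesis using letter_cyl by (auto simp: F_def)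
  qed
  have w'l: "?w' \<in> lists \<alpha>" using wl ba set_update_subset_insert[of w i b] by auto
  obtain y where y: "y \<in> cyl ?w'" "(T ^^ length ?w') y = ?z" using ex_prefix[OF zM w'l] by blast
  then have yM: "y \<in> space M" using subM by auto
  obtain u where u: "u \<in> good_words" "y \<in> cyl u" using good[OF yM] by blast
  define l where "l = length u"
  have pre: "map (coding T \<alpha> y) [0..<?k + l] = ?w' @ v l"
  proof (rule nth_equalityI)
    fix j assume j: "j < length (map (coding T \<alpha> y) [0..<?k + l])"
    show "map (coding T \<alpha> y) [0..<?k + l] ! j = (?w' @ v l) ! j"
    proof (cases "j < ?k")
      case True
      then show ?thesis using y(1) j by (simp add: nth_append cyl_def del: nth_list_update)
    next
      case False
      then have "coding T \<alpha> y (?k + (j - ?k)) = coding T \<alpha> ?z (j - ?k)"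
        using coding_shift[of ?k y "j - ?k"] y(2) by simp
      then show ?thesis using False j by (simp add: nth_append v_def)
    qed
  qed (simp add: vl)
  have "?w' @ v l \<in> good_words"
    using good_prefix[OF u, of "?k + l"] unfolding pre by (simp add: l_def)
  then have fin': "emeasure \<mu> (cyl (?w' @ v l)) < \<infinity>" by (simp add: good_words_def)
  \<comment> \<open>The last \<open>a\<close> occurs exactly at time \<open>?k + l + n\<close>.\<close>
  define D where "D n = {x\<in>cyl (?w' @ v l). coding T \<alpha> x (?k + l + n) = ?a \<and>
      (\<forall>j>?k + l + n. coding T \<alpha> x j \<noteq> ?a)}" for n
  have Dm: "D n \<in> sets M" for n
  proof -
    have "D n = cyl (?w' @ v l) \<inter> {x\<in>space M. coding T \<alpha> x (?k + l + n) = ?a \<and>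
      (\<forall>j>?k + l + n. coding T \<alpha> x j \<noteq> ?a)}" using subM by (auto simp: D_def)
    also have "\<dots> \<in> sets M" by (intro sets.Int cyl_measurable) measurable
    finally show ?thesis .
  qed
  have Dge: "emeasure \<mu> (F (v l) b (?k + l)) \<le> emeasure \<mu> (D n)" for n
  proof -
    let ?n = "?k + l + n"
    let ?p = "Transposition.transpose i ?n"
    have p: "?p permutes {i, ?n}" "finite {i, ?n}" by (auto intro: permutes_swap_id)
    have "F (v l) b ?n \<subseteq> rearrange ?p -` D n \<inter> space M"
    proof
      fix t assume t: "t \<in> F (v l) b ?n"
      then have tM: "t \<in> space M" using subM by (auto simp: F_def)
      note r = rearrange[OF p tM]
      have tw: "t \<in> cyl (w @ v l)" "t \<in> cyl w" "coding T \<alpha> t ?n = b" "\<And>j. j \<ge> ?k \<Longrightarrow> coding T \<alpha> t j \<noteq> ?a"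
        using t by (auto simp: F_def E_def)
      have "coding T \<alpha> (rearrange ?p t) j = (?w' @ v l) ! j" if j: "j < length (?w' @ v l)" for j
      proof (cases "j = i")
        case True
        then show ?thesis using r(2)[of i] tw(3) i by (simp add: nth_append)
      next
        case False
        moreover have "j \<noteq> ?n" using j vl by simp
        ultimately have "coding T \<alpha> (rearrange ?p t) j = (w @ v l) ! j"
          using r(2)[of j] tw(1) j by (simp add: cyl_def)
        then show ?thesis using False by (simp add: nth_append)
      qed
      moreover have "coding T \<alpha> (rearrange ?p t) ?n = ?a" using r(2)[of ?n] tw(2) i by (simp add: cyl_def)
      moreover have "coding T \<alpha> (rearrange ?p t) j \<noteq> ?a" if "j > ?n" for j
        using r(2)[of j] tw(4)[of j] that i by simp
      ultimately show "t \<in> rearrange ?p -` D n \<inter> space M"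
        using r(1) tM by (auto simp: D_def cyl_def)
    qed
    then have "emeasure \<mu> (F (v l) b ?n) \<le> emeasure \<mu> (rearrange ?p -` D n \<inter> space M)"
      using measurable_sets[OF rearrange_measurable[OF p] Dm] sets_mu by (intro emeasure_mono) auto
    also have "\<dots> = emeasure \<mu> (D n)" by (rule emeasure_rearrange_vimage[OF p Dm])
    finally show ?thesis using Fexch[of "v l" ?n b] vl by simp
  qed
  have "disjoint_family D"
    unfolding disjoint_family_on_def
  proof (intro ballI impI)
    fix m n :: nat assume "m \<noteq> n"
    then consider "m < n" | "n < m" by linarith
    then show "D m \<inter> D n = {}" by cases (auto simp: D_def)
  qed
  then have "(\<Sum>n. emeasure \<mu> (D n)) = emeasure \<mu> (\<Union>n. D n)"
    using Dm sets_mu by (intro suminf_emeasure) auto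
  also have "\<dots> \<le> emeasure \<mu> (cyl (?w' @ v l))" by (rule emeasure_mono) (auto simp: D_def)
  finally have fin: "(\<Sum>n. emeasure \<mu> (D n)) < \<infinity>" using fin' by (rule le_less_trans)
  have "(\<Sum>n. emeasure \<mu> (F (v l) b (?k + l))) \<le> (\<Sum>n. emeasure \<mu> (D n))"
    by (intro suminf_le Dge) auto
  moreover have "(\<Sum>n::nat. emeasure \<mu> (F (v l) b (?k + l))) = \<infinity>"
    using Fpos[of l] nn_integral_count_space_nat[of "\<lambda>_. emeasure \<mu> (F (v l) b (?k + l))"]
    by (simp add: ennreal_mult_eq_top_iff)
  ultimately show False using fin by (simp add: top_unique)
qed

theorem locally_finite_imp_recurrent:
  assumes good: "\<And>x. x \<in> space M \<Longrightarrow> \<exists>w\<in>good_words. x \<in> cyl w"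
  shows "recurrent_measure T \<alpha> \<mu>"
proof -
  have last: "AE x in \<mu>. \<forall>w\<in>good_words. \<forall>i. i < length w \<longrightarrow>
      x \<notin> {x\<in>cyl w. \<forall>n\<ge>length w. coding T \<alpha> x n \<noteq> w ! i}"
  proof (intro AE_ball_countable' countable_good_words, subst AE_all_countable, rule allI)
    fix w i assume w: "w \<in> good_words"
    let ?E = "{x\<in>cyl w. \<forall>n\<ge>length w. coding T \<alpha> x n \<noteq> w ! i}"
    show "AE x in \<mu>. i < length w \<longrightarrow> x \<notin> ?E"
    proof (cases "i < length w")
      case True
      have "?E = cyl w \<inter> {x\<in>space M. \<forall>n\<ge>length w. coding T \<alpha> x n \<noteq> w ! i}"
        using cyl_subset_space by auto
      also have "\<dots> \<in> sets M" by (intro sets.Int cyl_measurable) measurable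
      finally have "?E \<in> null_sets \<mu>"
        using last_occurrence_null[OF good w True] sets_mu by (intro null_setsI) auto
      then have "AE x in \<mu>. x \<notin> ?E" by (rule AE_not_in)
      then show ?thesis by eventually_elim simp
    qed simp
  qed
  show ?thesis
    unfolding recurrent_measure_def
  proof
    fix a assume a: "a \<in> \<alpha>"
    show "AE x in \<mu>. visits T a x \<in> {0, \<infinity>}"
      using last AE_space
    proof eventually_elim
      case (elim x)
      then have x: "x \<in> space M" by (simp add: space_mu)
      have "{n. coding T \<alpha> x n = a} = {}" if fin: "finite {n. coding T \<alpha> x n = a}"
      proof (rule ccontr)
        assume "{n. coding T \<alpha> x n = a} \<noteq> {}"
        then obtain i where i: "coding T \<alpha> x i = a" by blast
        obtain u where u: "u \<in> good_words" "x \<in> cyl u" using good[OF x] by blast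
        obtain m where m: "\<And>n. coding T \<alpha> x n = a \<Longrightarrow> n < m"
          using fin unfolding finite_nat_iff_bounded by blast
        let ?n = "max m (length u)"
        let ?w = "map (coding T \<alpha> x) [0..<?n]"
        have "?w \<in> good_words" by (rule good_prefix[OF u]) simp
        moreover have "i < length ?w" using m[OF i] by simp
        ultimately have "x \<notin> {x\<in>cyl ?w. \<forall>n\<ge>length ?w. coding T \<alpha> x n \<noteq> ?w ! i}" using elim(1) by blast
        moreover have "x \<in> cyl ?w" using x by (simp add: cyl_def)
        moreover have "?w ! i = a" using m[OF i] i by simp
        ultimately obtain n where "n \<ge> ?n" "coding T \<alpha> x n = a" by auto
        then show False using m by fastforce
      qed
      then show ?case
        unfolding visits_eq[OF x a] by (cases "finite {n. coding T \<alpha> x n = a}") auto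
    qed
  qed
qed

end

section \<open>The representation theorem\<close>

theorem proposition2p2:
  fixes M \<mu> :: "'a measure" and T :: "'a \<Rightarrow> 'a" and \<alpha> :: "'a set set"
  assumes "full_fibred_system M T \<alpha>"
    and "sets \<mu> = sets M"
    and "sigma_finite_measure \<mu>"
    and "relation_invariant (exchangeable_relation M T \<alpha>) \<mu>"
  shows "(topologically_sigma_finite (cylinder_topology M T \<alpha>) \<mu> \<and> recurrent_measure T \<alpha> \<mu> \<longrightarrow>
            is_mixture (product_measure M T \<alpha>) \<mu>) \<and>
         (locally_finite_measure (cylinder_topology M T \<alpha>) \<mu> \<longrightarrow>
            recurrent_measure T \<alpha> \<mu> \<and> is_mixture (product_measure M T \<alpha>) \<mu>)"
proof -
  interpret full_fibred_system M T \<alpha> by (rule assms(1))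
  interpret exchangeable_measure M T \<alpha> \<mu>
    by unfold_locales (fact assms)+
  let ?S = "cylinder_topology M T \<alpha>"
  have mix: "is_mixture (product_measure M T \<alpha>) \<mu>"
    if top: "topologically_sigma_finite ?S \<mu>" and rec: "recurrent_measure T \<alpha> \<mu>"
  proof (rule mixture[OF rec _ assms(3)])
    obtain Y where Y: "Y \<in> sets \<mu>" "emeasure \<mu> (space \<mu> - Y) = 0"
        "locally_finite_measure (subtopology ?S Y) \<mu>"
      using top unfolding topologically_sigma_finite_def by blast
    then have null: "space \<mu> - Y \<in> null_sets \<mu>" by auto
    show "AE x in \<mu>. \<exists>w\<in>good_words. x \<in> cyl w"
      using AE_not_in[OF null] AE_space
    proof eventually_elim
      case (elim x)
      then have "x \<in> Y" by blast
      then show ?case using locally_finite_good[of Y x] Y sets_mu space_mu by simp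
    qed
  qed
  have loc: "topologically_sigma_finite ?S \<mu> \<and> recurrent_measure T \<alpha> \<mu>"
    if loc: "locally_finite_measure ?S \<mu>"
  proof
    have sub: "subtopology ?S (space M) = ?S"
      using subtopology_topspace[of ?S] by (simp add: topspace_cylinder_topology)
    show "topologically_sigma_finite ?S \<mu>"
      unfolding topologically_sigma_finite_def
      using loc sub sets_mu space_mu by (intro bexI[of _ "space M"]) auto
    show "recurrent_measure T \<alpha> \<mu>"
      using loc sub by (intro locally_finite_imp_recurrent locally_finite_good[of "space M"]) auto
  qed
  show ?thesis using mix loc by blast
qed

end
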